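(* Let $(A(n))_{n\ge1}$ be an i.i.d. sequence of random topical operators on $\mathbb R^d$ with the memory loss property, and let $\phi:\mathbb R^d\to\mathbb R$ be topical. Assume that $\sup_x|\phi(A(1)x)-\phi(x)|$ has an exponential moment (i.e. $\mathbb E[e^{\theta\sup_x|\phi(A(1)x)-\phi(x)|}]<\infty$ for some $\theta>0$), and that $\sigma^2>0$, where $\sigma^2$ is the constant such that $\frac{x(n,X^0)-n\gamma\mathbf 1}{\sqrt n}$ converges weakly to a random vector with equal coordinates of law $\mathcal N(0,\sigma^2)$. Then there exists a nonnegative strictly convex function $c$, defined on a neighbourhood of $0$ and vanishing only at $0$, such that for every bounded $\mathbb R^d$-valued random variable $X^0$ independent of $(A(n))$ and every sufficiently small $\epsilon>0$: $$\lim_n\frac1n\ln\mathbb P[\phi(x(n,X^0))-n\gamma>n\epsilon]=-c(\epsilon),\qquad \lim_n\frac1n\ln\mathbb P[\phi(x(n,X^0))-n\gamma<-n\epsilon]=-c(-\epsilon).$$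
   Context: A map $A:\mathbb R^d\to\mathbb R^d$ is topical if it is isotone ($x\le y$ coordinatewise implies $Ax\le Ay$) and additively homogeneous ($A(x+a\mathbf 1)=Ax+a\mathbf 1$, $\mathbf 1=(1,\dots,1)'$). A map $\phi:\mathbb R^d\to\mathbb R$ is topical if isotone and $\phi(x+a\mathbf 1)=\phi(x)+a$. $\mathbb{PR}^d_{\max}$ is the quotient of $\mathbb R^d$ by $x\sim y\iff x-y\in\mathbb R\mathbf 1$, $\bar x$ the class of $x$. $A$ has rank 1 if $\overline{Ax}$ does not depend on $x$. The sequence has the memory loss property if some $A(N)\cdots A(1)$ has rank 1 with positive probability. $x(0,X^0)=X^0$, $x(n,X^0)=A(n)x(n-1,X^0)$; $\gamma$ is the Lyapunov exponent ($x(n,X^0)/n\to\gamma\mathbf 1$ a.s.). *)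

theory Defs
  imports "HOL-Analysis.Analysis" "HOL-Probability.Probability"
begin

definition one_vec :: "real ^ 'd" where
  "one_vec = (\<chi> i. 1)"

definition vle :: "real ^ 'd \<Rightarrow> real ^ 'd \<Rightarrow> bool" where
  "vle x y \<longleftrightarrow> (\<forall>i. x $ i \<le> y $ i)"

definition topical_op :: "(real ^ 'd \<Rightarrow> real ^ 'd) \<Rightarrow> bool" where
  "topical_op F \<longleftrightarrow> (\<forall>x y. vle x y \<longrightarrow> vle (F x) (F y)) \<and>
     (\<forall>x a. F (x + a *\<^sub>R one_vec) = F x + a *\<^sub>R one_vec)"

definition topical_fun :: "(real ^ 'd \<Rightarrow> real) \<Rightarrow> bool" where
  "topical_fun f \<longleftrightarrow> (\<forall>x y. vle x y \<longrightarrow> f x \<le> f y) \<and>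
     (\<forall>x a. f (x + a *\<^sub>R one_vec) = f x + a)"

text \<open>Rank 1: the class of F x in the projective space PR^d does not depend on x.\<close>
definition rank1 :: "(real ^ 'd \<Rightarrow> real ^ 'd) \<Rightarrow> bool" where
  "rank1 F \<longleftrightarrow> (\<forall>x y. \<exists>a. F x - F y = a *\<^sub>R one_vec)"

abbreviation op_space :: "(real ^ 'd \<Rightarrow> real ^ 'd) measure" where
  "op_space \<equiv> PiM UNIV (\<lambda>_. borel)"

fun prodA :: "(nat \<Rightarrow> 'w \<Rightarrow> real ^ 'd \<Rightarrow> real ^ 'd) \<Rightarrow> 'w \<Rightarrow> nat \<Rightarrow> real ^ 'd \<Rightarrow> real ^ 'd" where
  "prodA A \<omega> 0 = id"
| "prodA A \<omega> (Suc n) = A (Suc n) \<omega> \<circ> prodA A \<omega> n"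

fun xseq :: "(nat \<Rightarrow> 'w \<Rightarrow> real ^ 'd \<Rightarrow> real ^ 'd) \<Rightarrow> ('w \<Rightarrow> real ^ 'd) \<Rightarrow> nat \<Rightarrow> 'w \<Rightarrow> real ^ 'd" where
  "xseq A X0 0 \<omega> = X0 \<omega>"
| "xseq A X0 (Suc n) \<omega> = A (Suc n) \<omega> (xseq A X0 n \<omega>)"

definition weak_conv_measures :: "(nat \<Rightarrow> 'a::metric_space measure) \<Rightarrow> 'a measure \<Rightarrow> bool" where
  "weak_conv_measures \<mu>s \<mu> \<longleftrightarrow>
     (\<forall>f :: 'a \<Rightarrow> real. continuous_on UNIV f \<and> bounded (range f) \<longrightarrow>
        (\<lambda>n. \<integral>x. f x \<partial>(\<mu>s n)) \<longlonglongrightarrow> (\<integral>x. f x \<partial>\<mu>))"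

definition strict_convex_on :: "real set \<Rightarrow> (real \<Rightarrow> real) \<Rightarrow> bool" where
  "strict_convex_on S f \<longleftrightarrow> convex S \<and>
     (\<forall>x\<in>S. \<forall>y\<in>S. \<forall>t. x \<noteq> y \<and> 0 < t \<and> t < 1 \<longrightarrow>
        f ((1 - t) * x + t * y) < (1 - t) * f x + t * f y)"

end

theory Submission
  imports Defs "HOL-Real_Asymp.Real_Asymp"
begin

text \<open>
  Represent projective classes by vectors \<open>y\<close> with \<open>\<phi> y = 0\<close>. Then \<open>\<phi> (x(n))\<close> is an additive functional of
  a Markov chain, and its Laplace transform at \<open>t\<close> is the \<open>n\<close>-th iterate of the positive operator
  \<open>f \<mapsto> E[exp (t (\<phi> (A x) - \<phi> x)) f (proj (A x))]\<close> on bounded continuous functions. When a product of \<open>N\<close>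
  operators has rank 1 the chain forgets its starting point, so the \<open>N\<close>-th iterate \<open>T t\<close> satisfies a Doeblin
  condition on the whole space: \<open>T t = Q t + \<nu> 1\<close> with a fixed positive functional \<open>\<nu>\<close> and a positive
  operator \<open>Q t\<close> whose norm stays below the leading eigenvalue for small \<open>t\<close>. That eigenvalue solves the
  scalar renewal equation \<open>\<nu> ((\<lambda> - Q t)\<^sup>-\<^sup>1 1) = 1\<close>. It has an eigenfunction bounded away from \<open>0\<close>
  and, by a first-order perturbation argument, depends differentiably on \<open>t\<close>. Hence the cumulants
  \<open>1/n ln E exp (t (\<phi> (x(n)) - n \<gamma>))\<close> converge, with error \<open>O(1/n)\<close>, to a differentiable function \<open>\<Lambda>\<close>
  near \<open>0\<close>. By the central limit theorem with \<open>\<sigma>\<^sup>2 > 0\<close> these Laplace transforms tend to infinity for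
  \<open>t \<noteq> 0\<close>, which forces \<open>\<Lambda> t > 0\<close>. The function \<open>c\<close> is the Legendre transform of \<open>\<Lambda>\<close> restricted to a
  compact interval, and the tail asymptotics are those of the Gaertner-Ellis theorem. A bounded initial
  value changes \<open>\<phi> (x(n))\<close> by a bounded amount only.
\<close>

section \<open>Legendre transforms and tail asymptotics\<close>

text \<open>The space of projective classes is not compact, so the eigenfunction cannot come from a
  compactness argument: it comes from a Neumann series and the intermediate value theorem in one
  real variable, and its lower bound from positivity. Uniformity in the starting point is supplied
  by the exponential moment of a supremum over all \<open>x\<close>; it makes the operators
  differentiable in operator norm on bounded continuous functions. Differentiability of the
  eigenvalue is a comparison of positive functions: a positive approximate eigenvector with relative
  error \<open>O(s^2)\<close> locates the eigenvalue up to \<open>O(s^2)\<close>. One derivative of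
  \<Lambda> is enough for the shape of \<open>c\<close>. Strict convexity of \<open>c\<close> is
  dual to smoothness of \<Lambda>: a point \<open>t\<close> can maximise
  \<open>t * e - \<Lambda> t\<close> for only one slope, \<open>e = \<Lambda>' t\<close>, so
  \<open>c\<close> has no affine pieces. It vanishes only at \<open>0\<close> because \<Lambda> has
  a minimum at \<open>0\<close> and therefore slope \<open>0\<close> there.\<close>

definition legendre :: "(real \<Rightarrow> real) \<Rightarrow> real \<Rightarrow> real \<Rightarrow> real" where
  "legendre L r e = (SUP t\<in>{-r..r}. t * e - L t)"

text \<open>This reflection reduces lower tails to upper tails of the negated variables.\<close>

lemma legendre_uminus: "legendre (\<lambda>t. L (- t)) r e = legendre L r (- e)"
proof -
  have "(\<lambda>t. t * e - L (- t)) ` {-r..r} = (\<lambda>t. t * (- e) - L t) ` (uminus ` {-r..r})"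
    unfolding image_image by (intro image_cong) auto
  then show ?thesis unfolding legendre_def by simp
qed

text \<open>\<open>\<delta>\<close> is a range of slopes: for
  \<open>\<bar>e\<bar> < \<delta>\<close> the line of slope \<open>e\<close> through the origin lies
  below \<open>L\<close> at \<open>t = r\<close> and at \<open>t = - r\<close>. This keeps the
  maximisers of \<open>t * e - L t\<close> off the endpoints, so that the restriction to
  \<open>{-r..r}\<close> does no harm for small \<open>e\<close>.\<close>

locale cumulant_limit =
  fixes L L' :: "real \<Rightarrow> real" and t0 r \<delta> :: real
  assumes r: "0 < r" "r < t0"
    and deriv: "\<And>t. \<bar>t\<bar> < t0 \<Longrightarrow> (L has_real_derivative L' t) (at t)"
    and zero: "L 0 = 0"
    and pos: "\<And>t. \<bar>t\<bar> < t0 \<Longrightarrow> t \<noteq> 0 \<Longrightarrow> 0 < L t"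
    and \<delta>: "0 < \<delta>" "\<delta> * r \<le> L r" "\<delta> * r \<le> L (- r)"
begin

lemma reflect: "cumulant_limit (\<lambda>t. L (- t)) (\<lambda>t. - L' (- t)) t0 r \<delta>"
proof
  fix t :: real assume "\<bar>t\<bar> < t0"
  then have "(L has_real_derivative L' (- t)) (at (- t))" using deriv[of "- t"] by simp
  then show "((\<lambda>t. L (- t)) has_real_derivative - L' (- t)) (at t)"
    by (simp add: DERIV_mirror)
qed (use r zero pos \<delta> in auto)

lemma nonneg: "\<bar>t\<bar> < t0 \<Longrightarrow> 0 \<le> L t"
  using pos[of t] zero by (cases "t = 0") (auto simp: less_imp_le)

lemma continuous: "continuous_on {-r..r} L"
proof (rule continuous_at_imp_continuous_on, rule ballI)
  fix t assume "t \<in> {-r..r}"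
  then have "\<bar>t\<bar> < t0" using r by auto
  then show "isCont L t" by (rule DERIV_isCont[OF deriv])
qed

lemma bdd: "bdd_above ((\<lambda>t. t * e - L t) ` {-r..r})"
  by (intro bounded_imp_bdd_above compact_imp_bounded compact_continuous_image
      continuous_intros continuous) auto

lemma legendre_upper: "\<bar>t\<bar> \<le> r \<Longrightarrow> t * e - L t \<le> legendre L r e"
  unfolding legendre_def by (intro cSUP_upper bdd) auto

text \<open>Compactness gives a maximiser. Its value is at least the value \<open>0\<close> at
  \<open>t = 0\<close>, whereas the objective is negative at the endpoints; an interior maximiser is
  a critical point.\<close>

lemma legendre_max:
  assumes "\<bar>e\<bar> < \<delta>"
  obtains t where "\<bar>t\<bar> < r" "L' t = e" "legendre L r e = t * e - L t"
proof -
  have "\<exists>t\<in>{-r..r}. \<forall>s\<in>{-r..r}. s * e - L s \<le> t * e - L t"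
    by (rule continuous_attains_sup) (use r in \<open>auto intro!: continuous_intros continuous\<close>)
  then obtain t where "t \<in> {-r..r}" and max: "\<forall>s\<in>{-r..r}. s * e - L s \<le> t * e - L t" by blast
  then have t: "\<bar>t\<bar> \<le> r" by auto
  have mx: "s * e - L s \<le> t * e - L t" if "\<bar>s\<bar> \<le> r" for s
    using max that by (auto simp: abs_le_iff)
  have nn: "0 \<le> t * e - L t" using mx[of 0] r zero by simp
  have "\<bar>t\<bar> \<noteq> r"
  proof
    assume *: "\<bar>t\<bar> = r"
    then have "\<delta> * r \<le> L t" using \<delta> r by (cases "t \<ge> 0") auto
    moreover have "t * e \<le> r * \<bar>e\<bar>" using * by (metis abs_ge_self abs_mult)
    moreover have "r * \<bar>e\<bar> < r * \<delta>" using assms r by simp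
    ultimately show False using nn by (simp add: mult.commute)
  qed
  with t have tr: "\<bar>t\<bar> < r" by simp
  have "((\<lambda>s. s * e - L s) has_real_derivative e - L' t) (at t)"
    using tr r by (auto intro!: derivative_eq_intros deriv)
  then have "e - L' t = 0"
    by (rule DERIV_local_max[of _ _ _ "r - \<bar>t\<bar>"]) (use tr mx in auto)
  moreover have "legendre L r e = t * e - L t"
    unfolding legendre_def
    by (intro cSup_eq_maximum) (use t mx in \<open>auto simp: abs_le_iff\<close>)
  ultimately show ?thesis using that tr by simp
qed

lemma legendre_nonneg: "0 \<le> legendre L r e"
  using legendre_upper[of 0 e] r zero by simp

text \<open>An interior \<open>t\<close> that attains the supremum is a critical point, so it can do
  so only for the slope \<open>e = L' t\<close>.\<close>

lemma legendre_gt: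
  assumes "\<bar>t\<bar> < r" "\<bar>e\<bar> < \<delta>" "L' t \<noteq> e"
  shows "t * e - L t < legendre L r e"
proof (rule ccontr)
  assume *: "\<not> ?thesis"
  have "((\<lambda>s. s * e - L s) has_real_derivative e - L' t) (at t)"
    using assms r by (auto intro!: derivative_eq_intros deriv)
  then have "e - L' t = 0"
  proof (rule DERIV_local_max[of _ _ _ "r - \<bar>t\<bar>"])
    show "\<forall>y. \<bar>t - y\<bar> < r - \<bar>t\<bar> \<longrightarrow> y * e - L y \<le> t * e - L t"
    proof (intro allI impI)
      fix y assume "\<bar>t - y\<bar> < r - \<bar>t\<bar>"
      then have "y * e - L y \<le> legendre L r e" by (intro legendre_upper) auto
      with * show "y * e - L y \<le> t * e - L t" by simp
    qed
  qed (use assms in auto)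
  with assms show False by simp
qed

lemma deriv_zero: "L' 0 = 0"
  by (rule DERIV_local_min[OF deriv, of 0 t0]) (use r zero nonneg in auto)

lemma legendre_eq_0_iff:
  assumes "\<bar>e\<bar> < \<delta>"
  shows "legendre L r e = 0 \<longleftrightarrow> e = 0"
proof
  assume "legendre L r e = 0"
  then show "e = 0"
    using legendre_gt[of 0 e] assms r zero deriv_zero by fastforce
next
  assume "e = 0"
  obtain t where "\<bar>t\<bar> < r" "legendre L r e = t * e - L t"
    using legendre_max[OF assms] by blast
  with \<open>e = 0\<close> have "legendre L r e \<le> 0" using nonneg[of t] r by auto
  then show "legendre L r e = 0" using legendre_nonneg[of e] by simp
qed

text \<open>The maximiser \<open>t\<close> at the intermediate point \<open>?z\<close> has
  \<open>L' t = ?z\<close>, so it is a maximiser for neither \<open>x\<close> nor \<open>y\<close>.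
  The affine function with value \<open>t * e - L t\<close> at \<open>e\<close> touches the
  transform at \<open>?z\<close> and lies strictly below it at \<open>x\<close> and
  \<open>y\<close>.\<close>

lemma strict_convex_legendre: "strict_convex_on {-\<delta><..<\<delta>} (legendre L r)"
  unfolding strict_convex_on_def
proof (intro conjI ballI allI impI)
  show "convex {-\<delta><..<\<delta>}" by simp
  fix x y s :: real assume x: "x \<in> {-\<delta><..<\<delta>}" and y: "y \<in> {-\<delta><..<\<delta>}" and s: "x \<noteq> y \<and> 0 < s \<and> s < 1"
  let ?z = "(1 - s) * x + s * y"
  have "?z \<in> {-\<delta><..<\<delta>}"
    using convexD_alt[of "{-\<delta><..<\<delta>}" x y s] x y s by simp
  then have "\<bar>?z\<bar> < \<delta>" by auto
  then obtain t where t: "\<bar>t\<bar> < r" "L' t = ?z" "legendre L r ?z = t * ?z - L t"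
    by (rule legendre_max)
  have "?z - x = s * (y - x)" "y - ?z = (1 - s) * (y - x)" by (simp_all add: algebra_simps)
  then have ne: "?z \<noteq> x" "?z \<noteq> y" using s by (metis diff_self mult_eq_0_iff right_minus_eq less_irrefl)+
  have *: "\<bar>x\<bar> < \<delta>" "\<bar>y\<bar> < \<delta>" using x y by auto
  have "t * x - L t < legendre L r x" "t * y - L t < legendre L r y"
    using legendre_gt[OF t(1) *(1)] legendre_gt[OF t(1) *(2)] t(2) ne by auto
  then have "(1 - s) * (t * x - L t) + s * (t * y - L t)
      < (1 - s) * legendre L r x + s * legendre L r y"
    using s by (intro add_strict_mono mult_strict_left_mono) auto
  also have "(1 - s) * (t * x - L t) + s * (t * y - L t) = t * ?z - L t"
    by (simp add: algebra_simps)
  finally show "legendre L r ?z < (1 - s) * legendre L r x + s * legendre L r y"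
    using t by simp
qed

text \<open>The maximiser at \<open>x\<close> has modulus below \<open>r\<close> and competes at
  \<open>y\<close>. This bounds the cost of shifting \<open>e\<close> in the lower tail
  estimate.\<close>

lemma legendre_lipschitz:
  assumes "\<bar>x\<bar> < \<delta>"
  shows "legendre L r x \<le> legendre L r y + r * \<bar>x - y\<bar>"
proof -
  obtain t where t: "\<bar>t\<bar> < r" "legendre L r x = t * x - L t"
    using legendre_max[OF assms] by blast
  have "\<bar>t * (x - y)\<bar> \<le> r * \<bar>x - y\<bar>"
    using t(1) unfolding abs_mult by (intro mult_right_mono) auto
  then have "t * (x - y) \<le> r * \<bar>x - y\<bar>" by linarith
  moreover have "t * y - L t \<le> legendre L r y" using t by (intro legendre_upper) auto
  ultimately show ?thesis using t by (simp add: algebra_simps)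
qed

end

section \<open>Tail probabilities by exponential tilting\<close>

locale gaertner_ellis = prob_space M + cumulant_limit L L' t0 r \<delta>
  for M :: "'w measure" and L L' t0 r \<delta> +
  fixes Y :: "nat \<Rightarrow> 'w \<Rightarrow> real"
  assumes meas[measurable]: "\<And>n. Y n \<in> borel_measurable M"
    and int: "\<And>n t. \<bar>t\<bar> < t0 \<Longrightarrow> integrable M (\<lambda>\<omega>. exp (t * Y n \<omega>))"
    and lim: "\<And>t. \<bar>t\<bar> < t0 \<Longrightarrow> (\<lambda>n. ln (expectation (\<lambda>\<omega>. exp (t * Y n \<omega>))) / real n) \<longlonglongrightarrow> L t"
begin

abbreviation mgf :: "nat \<Rightarrow> real \<Rightarrow> real" where
  "mgf n t \<equiv> expectation (\<lambda>\<omega>. exp (t * Y n \<omega>))"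

lemma mgf_pos: "\<bar>t\<bar> < t0 \<Longrightarrow> 0 < mgf n t"
proof -
  assume "\<bar>t\<bar> < t0"
  from int[OF this, of n] have "mgf n t = 0 \<longleftrightarrow> (AE \<omega> in M. exp (t * Y n \<omega>) = 0)"
    by (intro integral_nonneg_eq_0_iff_AE) auto
  then have "mgf n t \<noteq> 0" by simp
  moreover have "0 \<le> mgf n t" by simp
  ultimately show ?thesis by linarith
qed

lemma mgf_upper:
  assumes "\<bar>t\<bar> < t0" "L t < a"
  shows "eventually (\<lambda>n. mgf n t \<le> exp (real n * a)) sequentially"
  using order_tendstoD(2)[OF lim[OF assms(1)] assms(2)] eventually_gt_at_top[of 0]
proof eventually_elim
  case (elim n)
  then have "ln (mgf n t) < real n * a" by (simp add: field_simps)
  then show ?case using mgf_pos[OF assms(1), of n] by (metis exp_ln exp_less_mono less_imp_le)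
qed

lemma mgf_lower:
  assumes "\<bar>t\<bar> < t0" "a < L t"
  shows "eventually (\<lambda>n. exp (real n * a) \<le> mgf n t) sequentially"
  using order_tendstoD(1)[OF lim[OF assms(1)] assms(2)] eventually_gt_at_top[of 0]
proof eventually_elim
  case (elim n)
  then have "real n * a < ln (mgf n t)" by (simp add: field_simps)
  then show ?case using mgf_pos[OF assms(1), of n] by (metis exp_ln exp_less_mono less_imp_le)
qed

text \<open>Chernoff's bound under the measure tilted by \<open>exp (t * Y n)\<close>; the sign of
  \<open>s\<close> selects the side of \<open>n * b\<close>. The factor \<open>1 / 4\<close> is
  chosen so that two such tails leave at least half of the tilted mass.\<close>

lemma tilted_tail:
  assumes t: "\<bar>t\<bar> < t0" "\<bar>t + s\<bar> < t0" and less: "L (t + s) - s * b < L t"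
  shows "eventually (\<lambda>n. expectation (\<lambda>\<omega>. exp (t * Y n \<omega>) *
      indicator {\<omega>\<in>space M. 0 \<le> s * (Y n \<omega> - real n * b)} \<omega>) \<le> mgf n t / 4) sequentially"
proof -
  \<comment> \<open>A third of the gap: one \<open>d\<close> is lost in the upper estimate at
    \<open>t + s\<close>, one in the lower estimate at \<open>t\<close>, and one remains as the
    decay rate.\<close>
  define d where "d = (L t - (L (t + s) - s * b)) / 3"
  have d: "d > 0" using less by (simp add: d_def)
  have "eventually (\<lambda>n. mgf n (t + s) \<le> exp (real n * (L (t + s) + d))) sequentially"
    using d by (intro mgf_upper t) simp
  moreover have "eventually (\<lambda>n. exp (real n * (L t - d)) \<le> mgf n t) sequentially"
    using d by (intro mgf_lower t) simp
  moreover have "eventually (\<lambda>n. exp (- (real n * d)) \<le> 1 / 4) sequentially"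
    using d by real_asymp
  ultimately show ?thesis
  proof eventually_elim
    case (elim n)
    have "expectation (\<lambda>\<omega>. exp (t * Y n \<omega>) *
      indicator {\<omega>\<in>space M. 0 \<le> s * (Y n \<omega> - real n * b)} \<omega>)
      \<le> expectation (\<lambda>\<omega>. exp (- s * real n * b) * exp ((t + s) * Y n \<omega>))"
    proof (intro integral_mono integrable_mult_right int t)
      show "integrable M (\<lambda>\<omega>. exp (t * Y n \<omega>) *
        indicator {\<omega>\<in>space M. 0 \<le> s * (Y n \<omega> - real n * b)} \<omega>)"
        by (rule Bochner_Integration.integrable_bound[OF int[OF t(1), of n]]) (auto simp: indicator_def)
      fix \<omega>
      have "exp (t * Y n \<omega>) \<le> exp (- s * real n * b) * exp ((t + s) * Y n \<omega>)"
        if "0 \<le> s * (Y n \<omega> - real n * b)"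
        using that by (simp add: exp_add[symmetric] algebra_simps)
      then show "exp (t * Y n \<omega>) * indicator {\<omega>\<in>space M. 0 \<le> s * (Y n \<omega> - real n * b)} \<omega>
        \<le> exp (- s * real n * b) * exp ((t + s) * Y n \<omega>)"
        by (auto simp: indicator_def)
    qed
    also have "\<dots> = exp (- s * real n * b) * mgf n (t + s)" by simp
    also have "\<dots> \<le> exp (- s * real n * b) * exp (real n * (L (t + s) + d))"
      using elim by simp
    also have "\<dots> = exp (- (real n * d)) * exp (real n * (L t - d))"
      by (simp add: exp_add[symmetric] d_def field_simps)
    also have "\<dots> \<le> 1 / 4 * mgf n t"
      using elim by (intro mult_mono) auto
    finally show ?case by simp
  qed
qed

text \<open>A weak law of large numbers for the tilted measure: at least half of its mass lies where
  \<open>Y n / n\<close> is within \<open>\<eta>\<close> of \<open>e\<close>, and there the tilting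
  factor is under control. Of the loss \<open>\<eta> * (2 + \<bar>t\<bar>)\<close>, the share with
  \<open>\<bar>t\<bar>\<close> is the variation of that factor, one \<open>\<eta>\<close> is the
  error of \<open>mgf_lower\<close>, and one absorbs the factor \<open>1 / 2\<close>.\<close>

lemma local_lower:
  assumes t: "\<bar>t\<bar> < t0" and e: "L' t = e" and \<eta>: "0 < \<eta>"
  shows "eventually (\<lambda>n. exp (real n * (L t - t * e - \<eta> * (2 + \<bar>t\<bar>))) \<le>
    prob {\<omega>\<in>space M. \<bar>Y n \<omega> - real n * e\<bar> < real n * \<eta>}) sequentially"
proof -
  have D: "((\<lambda>s. L (t + s) - s * b) has_real_derivative e - b) (at 0)" for b
  proof -
    have "(L has_real_derivative e) (at (0 + t))" using deriv[OF t] e by simp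
    then have "((\<lambda>s. L (t + s)) has_real_derivative e) (at 0)"
      unfolding DERIV_shift by (simp add: add.commute)
    then show ?thesis by (auto intro!: derivative_eq_intros)
  qed
  \<comment> \<open>As a function of \<open>s\<close>, the left side equals \<open>L t\<close> at
    \<open>s = 0\<close> and has slope \<open>- \<eta>\<close> there, so a small positive
    \<open>s\<close> works. On the other side the slope is \<open>\<eta>\<close> and
    \<open>s\<close> is negative.\<close>
  have "\<exists>s>0. \<bar>t + s\<bar> < t0 \<and> L (t + s) - s * (e + \<eta>) < L t"
  proof -
    obtain d where d: "d > 0" "\<And>h. 0 < h \<Longrightarrow> h < d \<Longrightarrow> L (t + h) - h * (e + \<eta>) < L t"
      using DERIV_neg_dec_right[OF D[of "e + \<eta>"]] \<eta> by auto
    define s where "s = min (d / 2) ((t0 - \<bar>t\<bar>) / 2)"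
    have s: "0 < s" "s < d" "s \<le> (t0 - \<bar>t\<bar>) / 2" using d t min.cobounded2[of "d / 2" "(t0 - \<bar>t\<bar>) / 2"] by (auto simp: s_def simp del: min.cobounded2)
    have "\<bar>t + s\<bar> < t0" using abs_triangle_ineq[of t s] s t by (simp add: field_simps)
    with s show ?thesis using d by blast
  qed
  then obtain s1 where s1: "s1 > 0" "\<bar>t + s1\<bar> < t0" "L (t + s1) - s1 * (e + \<eta>) < L t" by blast
  have "\<exists>s<0. \<bar>t + s\<bar> < t0 \<and> L (t + s) - s * (e - \<eta>) < L t"
  proof -
    obtain d where d: "d > 0" "\<And>h. 0 < h \<Longrightarrow> h < d \<Longrightarrow> L (t + (0 - h)) - (0 - h) * (e - \<eta>) < L t"
      using DERIV_pos_inc_left[OF D[of "e - \<eta>"]] \<eta> by auto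
    define s where "s = min (d / 2) ((t0 - \<bar>t\<bar>) / 2)"
    have s: "0 < s" "s < d" "s \<le> (t0 - \<bar>t\<bar>) / 2" using d t min.cobounded2[of "d / 2" "(t0 - \<bar>t\<bar>) / 2"] by (auto simp: s_def simp del: min.cobounded2)
    have "\<bar>t + (0 - s)\<bar> < t0" using abs_triangle_ineq[of t "0 - s"] s t by (simp add: field_simps)
    with s show ?thesis using d(2)[of s] by (intro exI[of _ "- s"]) auto
  qed
  then obtain s2 where s2: "s2 < 0" "\<bar>t + s2\<bar> < t0" "L (t + s2) - s2 * (e - \<eta>) < L t" by blast
  have "eventually (\<lambda>n. exp (real n * (L t - \<eta>)) \<le> mgf n t) sequentially"
    using \<eta> by (intro mgf_lower t) simp
  moreover have "eventually (\<lambda>n. exp (- (real n * \<eta>)) \<le> 1 / 2) sequentially"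
    using \<eta> by real_asymp
  ultimately show ?thesis
    using tilted_tail[OF t s1(2,3)] tilted_tail[OF t s2(2,3)]
  proof eventually_elim
    case (elim n)
    let ?B = "{\<omega>\<in>space M. \<bar>Y n \<omega> - real n * e\<bar> < real n * \<eta>}"
    let ?I1 = "\<lambda>\<omega>. exp (t * Y n \<omega>) * indicator {\<omega>\<in>space M. 0 \<le> s1 * (Y n \<omega> - real n * (e + \<eta>))} \<omega>"
    let ?I2 = "\<lambda>\<omega>. exp (t * Y n \<omega>) * indicator {\<omega>\<in>space M. 0 \<le> s2 * (Y n \<omega> - real n * (e - \<eta>))} \<omega>"
    let ?K = "exp (real n * (t * e + \<bar>t\<bar> * \<eta>))"
    have i1: "integrable M ?I1" "integrable M ?I2"
      by (rule Bochner_Integration.integrable_bound[OF int[OF t, of n]]; auto simp: indicator_def)+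
    have "mgf n t \<le> expectation (\<lambda>\<omega>. ?I1 \<omega> + ?I2 \<omega> + ?K * indicator ?B \<omega>)"
    proof (intro integral_mono int t Bochner_Integration.integrable_add i1)
      show "integrable M (\<lambda>\<omega>. ?K * indicator ?B \<omega>)"
        by (intro integrable_mult_right integrable_real_indicator) (auto simp: emeasure_eq_measure)
      fix \<omega> assume \<omega>: "\<omega> \<in> space M"
      consider "real n * (e + \<eta>) \<le> Y n \<omega>" | "Y n \<omega> \<le> real n * (e - \<eta>)"
        | "\<bar>Y n \<omega> - real n * e\<bar> < real n * \<eta>"
        unfolding distrib_left right_diff_distrib by linarith
      then show "exp (t * Y n \<omega>) \<le> ?I1 \<omega> + ?I2 \<omega> + ?K * indicator ?B \<omega>"
      proof cases
        case 1
        then have "?I1 \<omega> = exp (t * Y n \<omega>)" using s1 \<omega> by simp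
        then show ?thesis by (simp add: indicator_def)
      next
        case 2
        then have "?I2 \<omega> = exp (t * Y n \<omega>)" using s2 \<omega> by (simp add: mult_nonpos_nonpos)
        then show ?thesis by (simp add: indicator_def)
      next
        case 3
        have "t * (Y n \<omega> - real n * e) \<le> \<bar>t\<bar> * \<bar>Y n \<omega> - real n * e\<bar>"
          by (metis abs_ge_self abs_mult)
        also have "\<dots> \<le> \<bar>t\<bar> * (real n * \<eta>)" using 3 by (intro mult_left_mono) auto
        finally have "t * Y n \<omega> \<le> real n * (t * e + \<bar>t\<bar> * \<eta>)"
          by (simp add: algebra_simps)
        then show ?thesis using 3 \<omega> by (simp add: indicator_def)
      qed
    qed
    also have "\<dots> = expectation ?I1 + expectation ?I2 + ?K * prob ?B"
      using i1 by (subst Bochner_Integration.integral_add)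
        (auto intro!: integrable_mult_right integrable_real_indicator simp: emeasure_eq_measure)
    also have "\<dots> \<le> mgf n t / 4 + mgf n t / 4 + ?K * prob ?B"
      using elim by simp
    finally have *: "mgf n t / 2 \<le> ?K * prob ?B" by simp
    have "?K * exp (real n * (L t - t * e - \<eta> * (2 + \<bar>t\<bar>)))
        = exp (- (real n * \<eta>)) * exp (real n * (L t - \<eta>))"
      by (simp add: exp_add[symmetric] algebra_simps)
    also have "\<dots> \<le> 1 / 2 * mgf n t" using elim by (intro mult_mono) auto
    also have "\<dots> \<le> ?K * prob ?B" using * by simp
    finally show ?case by simp
  qed
qed

lemma tail:
  assumes e: "0 < e" "e < \<delta>"
  shows "eventually (\<lambda>n. 0 < prob {\<omega>\<in>space M. real n * e < Y n \<omega>}) sequentially" (is ?pos)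
    and "(\<lambda>n. ln (prob {\<omega>\<in>space M. real n * e < Y n \<omega>}) / real n) \<longlonglongrightarrow> - legendre L r e" (is ?lim)
proof -
  let ?P = "\<lambda>n. prob {\<omega>\<in>space M. real n * e < Y n \<omega>}"
  have lower: "eventually (\<lambda>n. exp (real n * a) \<le> ?P n) sequentially" if a: "a < - legendre L r e" for a
  proof -
    \<comment> \<open>\<open>2 * r + 2\<close> adds up the losses per unit of \<open>\<eta>\<close>:
      \<open>r\<close> from the Lipschitz bound and at most \<open>2 + r\<close> from
      \<open>local_lower\<close>.\<close>
    define d where "d = (- legendre L r e - a) / (2 * r + 2)"
    have d: "d > 0" using a r by (simp add: d_def)
    \<comment> \<open>The window of radius \<open>\<eta>\<close> will be centred at
      \<open>e + \<eta>\<close>, so that it lies entirely above \<open>e\<close>. The second bound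
      keeps its centre below \<open>\<delta>\<close>, where maximisers are interior.\<close>
    define \<eta> where "\<eta> = min d ((\<delta> - e) / 2)"
    have \<eta>: "0 < \<eta>" "\<eta> \<le> d" "e + \<eta> < \<delta>" using d e by (auto simp: \<eta>_def min_def field_simps)
    obtain t where t: "\<bar>t\<bar> < r" "L' t = e + \<eta>" "legendre L r (e + \<eta>) = t * (e + \<eta>) - L t"
      using legendre_max[of "e + \<eta>"] \<eta> e by auto
    have "legendre L r (e + \<eta>) \<le> legendre L r e + r * \<eta>"
      using legendre_lipschitz[of "e + \<eta>" e] \<eta> e by simp
    moreover have "\<eta> * (2 + \<bar>t\<bar>) \<le> \<eta> * (2 + r)" using t \<eta> by simp
    moreover have "\<eta> * (2 * r + 2) \<le> d * (2 * r + 2)" using \<eta> r by (intro mult_right_mono) auto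
    moreover have "d * (2 * r + 2) = - legendre L r e - a" using r by (simp add: d_def)
    ultimately have a': "a \<le> L t - t * (e + \<eta>) - \<eta> * (2 + \<bar>t\<bar>)"
      using t(3) by (simp add: algebra_simps)
    have "\<bar>t\<bar> < t0" using t r by simp
    from local_lower[OF this t(2) \<eta>(1)] show ?thesis
    proof eventually_elim
      case (elim n)
      have "exp (real n * a) \<le> exp (real n * (L t - t * (e + \<eta>) - \<eta> * (2 + \<bar>t\<bar>)))"
        using a' by (simp add: mult_left_mono)
      also note elim
      also have "prob {\<omega> \<in> space M. \<bar>Y n \<omega> - real n * (e + \<eta>)\<bar> < real n * \<eta>} \<le> ?P n"
        by (intro finite_measure_mono) (auto simp: algebra_simps)
      finally show ?case .
    qed
  qed
  show pos: ?pos
    using lower[of "- legendre L r e - 1", simplified]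
    by eventually_elim (meson exp_gt_zero less_le_trans)
  obtain t where t: "\<bar>t\<bar> < r" "L' t = e" "legendre L r e = t * e - L t"
    using legendre_max[of e] e by auto
  have tt: "\<bar>t\<bar> < t0" using t r by simp
  \<comment> \<open>Markov's inequality for \<open>exp (t * Y n)\<close> controls an upper tail only
    when \<open>t \<ge> 0\<close>; a negative maximiser would make the transform negative.\<close>
  have tpos: "0 \<le> t"
  proof (rule ccontr)
    assume "\<not> 0 \<le> t"
    then have "t * e < 0" using e by (simp add: mult_less_0_iff)
    then show False using legendre_nonneg[of e] nonneg[OF tt] t(3) by simp
  qed
  have upper: "eventually (\<lambda>n. ?P n \<le> exp (real n * a)) sequentially" if a: "- legendre L r e < a" for a
  proof -
    have "L t < a + t * e" using a t by simp
    from mgf_upper[OF tt this] show ?thesis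
    proof eventually_elim
      case (elim n)
      have "exp (real n * (t * e)) * ?P n
        = expectation (\<lambda>\<omega>. exp (real n * (t * e)) * indicator {\<omega>\<in>space M. real n * e < Y n \<omega>} \<omega>)"
        by simp
      also have "\<dots> \<le> mgf n t"
      proof (intro integral_mono int tt)
        show "integrable M (\<lambda>\<omega>. exp (real n * (t * e)) * indicator {\<omega>\<in>space M. real n * e < Y n \<omega>} \<omega>)"
          by (intro integrable_mult_right integrable_real_indicator) (auto simp: emeasure_eq_measure)
        fix \<omega>
        have "real n * (t * e) \<le> t * Y n \<omega>" if "real n * e < Y n \<omega>"
          using mult_left_mono[OF less_imp_le[OF that] tpos] by (simp add: ac_simps)
        then show "exp (real n * (t * e)) * indicator {\<omega>\<in>space M. real n * e < Y n \<omega>} \<omega> \<le> exp (t * Y n \<omega>)"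
          by (auto simp: indicator_def)
      qed
      also have "\<dots> \<le> exp (real n * (t * e)) * exp (real n * a)"
        using elim by (simp add: exp_add[symmetric] algebra_simps)
      finally show ?case by simp
    qed
  qed
  show ?lim
  proof (rule order_tendstoI)
    fix a assume "a < - legendre L r e"
    then obtain b where b: "a < b" "b < - legendre L r e" using dense by blast
    show "eventually (\<lambda>n. a < ln (?P n) / real n) sequentially"
      using lower[OF b(2)] pos eventually_gt_at_top[of 0]
    proof eventually_elim
      case (elim n)
      then have "real n * b \<le> ln (?P n)" by (simp add: ln_ge_iff)
      then have "b \<le> ln (?P n) / real n" using elim by (simp add: field_simps)
      with b show ?case by simp
    qed
  next
    fix a assume "- legendre L r e < a"
    then obtain b where b: "- legendre L r e < b" "b < a" using dense by blast
    show "eventually (\<lambda>n. ln (?P n) / real n < a) sequentially"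
      using upper[OF b(1)] pos eventually_gt_at_top[of 0]
    proof eventually_elim
      case (elim n)
      then have "ln (?P n) \<le> real n * b" by (metis ln_exp ln_le_cancel_iff exp_gt_zero)
      then have "ln (?P n) / real n \<le> b" using elim by (simp add: field_simps)
      with b show ?case by simp
    qed
  qed
qed

end

section \<open>Positive operators with a Doeblin splitting\<close>

abbreviation one_bcontfun :: "'a::topological_space \<Rightarrow>\<^sub>C real" where
  "one_bcontfun \<equiv> const_bcontfun 1"

instance bcontfun :: (metric_space, banach) banach ..

lemma bounded_linear_apply_bcontfun: "bounded_linear (\<lambda>f :: 'a::metric_space \<Rightarrow>\<^sub>C real. f x)"
  by (intro bounded_linear_intro[where K = 1]) (use norm_bounded[where 'b = real] in auto)

lemma abs_apply_le_norm: "\<bar>apply_bcontfun f x\<bar> \<le> norm f"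
  using norm_bounded[of f x] by simp

lemma positive_linear_mono:
  fixes S :: "('a::metric_space \<Rightarrow>\<^sub>C real) \<Rightarrow> ('a \<Rightarrow>\<^sub>C real)" and f g :: "'a \<Rightarrow>\<^sub>C real"
  assumes S: "linear S" and pos: "\<And>f. (\<And>x. 0 \<le> apply_bcontfun f x) \<Longrightarrow> 0 \<le> apply_bcontfun (S f) y"
    and le: "\<And>x. apply_bcontfun f x \<le> apply_bcontfun g x"
  shows "apply_bcontfun (S f) y \<le> apply_bcontfun (S g) y"
proof -
  have "0 \<le> apply_bcontfun (S (g - f)) y" by (rule pos) (simp add: le)
  then show ?thesis by (simp add: linear_diff[OF S])
qed

text \<open>Collatz-Wielandt comparison. If \<open>k\<close> is the least constant with
  \<open>f \<le> k * g\<close>, one application of \<open>S\<close> improves it to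
  \<open>k * b / a\<close>, hence \<open>b / a \<ge> 1\<close>; the lower bound \<open>c\<close>
  makes \<open>k\<close> finite. An eigenfunction in the place of \<open>f\<close> has its
  eigenvalue bounded from above, in the place of \<open>g\<close> from below.\<close>

lemma positive_growth_le:
  fixes S :: "('a::metric_space \<Rightarrow>\<^sub>C real) \<Rightarrow> ('a \<Rightarrow>\<^sub>C real)" and f g :: "'a \<Rightarrow>\<^sub>C real"
  assumes S: "linear S" and pos: "\<And>f y. (\<And>x. 0 \<le> apply_bcontfun f x) \<Longrightarrow> 0 \<le> S f y"
    and c: "0 < c" "\<And>x. c \<le> apply_bcontfun f x" "\<And>x. c \<le> apply_bcontfun g x"
    and f: "\<And>x. a * f x \<le> S f x" and g: "\<And>x. S g x \<le> b * g x" and a: "0 < a"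
  shows "a \<le> b"
proof -
  define k where "k = (SUP x. f x / g x)"
  have gpos: "0 < g x" and fpos: "0 < f x" for x
    using c less_le_trans by blast+
  have "bdd_above (range (\<lambda>x. f x / g x))"
  proof (rule bdd_aboveI2)
    fix x
    have "f x \<le> norm f" using abs_apply_le_norm[of f x] by simp
    then show "f x / g x \<le> norm f / c"
      using c(1) c(2,3)[of x] by (intro frac_le) auto
  qed
  then have k: "f x / g x \<le> k" for x unfolding k_def by (intro cSUP_upper) auto
  obtain x0 :: 'a where True by simp
  have "0 < f x0 / g x0" using fpos gpos by simp
  then have kpos: "0 < k" using k[of x0] by linarith
  have le: "f x \<le> (k *\<^sub>R g) x" for x using k[of x] gpos[of x] by (simp add: field_simps)
  have "f x / g x \<le> k * b / a" for x
  proof -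
    have "a * f x \<le> S f x" by (rule f)
    also have "\<dots> \<le> S (k *\<^sub>R g) x" by (rule positive_linear_mono[OF S pos le])
    also have "\<dots> \<le> k * (b * g x)" using g[of x] kpos by (simp add: linear_scale[OF S])
    finally show ?thesis using gpos[of x] a by (simp add: field_simps)
  qed
  then have "k \<le> k * b / a" unfolding k_def by (intro cSUP_least) (auto simp: k_def[symmetric])
  then show ?thesis using kpos a by (simp add: field_simps)
qed

text \<open>The full operator is \<open>Q\<close> plus \<open>\<nu>\<close> times the constant
  \<open>1\<close>; it maps \<open>1\<close> to within \<open>\<delta> / 4\<close> of
  \<open>1\<close>, and removing the mass \<open>\<delta>\<close> leaves the fractions
  \<open>5 / 4\<close> and \<open>3 / 4\<close>. The norm of \<open>Q\<close> is then at most
  \<open>1 - 3 / 4 * \<delta>\<close>, below the range from \<open>1 - \<delta> / 4\<close> to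
  \<open>1 + \<delta> / 4\<close> in which the eigenvalue is sought.\<close>

locale doeblin =
  fixes Q :: "('a::metric_space \<Rightarrow>\<^sub>C real) \<Rightarrow> ('a \<Rightarrow>\<^sub>C real)"
    and \<nu> :: "('a \<Rightarrow>\<^sub>C real) \<Rightarrow> real" and \<delta> :: real
  assumes Q: "bounded_linear Q" and Q_nonneg: "\<And>f y. (\<And>x. 0 \<le> apply_bcontfun f x) \<Longrightarrow> 0 \<le> Q f y"
    and \<nu>: "bounded_linear \<nu>" and \<nu>_nonneg: "\<And>f. (\<And>x. 0 \<le> apply_bcontfun f x) \<Longrightarrow> 0 \<le> \<nu> f"
    and \<nu>_one: "\<nu> one_bcontfun = \<delta>" and \<delta>: "0 < \<delta>"
    and Q_lower: "\<And>x. 1 - 5 / 4 * \<delta> \<le> Q one_bcontfun x"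
    and Q_upper: "\<And>x. Q one_bcontfun x \<le> 1 - 3 / 4 * \<delta>"
begin

definition q :: real where "q = 1 - 3 / 4 * \<delta>"

lemma q: "0 \<le> q" "q < 1 - \<delta> / 2"
proof -
  have "0 \<le> Q one_bcontfun (undefined :: 'a)" by (rule Q_nonneg) simp
  then show "0 \<le> q" using Q_upper[of undefined] by (simp add: q_def)
  show "q < 1 - \<delta> / 2" using \<delta> by (simp add: q_def)
qed

lemma Q_linear: "linear Q" using Q by (rule bounded_linear.linear)
lemma \<nu>_linear: "linear \<nu>" using \<nu> by (rule bounded_linear.linear)

lemma norm_Q: "norm (Q f) \<le> q * norm f"
proof (rule norm_bound)
  fix y
  have "\<bar>Q f y\<bar> \<le> Q (norm f *\<^sub>R one_bcontfun) y"
  proof (rule abs_leI)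
    show "Q f y \<le> Q (norm f *\<^sub>R one_bcontfun) y"
      by (rule positive_linear_mono[OF Q_linear Q_nonneg]) (use abs_apply_le_norm[of f] in \<open>auto simp: abs_le_iff\<close>)
    have "Q (- f) y \<le> Q (norm f *\<^sub>R one_bcontfun) y"
      by (rule positive_linear_mono[OF Q_linear Q_nonneg]) (use abs_apply_le_norm[of f] in \<open>auto simp: abs_le_iff\<close>)
    then show "- Q f y \<le> Q (norm f *\<^sub>R one_bcontfun) y" by (simp add: linear_neg[OF Q_linear])
  qed
  also have "\<dots> \<le> norm f * q" unfolding q_def linear_scale[OF Q_linear]
    using Q_upper[of y] by (simp add: mult_left_mono)
  finally show "norm (Q f y) \<le> q * norm f" by (simp add: mult.commute)
qed

lemma norm_Q_pow: "norm ((Q ^^ j) f) \<le> q ^ j * norm f"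
proof (induction j)
  case (Suc j)
  have "norm ((Q ^^ Suc j) f) \<le> q * norm ((Q ^^ j) f)" using norm_Q by simp
  also have "\<dots> \<le> q * (q ^ j * norm f)" using Suc q by (intro mult_left_mono) auto
  finally show ?case by simp
qed simp

lemma Q_pow_linear: "linear (Q ^^ j)"
proof (induction j)
  case 0
  show ?case by (simp add: linear_ident id_def)
next
  case (Suc j)
  show ?case using linear_compose[OF Suc Q_linear] by (simp add: o_def)
qed

lemma Q_pow_nonneg: "(\<And>x. 0 \<le> apply_bcontfun f x) \<Longrightarrow> 0 \<le> (Q ^^ j) f y"
  by (induction j arbitrary: y) (auto intro: Q_nonneg)

text \<open>The Neumann series for the inverse of \<open>1 / z - Q\<close>. In the variable
  \<open>z\<close> it is a power series, so continuity in the spectral parameter reduces to that of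
  scalar power series.\<close>

definition R :: "real \<Rightarrow> ('a \<Rightarrow>\<^sub>C real) \<Rightarrow> ('a \<Rightarrow>\<^sub>C real)" where
  "R z f = (\<Sum>j. z ^ Suc j *\<^sub>R (Q ^^ j) f)"

context
  fixes z :: real
  assumes z: "0 < z" "z * q < 1"
begin

lemma R_summable: "summable (\<lambda>j. z ^ Suc j *\<^sub>R (Q ^^ j) f)"
proof (rule summable_comparison_test')
  show "summable (\<lambda>j. z * norm f * (z * q) ^ j)"
    using z q by (intro summable_mult summable_geometric) simp
  fix j
  have "norm (z ^ Suc j *\<^sub>R (Q ^^ j) f) \<le> z ^ Suc j * (q ^ j * norm f)"
    using z by (simp add: norm_Q_pow mult_left_mono)
  then show "norm (z ^ Suc j *\<^sub>R (Q ^^ j) f) \<le> z * norm f * (z * q) ^ j"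
    by (simp add: power_mult_distrib ac_simps)
qed

lemma Q_R: "Q (R z f) = R z (Q f)"
proof -
  have "Q (R z f) = (\<Sum>j. Q (z ^ Suc j *\<^sub>R (Q ^^ j) f))"
    unfolding R_def by (rule bounded_linear.suminf[OF Q R_summable])
  then show ?thesis by (simp add: R_def linear_scale[OF Q_linear] funpow_swap1)
qed

lemma R_eq: "R z f = z *\<^sub>R (f + Q (R z f))"
proof -
  have "R z f = z *\<^sub>R f + (\<Sum>j. z ^ Suc (Suc j) *\<^sub>R (Q ^^ Suc j) f)"
    unfolding R_def using suminf_split_head[OF R_summable[of f]] by simp
  also have "(\<Sum>j. z ^ Suc (Suc j) *\<^sub>R (Q ^^ Suc j) f) = (\<Sum>j. z *\<^sub>R (z ^ Suc j *\<^sub>R (Q ^^ j) (Q f)))"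
    by (simp add: funpow_swap1)
  also have "\<dots> = z *\<^sub>R R z (Q f)"
    unfolding R_def by (rule suminf_scaleR_right[OF R_summable, symmetric])
  finally show ?thesis unfolding Q_R scaleR_add_right .
qed

lemma R_scaleR: "R z (c *\<^sub>R f) = c *\<^sub>R R z f"
proof -
  have "R z (c *\<^sub>R f) = (\<Sum>j. c *\<^sub>R (z ^ Suc j *\<^sub>R (Q ^^ j) f))"
    by (simp add: R_def linear_scale[OF Q_pow_linear] ac_simps)
  also have "\<dots> = c *\<^sub>R R z f"
    unfolding R_def by (rule suminf_scaleR_right[OF R_summable, symmetric])
  finally show ?thesis .
qed

lemma R_diff: "R z (f - g) = R z f - R z g"
  unfolding R_def by (subst suminf_diff[OF R_summable R_summable])
    (simp add: linear_diff[OF Q_pow_linear] scaleR_diff_right)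

lemma R_nonneg:
  assumes "\<And>x. 0 \<le> apply_bcontfun f x"
  shows "0 \<le> R z f y"
proof -
  have "R z f y = (\<Sum>j. (z ^ Suc j *\<^sub>R (Q ^^ j) f) y)"
    unfolding R_def by (rule bounded_linear.suminf[OF bounded_linear_apply_bcontfun R_summable])
  also have "0 \<le> \<dots>"
    using z assms
    by (intro suminf_nonneg bounded_linear.summable[OF bounded_linear_apply_bcontfun R_summable])
      (auto intro!: mult_nonneg_nonneg Q_pow_nonneg)
  finally show ?thesis .
qed

lemma R_mono: "(\<And>x. apply_bcontfun f x \<le> apply_bcontfun g x) \<Longrightarrow> R z f y \<le> R z g y"
  using R_nonneg[of "g - f" y] by (simp add: R_diff)

lemma R_ge: "(\<And>x. 0 \<le> apply_bcontfun f x) \<Longrightarrow> z * f y \<le> R z f y"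
  using Q_nonneg[OF R_nonneg, of f y] z by (subst R_eq) (simp add: mult_left_mono)

lemma R_resolvent: "R z ((1 / z) *\<^sub>R f - Q f) = f"
proof -
  have "R z ((1 / z) *\<^sub>R f - Q f) = (1 / z) *\<^sub>R R z f - Q (R z f)"
    by (simp add: R_diff R_scaleR Q_R)
  also have "(1 / z) *\<^sub>R R z f = f + Q (R z f)"
    using z arg_cong[OF R_eq, of "scaleR (1 / z)" f] by simp
  finally show ?thesis by simp
qed

text \<open>\<open>R z\<close> is monotone and inverts \<open>1 / z - Q\<close>, so the pointwise
  bounds on \<open>Q\<close> at the constant \<open>1\<close> turn into bounds on \<open>R z\<close>
  at \<open>1\<close>.\<close>

lemma R_one_lower: "1 \<le> (1 / z - (1 - 5 / 4 * \<delta>)) * R z one_bcontfun y"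
proof -
  have "1 = R z ((1 / z) *\<^sub>R one_bcontfun - Q one_bcontfun) y" by (simp add: R_resolvent)
  also have "\<dots> \<le> R z ((1 / z - (1 - 5 / 4 * \<delta>)) *\<^sub>R one_bcontfun) y"
  proof (rule R_mono)
    show "((1 / z) *\<^sub>R one_bcontfun - Q one_bcontfun) x
        \<le> ((1 / z - (1 - 5 / 4 * \<delta>)) *\<^sub>R one_bcontfun) x" for x
      using Q_lower[of x] by simp
  qed
  finally show ?thesis by (simp add: R_scaleR)
qed

lemma R_one_upper: "(1 / z - q) * R z one_bcontfun y \<le> 1"
proof -
  have "R z ((1 / z - q) *\<^sub>R one_bcontfun) y \<le> R z ((1 / z) *\<^sub>R one_bcontfun - Q one_bcontfun) y"
  proof (rule R_mono)
    show "((1 / z - q) *\<^sub>R one_bcontfun) x \<le> ((1 / z) *\<^sub>R one_bcontfun - Q one_bcontfun) x" for x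
      using Q_upper[of x] by (simp add: q_def)
  qed
  also have "\<dots> = 1" by (simp add: R_resolvent)
  finally show ?thesis by (simp add: R_scaleR)
qed

text \<open>This makes the renewal equation an equation for a scalar power series, open to the
  intermediate value theorem.\<close>

lemma \<nu>_R: "\<nu> (R z f) = z * (\<Sum>j. \<nu> ((Q ^^ j) f) * z ^ j)"
proof -
  have s: "summable (\<lambda>j. z * (\<nu> ((Q ^^ j) f) * z ^ j))"
    using bounded_linear.summable[OF \<nu> R_summable[of f]]
    by (simp add: linear_scale[OF \<nu>_linear] ac_simps)
  have "\<nu> (R z f) = (\<Sum>j. \<nu> (z ^ Suc j *\<^sub>R (Q ^^ j) f))"
    unfolding R_def by (rule bounded_linear.suminf[OF \<nu> R_summable])
  also have "\<dots> = (\<Sum>j. z * (\<nu> ((Q ^^ j) f) * z ^ j))"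
    by (simp add: linear_scale[OF \<nu>_linear] ac_simps)
  also have "\<dots> = z * (\<Sum>j. \<nu> ((Q ^^ j) f) * z ^ j)"
    using s z by (intro suminf_mult) (simp add: summable_mult_D)
  finally show ?thesis .
qed

end

lemma \<nu>_mono: "(\<And>x. apply_bcontfun f x \<le> apply_bcontfun g x) \<Longrightarrow> \<nu> f \<le> \<nu> g"
  using \<nu>_nonneg[of "g - f"] by (simp add: linear_diff[OF \<nu>_linear])

lemma \<nu>_const: "\<nu> (c *\<^sub>R one_bcontfun) = c * \<delta>"
  by (simp add: linear_scale[OF \<nu>_linear] \<nu>_one)

text \<open>Here \<open>\<kappa> = 1 / z\<close> for the root \<open>z\<close> of the renewal equation \<open>\<nu> (R z 1) = 1\<close>, and
  \<open>h = R z 1\<close>. In the last conclusion \<open>l\<close> is chosen so that \<open>k = R z (w - l h)\<close> has \<open>\<nu> k = 0\<close>.\<close>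

lemma eigen:
  obtains \<kappa> h c where "0 < \<kappa>" "0 < c" "\<And>x. c \<le> apply_bcontfun h x"
    "Q h + \<nu> h *\<^sub>R one_bcontfun = \<kappa> *\<^sub>R h"
    "\<And>w. \<exists>k l. \<kappa> *\<^sub>R k - (Q k + \<nu> k *\<^sub>R one_bcontfun) = w - l *\<^sub>R h"
proof -
  \<comment> \<open>At \<open>1 / z1 = 1 + \<delta> / 4\<close> and
    \<open>1 / z2 = 1 - \<delta> / 4\<close> the bounds \<open>R_one_upper\<close> and
    \<open>R_one_lower\<close> compare \<open>R z\<close> at \<open>1\<close> with exactly
    \<open>1 / \<delta>\<close>, a constant on which \<open>\<nu>\<close> takes the value
    \<open>1\<close>; hence a root lies between them. Since \<open>1 / z3 = 1 - \<delta> / 2\<close>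
    still exceeds \<open>q\<close>, the series converges beyond \<open>z2\<close> and is continuous
    up to it.\<close>
  define z1 z2 z3 where "z1 = 1 / (1 + \<delta> / 4)" and "z2 = 1 / (1 - \<delta> / 4)" and "z3 = 1 / (1 - \<delta> / 2)"
  have d2: "0 < 1 - \<delta> / 2" using q by simp
  then have zz: "0 < z1" "z1 \<le> z2" "z2 < z3" using \<delta> by (auto simp: z1_def z2_def z3_def frac_le divide_strict_left_mono)
  have z3: "z3 * q < 1" using q d2 by (simp add: z3_def field_simps)
  have ok: "0 < z" "z * q < 1" if "z1 \<le> z" "z \<le> z2" for z
  proof -
    show "0 < z" using that zz by simp
    have "z * q \<le> z3 * q" using that zz q by (intro mult_right_mono) auto
    then show "z * q < 1" using z3 by simp
  qed
  let ?b = "\<lambda>j. \<nu> ((Q ^^ j) one_bcontfun)"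
  have "summable (\<lambda>j. z3 * (?b j * z3 ^ j))"
    using bounded_linear.summable[OF \<nu> R_summable[of z3 one_bcontfun]] zz z3
    by (simp add: linear_scale[OF \<nu>_linear] ac_simps)
  then have "summable (\<lambda>j. ?b j * z3 ^ j)" using zz by (simp add: summable_mult_D)
  then have cont: "isCont (\<lambda>z. \<Sum>j. ?b j * z ^ j) z" if "z1 \<le> z" "z \<le> z2" for z
    using that zz by (intro isCont_powser[where K = z3]) auto
  have "\<exists>z\<ge>z1. z \<le> z2 \<and> z * (\<Sum>j. ?b j * z ^ j) = 1"
  proof (rule IVT)
    have "\<nu> (R z1 one_bcontfun) \<le> \<nu> ((1 / \<delta>) *\<^sub>R one_bcontfun)"
    proof (rule \<nu>_mono)
      fix x
      show "R z1 one_bcontfun x \<le> ((1 / \<delta>) *\<^sub>R one_bcontfun) x"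
        using R_one_upper[of z1 x] ok[of z1] zz \<delta> by (simp add: z1_def q_def field_simps)
    qed
    then show "z1 * (\<Sum>j. ?b j * z1 ^ j) \<le> 1"
      using \<nu>_R[of z1 one_bcontfun] ok[of z1] zz \<delta> by (simp add: \<nu>_const)
    have "\<nu> ((1 / \<delta>) *\<^sub>R one_bcontfun) \<le> \<nu> (R z2 one_bcontfun)"
    proof (rule \<nu>_mono)
      fix x
      show "((1 / \<delta>) *\<^sub>R one_bcontfun) x \<le> R z2 one_bcontfun x"
        using R_one_lower[of z2 x] ok[of z2] zz \<delta> by (simp add: z2_def field_simps)
    qed
    then show "1 \<le> z2 * (\<Sum>j. ?b j * z2 ^ j)"
      using \<nu>_R[of z2 one_bcontfun] ok[of z2] zz \<delta> by (simp add: \<nu>_const)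
  qed (use zz cont in \<open>auto intro!: continuous_intros\<close>)
  then obtain z where z12: "z1 \<le> z" "z \<le> z2" and one: "z * (\<Sum>j. ?b j * z ^ j) = 1" by blast
  note z = ok[OF z12]
  let ?h = "R z one_bcontfun"
  have \<nu>h: "\<nu> ?h = 1" using \<nu>_R[OF z, of one_bcontfun] one by simp
  have h_ge: "z \<le> ?h x" for x using R_ge[OF z, of one_bcontfun x] by simp
  have QR: "Q (R z f) = (1 / z) *\<^sub>R R z f - f" for f
    using z arg_cong[OF R_eq[OF z], of "scaleR (1 / z)" f] by simp
  have "\<exists>k l. (1 / z) *\<^sub>R k - (Q k + \<nu> k *\<^sub>R one_bcontfun) = w - l *\<^sub>R ?h" for w
  proof -
    \<comment> \<open>This makes the denominator of \<open>l\<close> positive: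
      \<open>?h \<ge> z\<close>, and \<open>R z ?h \<ge> z * ?h\<close>.\<close>
    have "z * z * \<delta> = \<nu> ((z * z) *\<^sub>R one_bcontfun)" by (simp add: \<nu>_const)
    also have "\<dots> \<le> \<nu> (R z ?h)"
    proof (rule \<nu>_mono)
      fix x
      have "z * z \<le> z * ?h x" using h_ge z by (intro mult_left_mono) auto
      also have "\<dots> \<le> R z ?h x" using h_ge z by (intro R_ge[OF z]) (meson less_imp_le order_trans)
      finally show "((z * z) *\<^sub>R one_bcontfun) x \<le> R z ?h x" by simp
    qed
    finally have "\<nu> (R z ?h) > 0" using z \<delta> by (smt (verit) mult_pos_pos)
    define l where "l = \<nu> (R z w) / \<nu> (R z ?h)"
    let ?k = "R z (w - l *\<^sub>R ?h)"
    have "\<nu> ?k = 0" using \<open>\<nu> (R z ?h) > 0\<close>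
      by (simp add: R_diff[OF z] R_scaleR[OF z] linear_diff[OF \<nu>_linear] linear_scale[OF \<nu>_linear] l_def)
    then have "(1 / z) *\<^sub>R ?k - (Q ?k + \<nu> ?k *\<^sub>R one_bcontfun) = w - l *\<^sub>R ?h"
      by (simp add: QR)
    then show ?thesis by blast
  qed
  moreover have "Q ?h + \<nu> ?h *\<^sub>R one_bcontfun = (1 / z) *\<^sub>R ?h"
    by (simp add: \<nu>h QR)
  ultimately show ?thesis using that[of "1 / z" z ?h] z h_ge by auto
qed

end

section \<open>First-order perturbation of the leading eigenvalue\<close>

locale perturbed_doeblin =
  fixes T :: "real \<Rightarrow> ('a::metric_space \<Rightarrow>\<^sub>C real) \<Rightarrow> ('a \<Rightarrow>\<^sub>C real)"
    and \<nu> :: "('a \<Rightarrow>\<^sub>C real) \<Rightarrow> real" and \<delta> t0 :: real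
  assumes doeblin: "\<And>t. \<bar>t\<bar> < t0 \<Longrightarrow> doeblin (\<lambda>f. T t f - \<nu> f *\<^sub>R one_bcontfun) \<nu> \<delta>"
    and expansion: "\<And>t. \<bar>t\<bar> < t0 \<Longrightarrow> \<exists>T' C e. 0 < e \<and> 
      (\<forall>s f. \<bar>s\<bar> < e \<longrightarrow> norm (T (t + s) f - T t f - s *\<^sub>R T' f) \<le> C * s\<^sup>2 * norm f) \<and> linear T'"
begin

lemma T_linear: assumes "\<bar>t\<bar> < t0" shows "linear (T t)"
proof -
  interpret doeblin "\<lambda>f. T t f - \<nu> f *\<^sub>R one_bcontfun" \<nu> \<delta> by (rule doeblin[OF assms])
  have "linear (\<lambda>f. \<nu> f *\<^sub>R one_bcontfun)"
    using \<nu>_linear by (intro linearI) (simp_all add: linear_add linear_scale scaleR_add_left)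
  from linear_compose_add[OF Q_linear this] show ?thesis by simp
qed

lemma T_nonneg:
  assumes "\<bar>t\<bar> < t0" "\<And>x. 0 \<le> apply_bcontfun f x"
  shows "0 \<le> T t f y"
proof -
  interpret doeblin "\<lambda>f. T t f - \<nu> f *\<^sub>R one_bcontfun" \<nu> \<delta> by (rule doeblin[OF assms(1)])
  show ?thesis using Q_nonneg[OF assms(2), of y] \<nu>_nonneg[OF assms(2)] by simp
qed

lemma eigenvalue:
  assumes "\<bar>t\<bar> < t0"
  shows "\<exists>\<kappa>>0. \<exists>h c. 0 < c \<and> (\<forall>x. c \<le> apply_bcontfun h x) \<and> T t h = \<kappa> *\<^sub>R h \<and>
    (\<forall>w. \<exists>k l. \<kappa> *\<^sub>R k - T t k = w - l *\<^sub>R h)"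
proof -
  interpret doeblin "\<lambda>f. T t f - \<nu> f *\<^sub>R one_bcontfun" \<nu> \<delta> by (rule doeblin[OF assms])
  show ?thesis by (rule eigen, simp, blast)
qed

text \<open>The choice is made for each \<open>t\<close> separately, with no regularity built in;
  regularity follows because \<open>positive_growth_le\<close> pins down the eigenvalue of any
  eigenfunction bounded away from \<open>0\<close>. The last clause is a Fredholm condition: modulo
  \<open>h\<close>, every \<open>w\<close> lies in the range of
  \<open>\<kappa> - T t\<close>.\<close>

definition lam :: "real \<Rightarrow> real" where
  "lam t = (SOME \<kappa>. \<kappa> > 0 \<and> (\<exists>h c. 0 < c \<and> (\<forall>x. c \<le> apply_bcontfun h x) \<and> T t h = \<kappa> *\<^sub>R h \<and>
    (\<forall>w. \<exists>k l. \<kappa> *\<^sub>R k - T t k = w - l *\<^sub>R h)))"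

lemma lam:
  assumes "\<bar>t\<bar> < t0"
  shows "0 < lam t"
    and "\<exists>h c. 0 < c \<and> (\<forall>x. c \<le> apply_bcontfun h x) \<and> T t h = lam t *\<^sub>R h \<and>
      (\<forall>w. \<exists>k l. lam t *\<^sub>R k - T t k = w - l *\<^sub>R h)"
  using someI_ex[OF eigenvalue[OF assms]] unfolding lam_def by blast+

text \<open>Formal differentiation of \<open>T t h = lam t *\<^sub>R h\<close> gives
  \<open>lam t *\<^sub>R k - T t k = T' h - l *\<^sub>R h\<close>, with \<open>k\<close> and
  \<open>l\<close> the derivatives of eigenfunction and eigenvalue. The Fredholm condition supplies
  such a pair, and \<open>l\<close> is then verified to be the derivative.\<close>

lemma lam_differentiable:
  assumes t: "\<bar>t\<bar> < t0"
  shows "\<exists>D. (lam has_real_derivative D) (at t)"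
proof -
  obtain h c where c: "0 < c" "\<And>x. c \<le> apply_bcontfun h x" and h: "T t h = lam t *\<^sub>R h"
    and solve: "\<And>w. \<exists>k l. lam t *\<^sub>R k - T t k = w - l *\<^sub>R h"
    using lam(2)[OF t] by blast
  obtain T' C e where e: "0 < e" and T': "linear T'"
    and ex: "\<And>s f. \<bar>s\<bar> < e \<Longrightarrow> norm (T (t + s) f - T t f - s *\<^sub>R T' f) \<le> C * s\<^sup>2 * norm f"
    using expansion[OF t] by blast
  obtain k l where k: "lam t *\<^sub>R k - T t k = T' h - l *\<^sub>R h" using solve by blast
  \<comment> \<open>\<open>B * s\<^sup>2\<close> will bound the norm of the remainder
    \<open>\<rho>\<close>; division by the lower bound \<open>c / 2\<close> of \<open>u\<close>
    turns it into the relative error \<open>K * s\<^sup>2\<close>.\<close>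
  define B where "B = \<bar>C\<bar> * (norm h + norm k) + norm (T' k - l *\<^sub>R k)"
  define K where "K = 2 * B / c"
  have B: "0 \<le> B" by (simp add: B_def)
  \<comment> \<open>In order: validity of the expansion, the bound
    \<open>norm u \<le> norm h + norm k\<close>, \<open>t + s\<close> inside the domain, and
    \<open>u \<ge> c / 2\<close>.\<close>
  define e' where "e' = min (min e 1) (min (t0 - \<bar>t\<bar>) (c / (2 * (norm k + 1))))"
  have e': "0 < e'" using e t c by (auto simp: e'_def add_nonneg_pos)
  have main: "\<bar>lam (t + s) - lam t - s * l\<bar> \<le> K * s\<^sup>2" if s: "\<bar>s\<bar> < e'" for s
  proof -
    have s': "\<bar>s\<bar> < e" "\<bar>s\<bar> < 1" "\<bar>s\<bar> < t0 - \<bar>t\<bar>" "\<bar>s\<bar> < c / (2 * (norm k + 1))"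
      using s unfolding e'_def by simp_all
    have ts: "\<bar>t + s\<bar> < t0" using s'(3) abs_triangle_ineq[of t s] by linarith
    \<comment> \<open>By the choice of \<open>k\<close>, \<open>u\<close> is an eigenvector of \<open>T (t + s)\<close> for \<open>lam t + s * l\<close> up to \<open>O(s\<^sup>2)\<close>;
      positivity turns this into an estimate of the eigenvalue.\<close>
    define u where "u = h + s *\<^sub>R k"
    have u_ge: "c / 2 \<le> u x" for x
    proof -
      have "\<bar>s * k x\<bar> \<le> \<bar>s\<bar> * (norm k + 1)"
        using abs_apply_le_norm[of k x] by (simp add: abs_mult mult_left_mono)
      also have "\<dots> \<le> c / 2"
        using s'(4) norm_ge_zero[of k] by (simp add: field_simps)
      finally show ?thesis using c(2)[of x] by (simp add: u_def)
    qed
    define \<rho> where "\<rho> = T (t + s) u - (lam t + s * l) *\<^sub>R u"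
    have Ttk: "T t k = lam t *\<^sub>R k - T' h + l *\<^sub>R h" using k by (simp add: algebra_simps)
    have "\<rho> = (T (t + s) u - T t u - s *\<^sub>R T' u) + s\<^sup>2 *\<^sub>R (T' k - l *\<^sub>R k)"
      unfolding \<rho>_def u_def linear_add[OF T_linear[OF t]] linear_scale[OF T_linear[OF t]]
        linear_add[OF T'] linear_scale[OF T'] h Ttk
      by (simp add: algebra_simps power2_eq_square)
    then have "norm \<rho> \<le> C * s\<^sup>2 * norm u + s\<^sup>2 * norm (T' k - l *\<^sub>R k)"
      using ex[OF s'(1), of u] by (simp add: norm_triangle_le)
    also have "C * s\<^sup>2 * norm u \<le> \<bar>C\<bar> * s\<^sup>2 * (norm h + norm k)"
    proof -
      have "norm u \<le> norm h + \<bar>s\<bar> * norm k" unfolding u_def by (metis norm_scaleR norm_triangle_ineq)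
      also have "\<bar>s\<bar> * norm k \<le> 1 * norm k" using s'(2) by (intro mult_right_mono) auto
      finally have "norm u \<le> norm h + norm k" by simp
      then show ?thesis by (intro mult_mono) auto
    qed
    finally have \<rho>: "norm \<rho> \<le> B * s\<^sup>2" by (simp add: B_def algebra_simps)
    have \<rho>': "\<bar>T (t + s) u x - (lam t + s * l) * u x\<bar> \<le> K * s\<^sup>2 * u x" for x
    proof -
      have "\<bar>\<rho> x\<bar> \<le> B * s\<^sup>2" using \<rho> abs_apply_le_norm[of \<rho> x] by simp
      also have "\<dots> = K * s\<^sup>2 * (c / 2)" using c by (simp add: K_def)
      also have "\<dots> \<le> K * s\<^sup>2 * u x"
        using u_ge B c by (intro mult_left_mono) (auto simp: K_def)
      finally show ?thesis by (simp add: \<rho>_def)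
    qed
    obtain h' c' where c': "0 < c'" "\<And>x. c' \<le> apply_bcontfun h' x" and h': "T (t + s) h' = lam (t + s) *\<^sub>R h'"
      using lam(2)[OF ts] by blast
    have min: "0 < min c' (c / 2)" "\<And>x. min c' (c / 2) \<le> h' x" "\<And>x. min c' (c / 2) \<le> u x"
      using c c' u_ge by (auto simp: min.coboundedI1 min.coboundedI2)
    have "lam (t + s) \<le> lam t + s * l + K * s\<^sup>2"
    proof (rule positive_growth_le[OF T_linear[OF ts] T_nonneg[OF ts] min])
      show "lam (t + s) * h' x \<le> T (t + s) h' x" for x by (simp add: h')
      show "T (t + s) u x \<le> (lam t + s * l + K * s\<^sup>2) * u x" for x
        using \<rho>'[of x] by (simp add: algebra_simps abs_le_iff)
    qed (use lam(1)[OF ts] in auto)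
    moreover have "lam t + s * l - K * s\<^sup>2 \<le> lam (t + s)"
    \<comment> \<open>The comparison asks for a positive growth rate \<open>a\<close>; if the
      candidate is not positive, the bound follows from the positivity of
      \<open>lam\<close>.\<close>
    proof (cases "0 < lam t + s * l - K * s\<^sup>2")
      case True
      show ?thesis
      proof (rule positive_growth_le[OF T_linear[OF ts] T_nonneg[OF ts] min(1,3,2)])
        show "T (t + s) h' x \<le> lam (t + s) * h' x" for x by (simp add: h')
        show "(lam t + s * l - K * s\<^sup>2) * u x \<le> T (t + s) u x" for x
          using \<rho>'[of x] by (simp add: algebra_simps abs_le_iff)
      qed (use True in auto)
    qed (use lam(1)[OF ts] in auto)
    ultimately show ?thesis by (simp add: abs_le_iff)
  qed
  have "(\<lambda>s. (lam (t + s) - lam t) / s) \<midarrow>0\<rightarrow> l"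
  proof (rule LIM_zero_cancel, rule Lim_null_comparison)
    show "\<forall>\<^sub>F s in at 0. norm ((lam (t + s) - lam t) / s - l) \<le> K * \<bar>s\<bar>"
      unfolding eventually_at
    proof (intro exI[of _ e'] conjI ballI impI e')
      fix s :: real assume s: "s \<noteq> 0 \<and> dist s 0 < e'"
      then have "(lam (t + s) - lam t) / s - l = (lam (t + s) - lam t - s * l) / s"
        by (simp add: field_simps)
      then have "norm ((lam (t + s) - lam t) / s - l) = \<bar>lam (t + s) - lam t - s * l\<bar> / \<bar>s\<bar>"
        by simp
      also have "\<dots> \<le> K * s\<^sup>2 / \<bar>s\<bar>" using main[of s] s by (intro divide_right_mono) auto
      also have "\<dots> = K * \<bar>s\<bar>" using s by (simp add: power2_eq_square abs_if)
      finally show "norm ((lam (t + s) - lam t) / s - l) \<le> K * \<bar>s\<bar>" .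
    qed
    show "((\<lambda>s. K * \<bar>s\<bar>) \<longlongrightarrow> 0) (at 0)" by (auto intro!: tendsto_eq_intros)
  qed
  then show ?thesis unfolding DERIV_def by blast
qed

text \<open>Since \<open>h\<close> lies between \<open>c\<close> and \<open>norm h\<close>, the
  constant \<open>1\<close> lies between multiples of \<open>h\<close>, on which the powers of
  \<open>T t\<close> are explicit. That the factors do not depend on \<open>n\<close> is the source
  of the bounded error in the logarithms of the Laplace transforms.\<close>

lemma T_pow_bounds:
  assumes t: "\<bar>t\<bar> < t0"
  shows "\<exists>a>0. \<exists>b>0. \<forall>n x. a * lam t ^ n \<le> (T t ^^ n) one_bcontfun x \<and>
    (T t ^^ n) one_bcontfun x \<le> b * lam t ^ n"
proof -
  obtain h c where c: "0 < c" "\<And>x. c \<le> apply_bcontfun h x" and h: "T t h = lam t *\<^sub>R h"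
    using lam(2)[OF t] by blast
  have lin: "linear (T t ^^ n)" for n
  proof (induction n)
    case 0
    show ?case by (simp add: linear_ident id_def)
  next
    case (Suc n)
    show ?case using linear_compose[OF Suc T_linear[OF t]] by (simp add: o_def)
  qed
  have nn: "0 \<le> (T t ^^ n) f y" if "\<And>x. 0 \<le> apply_bcontfun f x" for n f y
    using that by (induction n arbitrary: y) (auto intro: T_nonneg[OF t])
  have hn: "(T t ^^ n) h = lam t ^ n *\<^sub>R h" for n
    by (induction n) (auto simp: h linear_scale[OF T_linear[OF t]])
  have nh: "0 < norm h" using c by (metis abs_apply_le_norm abs_ge_self less_le_trans order_trans)
  have "1 / norm h * c * lam t ^ n \<le> (T t ^^ n) one_bcontfun x" for n x
  proof -
    have "1 / norm h * c * lam t ^ n \<le> 1 / norm h * h x * lam t ^ n"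
      using c nh lam(1)[OF t] by (intro mult_right_mono mult_left_mono) auto
    also have "\<dots> = (T t ^^ n) ((1 / norm h) *\<^sub>R h) x"
      by (simp add: linear_scale[OF lin] hn)
    also have "\<dots> \<le> (T t ^^ n) one_bcontfun x"
    proof (rule positive_linear_mono[OF lin nn])
      show "((1 / norm h) *\<^sub>R h) x \<le> one_bcontfun x" for x
        using abs_apply_le_norm[of h x] nh by (simp add: field_simps)
    qed
    finally show ?thesis .
  qed
  moreover have "(T t ^^ n) one_bcontfun x \<le> norm h / c * lam t ^ n" for n x
  proof -
    have "(T t ^^ n) one_bcontfun x \<le> (T t ^^ n) ((1 / c) *\<^sub>R h) x"
      by (rule positive_linear_mono[OF lin nn]) (use c in \<open>auto simp: field_simps\<close>)
    also have "\<dots> = 1 / c * h x * lam t ^ n" by (simp add: linear_scale[OF lin] hn)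
    also have "\<dots> \<le> 1 / c * norm h * lam t ^ n"
      using c lam(1)[OF t] abs_apply_le_norm[of h x] by (intro mult_right_mono mult_left_mono) auto
    finally show ?thesis by simp
  qed
  ultimately show ?thesis using c nh
    by (intro exI[of _ "1 / norm h * c"] conjI exI[of _ "norm h / c"]) auto
qed

end

section \<open>Laplace kernels\<close>

lemma abs_exp_minus_1_le: "\<bar>exp y - 1\<bar> \<le> \<bar>y\<bar> * exp \<bar>y\<bar>" for y :: real
proof -
  obtain s where s: "\<bar>s\<bar> \<le> \<bar>y\<bar>" "exp y = (\<Sum>m<1. y ^ m / fact m) + exp s / fact 1 * y ^ 1"
    using Maclaurin_exp_le[of y 1] by blast
  then have "exp y - 1 = exp s * y" by simp
  moreover have "exp s \<le> exp \<bar>y\<bar>" using s by simp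
  ultimately show ?thesis by (simp add: abs_mult mult.commute mult_left_mono)
qed

lemma abs_exp_minus_linear_le: "\<bar>exp y - 1 - y\<bar> \<le> y\<^sup>2 * exp \<bar>y\<bar>" for y :: real
proof -
  obtain s where s: "\<bar>s\<bar> \<le> \<bar>y\<bar>" "exp y = (\<Sum>m<2. y ^ m / fact m) + exp s / fact 2 * y ^ 2"
    using Maclaurin_exp_le[of y 2] by blast
  then have eq: "exp y - 1 - y = y\<^sup>2 * (exp s / 2)" by (simp add: numeral_2_eq_2)
  have le: "exp s / 2 \<le> exp \<bar>y\<bar>"
  proof -
    have "exp s / 2 \<le> exp s" by simp
    also have "\<dots> \<le> exp \<bar>y\<bar>" using s by simp
    finally show ?thesis .
  qed
  have "\<bar>exp y - 1 - y\<bar> = y\<^sup>2 * (exp s / 2)" by (simp only: eq abs_mult) simp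
  with le show ?thesis by (simp only:) (rule mult_left_mono, auto)
qed

text \<open>A polynomial factor costs an arbitrarily small extra rate \<open>e\<close>, later taken
  from the gap between \<open>\<bar>t\<bar>\<close> and \<open>\<theta>\<close>.\<close>

lemma abs_le_exp: "0 < e \<Longrightarrow> \<bar>u\<bar> \<le> (1 / e) * exp (e * \<bar>u\<bar>)" for u e :: real
proof -
  assume e: "0 < e"
  have "e * \<bar>u\<bar> \<le> exp (e * \<bar>u\<bar>)" using exp_ge_add_one_self[of "e * \<bar>u\<bar>"] by linarith
  then show ?thesis using e by (simp add: field_simps)
qed

lemma square_le_exp: "0 < e \<Longrightarrow> u\<^sup>2 \<le> (2 / e\<^sup>2) * exp (e * \<bar>u\<bar>)" for u e :: real
proof -
  assume e: "0 < e"
  have "1 + e * \<bar>u\<bar> + (e * \<bar>u\<bar>)\<^sup>2 / 2 \<le> exp (e * \<bar>u\<bar>)"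
    using exp_lower_Taylor_quadratic[of "e * \<bar>u\<bar>"] e by simp
  moreover have "0 \<le> e * \<bar>u\<bar>" using e by simp
  ultimately have "(e * \<bar>u\<bar>)\<^sup>2 \<le> 2 * exp (e * \<bar>u\<bar>)" by linarith
  then show ?thesis using e by (simp add: field_simps power_mult_distrib)
qed

text \<open>One integrable \<open>Z\<close> dominates the exponential of \<open>U\<close> for all
  \<open>x\<close> simultaneously; this gives operator bounds on a space that need not be
  compact.\<close>

locale weighted_kernel = prob_space M
  for M :: "'w measure" +
  fixes U :: "'w \<Rightarrow> 'a::metric_space \<Rightarrow> real" and V :: "'w \<Rightarrow> 'a \<Rightarrow> 'a"
    and Z :: "'w \<Rightarrow> real" and \<theta> :: real
  assumes \<theta>: "0 < \<theta>"
    and U_meas[measurable]: "\<And>x. (\<lambda>\<omega>. U \<omega> x) \<in> borel_measurable M"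
    and V_meas[measurable]: "\<And>x. (\<lambda>\<omega>. V \<omega> x) \<in> borel_measurable M"
    and U_cont: "\<And>\<omega>. \<omega> \<in> space M \<Longrightarrow> continuous_on UNIV (U \<omega>)"
    and V_cont: "\<And>\<omega>. \<omega> \<in> space M \<Longrightarrow> continuous_on UNIV (V \<omega>)"
    and Z_int: "integrable M Z"
    and U_bound: "AE \<omega> in M. \<forall>x. exp (\<theta> * \<bar>U \<omega> x\<bar>) \<le> Z \<omega>"
begin

lemma norm_expectation_le:
  fixes f g :: "'w \<Rightarrow> real"
  assumes "integrable M f" "integrable M g" "AE \<omega> in M. norm (f \<omega>) \<le> g \<omega>"
  shows "norm (expectation f) \<le> expectation g"
proof -
  have "norm (expectation f) \<le> expectation (\<lambda>\<omega>. norm (f \<omega>))" by (rule integral_norm_bound)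
  also have "\<dots> \<le> expectation g" using assms by (intro integral_mono_AE) auto
  finally show ?thesis .
qed

text \<open>One class of weights holds \<open>exp (t * u)\<close>, its derivative in
  \<open>t\<close> and the Taylor remainder. \<open>C\<close> stays explicit because it controls the
  operator norm in \<open>norm_kop\<close>.\<close>

definition adm :: "(real \<Rightarrow> real) \<Rightarrow> real \<Rightarrow> bool" where
  "adm w C \<longleftrightarrow> continuous_on UNIV w \<and> (\<forall>u. \<bar>w u\<bar> \<le> C * exp (\<theta> * \<bar>u\<bar>))"

definition kop :: "(real \<Rightarrow> real) \<Rightarrow> ('a \<Rightarrow>\<^sub>C real) \<Rightarrow> ('a \<Rightarrow>\<^sub>C real)" where
  "kop w f = Bcontfun (\<lambda>x. expectation (\<lambda>\<omega>. w (U \<omega> x) * f (V \<omega> x)))"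

lemma Z_ge: "AE \<omega> in M. 1 \<le> Z \<omega>"
  using U_bound
proof eventually_elim
  case (elim \<omega>)
  have "1 \<le> exp (\<theta> * \<bar>U \<omega> undefined\<bar>)" using \<theta> by simp
  then show ?case using elim order_trans by blast
qed

lemma apply_bcontfun_meas[measurable]: "apply_bcontfun (f :: 'a \<Rightarrow>\<^sub>C real) \<in> borel_measurable borel"
  by (intro borel_measurable_continuous_onI) simp

lemma adm_nonneg: "adm w C \<Longrightarrow> 0 \<le> C"
  unfolding adm_def by (metis abs_ge_zero abs_zero exp_zero mult.right_neutral mult_zero_right order_trans)

lemma kernel_bound:
  assumes "adm w C"
  shows "AE \<omega> in M. \<forall>x. norm (w (U \<omega> x) * apply_bcontfun f (V \<omega> x)) \<le> C * norm f * Z \<omega>"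
  using U_bound
proof eventually_elim
  case (elim \<omega>)
  show ?case
  proof
    fix x
    have "norm (w (U \<omega> x) * f (V \<omega> x)) \<le> (C * exp (\<theta> * \<bar>U \<omega> x\<bar>)) * norm f"
      using assms adm_nonneg[OF assms] unfolding norm_mult adm_def
      by (intro mult_mono) (auto simp: abs_apply_le_norm)
    also have "\<dots> \<le> (C * Z \<omega>) * norm f"
      using elim adm_nonneg[OF assms] by (intro mult_right_mono mult_left_mono) auto
    finally show "norm (w (U \<omega> x) * f (V \<omega> x)) \<le> C * norm f * Z \<omega>" by (simp add: ac_simps)
  qed
qed

lemma kernel_meas:
  assumes "adm w C"
  shows "(\<lambda>\<omega>. w (U \<omega> x) * apply_bcontfun f (V \<omega> x)) \<in> borel_measurable M"
proof -
  have [measurable]: "w \<in> borel_measurable borel"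
    using assms by (intro borel_measurable_continuous_onI) (simp add: adm_def)
  show ?thesis by measurable
qed

lemma kernel_int:
  assumes "adm w C"
  shows "integrable M (\<lambda>\<omega>. w (U \<omega> x) * apply_bcontfun f (V \<omega> x))"
proof (rule Bochner_Integration.integrable_bound)
  show "integrable M (\<lambda>\<omega>. C * norm f * Z \<omega>)" using Z_int by simp
  show "AE \<omega> in M. norm (w (U \<omega> x) * f (V \<omega> x)) \<le> norm (C * norm f * Z \<omega>)"
    using kernel_bound[OF assms, of f]
    by eventually_elim (metis abs_ge_self order_trans real_norm_def)
qed (rule kernel_meas[OF assms])

lemma kop_bcontfun:
  assumes "adm w C"
  shows "(\<lambda>x. expectation (\<lambda>\<omega>. w (U \<omega> x) * apply_bcontfun f (V \<omega> x))) \<in> bcontfun"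
proof (rule bcontfun_normI)
  show "continuous_on UNIV (\<lambda>x. expectation (\<lambda>\<omega>. w (U \<omega> x) * apply_bcontfun f (V \<omega> x)))"
    unfolding continuous_on_sequentially
  proof (intro allI ballI impI, elim conjE)
    fix xs :: "nat \<Rightarrow> 'a" and x assume xs: "xs \<longlonglongrightarrow> x"
    show "((\<lambda>x. expectation (\<lambda>\<omega>. w (U \<omega> x) * apply_bcontfun f (V \<omega> x))) \<circ> xs)
      \<longlonglongrightarrow> expectation (\<lambda>\<omega>. w (U \<omega> x) * apply_bcontfun f (V \<omega> x))"
      unfolding o_def
    proof (rule integral_dominated_convergence)
      show "integrable M (\<lambda>\<omega>. C * norm f * Z \<omega>)" using Z_int by simp
      show "AE \<omega> in M. norm (w (U \<omega> (xs n)) * f (V \<omega> (xs n))) \<le> C * norm f * Z \<omega>" for n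
        using kernel_bound[OF assms, of f] by eventually_elim blast
      show "AE \<omega> in M. (\<lambda>n. w (U \<omega> (xs n)) * f (V \<omega> (xs n))) \<longlonglongrightarrow> w (U \<omega> x) * f (V \<omega> x)"
      proof (rule AE_I2)
        fix \<omega> assume \<omega>: "\<omega> \<in> space M"
        have w: "continuous_on UNIV w" using assms by (simp add: adm_def)
        have "(\<lambda>n. U \<omega> (xs n)) \<longlonglongrightarrow> U \<omega> x" "(\<lambda>n. V \<omega> (xs n)) \<longlonglongrightarrow> V \<omega> x"
          by (intro continuous_on_tendsto_compose[OF U_cont[OF \<omega>] xs]
            continuous_on_tendsto_compose[OF V_cont[OF \<omega>] xs]; simp)+
        then show "(\<lambda>n. w (U \<omega> (xs n)) * f (V \<omega> (xs n))) \<longlonglongrightarrow> w (U \<omega> x) * f (V \<omega> x)"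
          by (intro tendsto_mult continuous_on_tendsto_compose[OF w]
            continuous_on_tendsto_compose[OF continuous_on_apply_bcontfun[of UNIV f]]) auto
      qed
    qed (auto intro!: kernel_meas[OF assms])
  qed
  show "norm (expectation (\<lambda>\<omega>. w (U \<omega> x) * apply_bcontfun f (V \<omega> x))) \<le> expectation (\<lambda>\<omega>. C * norm f * Z \<omega>)" for x
    using kernel_bound[OF assms, of f] Z_int
    by (intro norm_expectation_le kernel_int[OF assms]) (auto elim: eventually_mono)
qed

lemma kop_apply:
  "adm w C \<Longrightarrow> apply_bcontfun (kop w f) x = expectation (\<lambda>\<omega>. w (U \<omega> x) * apply_bcontfun f (V \<omega> x))"
  unfolding kop_def by (subst Bcontfun_inverse[OF kop_bcontfun]) auto

lemma norm_kop:
  assumes "adm w C"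
  shows "norm (kop w f) \<le> C * expectation Z * norm f"
proof (rule norm_bound)
  fix x
  have "norm (kop w f x) \<le> expectation (\<lambda>\<omega>. C * norm f * Z \<omega>)"
    unfolding kop_apply[OF assms] using kernel_bound[OF assms, of f] Z_int
    by (intro norm_expectation_le kernel_int[OF assms]) (auto elim: eventually_mono)
  then show "norm (kop w f x) \<le> C * expectation Z * norm f" by (simp add: ac_simps)
qed

lemma kop_linear: "adm w C \<Longrightarrow> linear (kop w)"
  by (intro linearI bcontfun_eqI)
    (simp_all add: kop_apply kernel_int distrib_left mult.left_commute)

lemma kop_bounded_linear: 
  assumes "adm w C" shows "bounded_linear (kop w)"
  using kop_linear[OF assms] norm_kop[OF assms]
  by (intro bounded_linear_intro[where K = "C * expectation Z"])
    (auto simp: linear_add linear_scale ac_simps)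

text \<open>The Taylor remainder of the operators is itself a \<open>kop\<close>, with the scalar
  remainder as weight, so \<open>norm_kop\<close> estimates it.\<close>

lemma kop_lincomb:
  assumes "adm w C" "adm w' C'" "adm w'' C''" "adm (\<lambda>u. w u - w' u - a * w'' u) K"
  shows "kop (\<lambda>u. w u - w' u - a * w'' u) f = kop w f - kop w' f - a *\<^sub>R kop w'' f"
proof (rule bcontfun_eqI)
  fix x
  have "(w (U \<omega> x) - w' (U \<omega> x) - a * w'' (U \<omega> x)) * f (V \<omega> x) =
    w (U \<omega> x) * f (V \<omega> x) - w' (U \<omega> x) * f (V \<omega> x) - a * (w'' (U \<omega> x) * f (V \<omega> x))" for \<omega>
    by (simp add: algebra_simps)
  then show "kop (\<lambda>u. w u - w' u - a * w'' u) f x = (kop w f - kop w' f - a *\<^sub>R kop w'' f) x"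
    by (simp add: kop_apply[OF assms(1)] kop_apply[OF assms(2)] kop_apply[OF assms(3)]
      kop_apply[OF assms(4)] kernel_int[OF assms(1)] kernel_int[OF assms(2)] kernel_int[OF assms(3)])
qed

abbreviation laplace :: "real \<Rightarrow> ('a \<Rightarrow>\<^sub>C real) \<Rightarrow> ('a \<Rightarrow>\<^sub>C real)" where
  "laplace t \<equiv> kop (\<lambda>u. exp (t * u))"

lemma adm_exp: 
  assumes "\<bar>t\<bar> \<le> \<theta>" shows "adm (\<lambda>u. exp (t * u)) 1"
proof -
  have "t * u \<le> \<theta> * \<bar>u\<bar>" for u
    using mult_right_mono[OF assms, of "\<bar>u\<bar>"] abs_ge_self[of "t * u"] by (simp add: abs_mult)
  then show ?thesis by (auto simp: adm_def intro!: continuous_intros)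
qed

lemma adm_mult_exp:
  assumes "0 < e" "\<bar>t\<bar> + e \<le> \<theta>" shows "adm (\<lambda>u. u * exp (t * u)) (1 / e)"
  unfolding adm_def
proof (intro conjI allI)
  fix u
  have "t * u \<le> \<bar>t\<bar> * \<bar>u\<bar>" by (metis abs_ge_self abs_mult)
  then have "\<bar>u * exp (t * u)\<bar> \<le> (1 / e * exp (e * \<bar>u\<bar>)) * exp (\<bar>t\<bar> * \<bar>u\<bar>)"
    using abs_le_exp[of e u] assms unfolding abs_mult by (intro mult_mono) auto
  also have "\<dots> = 1 / e * exp ((\<bar>t\<bar> + e) * \<bar>u\<bar>)" by (simp add: exp_add[symmetric] algebra_simps)
  also have "\<dots> \<le> 1 / e * exp (\<theta> * \<bar>u\<bar>)"
    using assms by (intro mult_left_mono) (auto intro!: mult_right_mono)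
  finally show "\<bar>u * exp (t * u)\<bar> \<le> 1 / e * exp (\<theta> * \<bar>u\<bar>)" .
qed (auto intro!: continuous_intros)

text \<open>A lower bound on the weight that depends on neither \<open>x\<close> nor
  \<open>t\<close>: it yields both the positivity of the Laplace transforms and a minorising
  functional common to all \<open>t\<close>.\<close>

lemma inverse_Z_le_exp:
  assumes "\<bar>t\<bar> \<le> \<theta>"
  shows "AE \<omega> in M. \<forall>x. 1 / Z \<omega> \<le> exp (t * U \<omega> x)"
  using U_bound Z_ge
proof eventually_elim
  case (elim \<omega>)
  show ?case
  proof
    fix x
    have "\<bar>t * U \<omega> x\<bar> \<le> \<theta> * \<bar>U \<omega> x\<bar>" using assms by (simp add: abs_mult mult_right_mono)
    then have "- (\<theta> * \<bar>U \<omega> x\<bar>) \<le> t * U \<omega> x" by linarith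
    then have "exp (- (\<theta> * \<bar>U \<omega> x\<bar>)) \<le> exp (t * U \<omega> x)" by simp
    moreover have "1 / Z \<omega> \<le> exp (- (\<theta> * \<bar>U \<omega> x\<bar>))"
      using elim(1) elim(2) unfolding exp_minus inverse_eq_divide by (intro divide_left_mono) auto
    ultimately show "1 / Z \<omega> \<le> exp (t * U \<omega> x)" by (rule order_trans[rotated])
  qed
qed

lemma laplace_one_lower:
  assumes t: "\<bar>t\<bar> \<le> \<theta>"
  obtains p where "0 < p" "\<And>x. p \<le> laplace t one_bcontfun x"
proof
  have [measurable]: "Z \<in> borel_measurable M" using Z_int by simp
  have int: "integrable M (\<lambda>\<omega>. 1 / Z \<omega>)"
    by (rule integrable_const_bound[of _ 1]) (use Z_ge in \<open>auto elim: eventually_mono\<close>)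
  have nn: "AE \<omega> in M. 0 \<le> 1 / Z \<omega>" using Z_ge by eventually_elim auto
  show "0 < expectation (\<lambda>\<omega>. 1 / Z \<omega>)"
  proof -
    have "expectation (\<lambda>\<omega>. 1 / Z \<omega>) \<noteq> 0"
    proof
      assume "expectation (\<lambda>\<omega>. 1 / Z \<omega>) = 0"
      then have "AE \<omega> in M. 1 / Z \<omega> = 0" using integral_nonneg_eq_0_iff_AE[OF int nn] by simp
      then have "AE \<omega> in M. False" using Z_ge by eventually_elim auto
      then show False by simp
    qed
    moreover have "0 \<le> expectation (\<lambda>\<omega>. 1 / Z \<omega>)" using nn by (rule integral_nonneg_AE)
    ultimately show ?thesis by simp
  qed
  show "expectation (\<lambda>\<omega>. 1 / Z \<omega>) \<le> laplace t one_bcontfun x" for x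
    unfolding kop_apply[OF adm_exp[OF t]]
    by (intro integral_mono_AE int kernel_int[OF adm_exp[OF t]])
      (use inverse_Z_le_exp[OF t] in eventually_elim, simp)
qed

lemma laplace_expansion:
  assumes "\<bar>t\<bar> < \<theta>"
  shows "\<exists>T' C e. 0 < e \<and>
    (\<forall>s f. \<bar>s\<bar> < e \<longrightarrow> norm (laplace (t + s) f - laplace t f - s *\<^sub>R T' f) \<le> C * s\<^sup>2 * norm f) \<and> linear T'"
proof -
  \<comment> \<open>\<open>\<bar>t\<bar> + e + e = \<theta>\<close>: one \<open>e\<close> pays for
    the factor \<open>u\<^sup>2\<close>, the other for \<open>exp \<bar>s * u\<bar>\<close>.\<close>
  define e where "e = (\<theta> - \<bar>t\<bar>) / 2"
  have e: "0 < e" "\<bar>t\<bar> + e \<le> \<theta>" using assms by (simp_all add: e_def field_simps)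
  let ?T' = "kop (\<lambda>u. u * exp (t * u))"
  have "norm (laplace (t + s) f - laplace t f - s *\<^sub>R ?T' f) \<le> (2 / e\<^sup>2 * expectation Z) * s\<^sup>2 * norm f"
    if s: "\<bar>s\<bar> < e" for s f
  proof -
    have ts: "\<bar>t + s\<bar> \<le> \<theta>" using s e abs_triangle_ineq[of t s] by linarith
    have adm: "adm (\<lambda>u. exp ((t + s) * u) - exp (t * u) - s * (u * exp (t * u))) (2 / e\<^sup>2 * s\<^sup>2)"
      unfolding adm_def
    proof (intro conjI allI)
      fix u
      have "exp ((t + s) * u) - exp (t * u) - s * (u * exp (t * u)) = exp (t * u) * (exp (s * u) - 1 - s * u)"
        by (simp add: algebra_simps exp_add)
      then have "\<bar>exp ((t + s) * u) - exp (t * u) - s * (u * exp (t * u))\<bar>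
          = exp (t * u) * \<bar>exp (s * u) - 1 - s * u\<bar>" by (simp add: abs_mult)
      also have "\<dots> \<le> exp (\<bar>t\<bar> * \<bar>u\<bar>) * ((s * u)\<^sup>2 * exp \<bar>s * u\<bar>)"
      proof (intro mult_mono abs_exp_minus_linear_le)
        have "t * u \<le> \<bar>t\<bar> * \<bar>u\<bar>" by (metis abs_ge_self abs_mult)
        then show "exp (t * u) \<le> exp (\<bar>t\<bar> * \<bar>u\<bar>)" by simp
      qed auto
      also have "\<dots> \<le> exp (\<bar>t\<bar> * \<bar>u\<bar>) * ((s\<^sup>2 * (2 / e\<^sup>2 * exp (e * \<bar>u\<bar>))) * exp (e * \<bar>u\<bar>))"
        unfolding power_mult_distrib abs_mult using square_le_exp[OF e(1), of u] s e
        by (intro mult_left_mono mult_mono) (auto intro!: mult_right_mono)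
      also have "\<dots> = 2 / e\<^sup>2 * s\<^sup>2 * exp ((\<bar>t\<bar> + e + e) * \<bar>u\<bar>)"
        by (simp only: distrib_right exp_add) simp
      also have "\<bar>t\<bar> + e + e = \<theta>" by (simp add: e_def)
      finally show "\<bar>exp ((t + s) * u) - exp (t * u) - s * (u * exp (t * u))\<bar>
        \<le> 2 / e\<^sup>2 * s\<^sup>2 * exp (\<theta> * \<bar>u\<bar>)" .
    qed (auto intro!: continuous_intros)
    have "laplace (t + s) f - laplace t f - s *\<^sub>R ?T' f =
        kop (\<lambda>u. exp ((t + s) * u) - exp (t * u) - s * (u * exp (t * u))) f"
      by (rule kop_lincomb[symmetric, OF adm_exp[OF ts] adm_exp adm_mult_exp[OF e] adm]) (use assms in simp)
    then show ?thesis using norm_kop[OF adm, of f] by (simp add: ac_simps)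
  qed
  then show ?thesis using e kop_linear[OF adm_mult_exp[OF e]]
    by (intro exI[of _ ?T'] exI[of _ "2 / e\<^sup>2 * expectation Z"] exI[of _ e]) blast
qed

lemma laplace_one_near:
  assumes "\<bar>t\<bar> \<le> \<theta> / 2"
  shows "\<bar>laplace t one_bcontfun x - 1\<bar> \<le> \<bar>t\<bar> * (2 / \<theta> * expectation Z)"
proof -
  have t: "\<bar>t\<bar> \<le> \<theta>" using assms \<theta> by simp
  \<comment> \<open>Half of \<open>\<theta>\<close> is spent on the factor
    \<open>\<bar>u\<bar>\<close>, the other half on the exponential.\<close>
  have adm: "adm (\<lambda>u. exp (t * u) - 1) (2 / \<theta> * \<bar>t\<bar>)"
    unfolding adm_def
  proof (intro conjI allI)
    fix u
    have "\<bar>exp (t * u) - 1\<bar> \<le> \<bar>t * u\<bar> * exp \<bar>t * u\<bar>" by (rule abs_exp_minus_1_le)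
    also have "\<dots> \<le> (\<bar>t\<bar> * (1 / (\<theta> / 2) * exp (\<theta> / 2 * \<bar>u\<bar>))) * exp (\<theta> / 2 * \<bar>u\<bar>)"
    proof (intro mult_mono)
      show "\<bar>t * u\<bar> \<le> \<bar>t\<bar> * (1 / (\<theta> / 2) * exp (\<theta> / 2 * \<bar>u\<bar>))"
        unfolding abs_mult using abs_le_exp[of "\<theta> / 2" u] \<theta> by (intro mult_left_mono) auto
      show "exp \<bar>t * u\<bar> \<le> exp (\<theta> / 2 * \<bar>u\<bar>)"
        unfolding abs_mult exp_le_cancel_iff using assms by (intro mult_right_mono) auto
    qed (use \<theta> in auto)
    also have "\<dots> = 2 / \<theta> * \<bar>t\<bar> * exp (\<theta> / 2 * \<bar>u\<bar> + \<theta> / 2 * \<bar>u\<bar>)"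
      by (simp only: exp_add) simp
    also have "\<theta> / 2 * \<bar>u\<bar> + \<theta> / 2 * \<bar>u\<bar> = \<theta> * \<bar>u\<bar>" by simp
    finally show "\<bar>exp (t * u) - 1\<bar> \<le> 2 / \<theta> * \<bar>t\<bar> * exp (\<theta> * \<bar>u\<bar>)" .
  qed (auto intro!: continuous_intros)
  have "laplace t one_bcontfun x - 1 = kop (\<lambda>u. exp (t * u) - 1) one_bcontfun x"
    using kernel_int[OF adm_exp[OF t], of x one_bcontfun]
    by (simp add: kop_apply[OF adm] kop_apply[OF adm_exp[OF t]] prob_space)
  also have "\<bar>\<dots>\<bar> \<le> 2 / \<theta> * \<bar>t\<bar> * expectation Z * norm (one_bcontfun :: 'a \<Rightarrow>\<^sub>C real)"
    using abs_apply_le_norm norm_kop[OF adm] order_trans by blast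
  also have "\<dots> \<le> 2 / \<theta> * \<bar>t\<bar> * expectation Z * 1"
  proof (intro mult_left_mono mult_nonneg_nonneg)
    show "norm (one_bcontfun :: 'a \<Rightarrow>\<^sub>C real) \<le> 1" by (rule norm_bound) simp
    show "0 \<le> expectation Z" using Z_ge by (intro integral_nonneg_AE) (auto elim: eventually_mono)
  qed (use \<theta> in auto)
  finally show ?thesis by (simp add: ac_simps)
qed

end

section \<open>A minorising functional from the event of forgetting\<close>

locale forgetful_kernel = weighted_kernel M U V Z \<theta>
  for M :: "'w measure" and U :: "'w \<Rightarrow> 'a::metric_space \<Rightarrow> real" and V Z \<theta> +
  fixes G :: "'w set"
  assumes G_sets[measurable]: "G \<in> sets M" and G_pos: "0 < prob G"
    and G_const: "\<And>\<omega> x y. \<omega> \<in> G \<Longrightarrow> V \<omega> x = V \<omega> y"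
begin

text \<open>On \<open>G\<close> the kernel forgets its starting point and \<open>exp (t U) \<ge> 1 / Z\<close>, so this functional
  minorises all the operators \<open>laplace t\<close>, \<open>\<bar>t\<bar> \<le> \<theta>\<close>, at once.\<close>

definition \<nu> :: "('a \<Rightarrow>\<^sub>C real) \<Rightarrow> real" where
  "\<nu> f = expectation (\<lambda>\<omega>. indicator G \<omega> / Z \<omega> * f (V \<omega> undefined))"

lemma \<nu>_bound: "AE \<omega> in M. norm (indicator G \<omega> / Z \<omega> * apply_bcontfun f (V \<omega> undefined)) \<le> norm f"
  using Z_ge
proof eventually_elim
  case (elim \<omega>)
  have "\<bar>indicator G \<omega> / Z \<omega>\<bar> \<le> 1" using elim by (auto simp: indicator_def)
  then have "\<bar>indicator G \<omega> / Z \<omega>\<bar> * \<bar>f (V \<omega> undefined)\<bar> \<le> 1 * norm f"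
    by (intro mult_mono abs_apply_le_norm) auto
  then show ?case by (simp only: real_norm_def abs_mult mult_1)
qed

lemma Z_meas[measurable]: "Z \<in> borel_measurable M"
  using Z_int by simp

lemma \<nu>_int: "integrable M (\<lambda>\<omega>. indicator G \<omega> / Z \<omega> * apply_bcontfun f (V \<omega> undefined))"
  using \<nu>_bound[of f] by (intro integrable_const_bound[of _ "norm f"]) auto

lemma \<nu>_bounded_linear: "bounded_linear \<nu>"
proof (rule bounded_linear_intro[where K = 1])
  show "\<nu> (f + g) = \<nu> f + \<nu> g" for f g
    using \<nu>_int[of f] \<nu>_int[of g] by (simp add: \<nu>_def distrib_left)
  show "\<nu> (r *\<^sub>R f) = r *\<^sub>R \<nu> f" for r f
    unfolding \<nu>_def scaleR_bcontfun.rep_eq real_scaleR_def mult.left_commute[of _ r]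
    by (rule integral_mult_right_zero)
  show "norm (\<nu> f) \<le> norm f * 1" for f
  proof -
    have "norm (\<nu> f) \<le> expectation (\<lambda>\<omega>. norm f)"
      unfolding \<nu>_def using \<nu>_bound by (intro norm_expectation_le \<nu>_int) auto
    then show ?thesis by (simp add: prob_space)
  qed
qed

lemma \<nu>_le_laplace:
  assumes t: "\<bar>t\<bar> \<le> \<theta>" and f: "\<And>x. 0 \<le> apply_bcontfun f x"
  shows "\<nu> f \<le> laplace t f x"
  unfolding \<nu>_def kop_apply[OF adm_exp[OF t]]
proof (intro integral_mono_AE \<nu>_int kernel_int[OF adm_exp[OF t]])
  show "AE \<omega> in M. indicator G \<omega> / Z \<omega> * f (V \<omega> undefined) \<le> exp (t * U \<omega> x) * f (V \<omega> x)"
    using inverse_Z_le_exp[OF t]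
  proof eventually_elim
    case (elim \<omega>)
    show ?case
    proof (cases "\<omega> \<in> G")
      case True
      \<comment> \<open>On \<open>G\<close> the reference point \<open>undefined\<close> used in
        \<open>\<nu>\<close> may be exchanged for \<open>x\<close>.\<close>
      have "1 / Z \<omega> \<le> exp (t * U \<omega> x)" using elim by blast
      then show ?thesis using True f[of "V \<omega> x"] G_const[OF True, of undefined x]
        by (simp del: times_divide_eq_left add: mult_right_mono)
    qed (simp add: f)
  qed
qed

lemma \<nu>_nonneg: "(\<And>x. 0 \<le> apply_bcontfun f x) \<Longrightarrow> 0 \<le> \<nu> f"
  unfolding \<nu>_def using Z_ge
  by (intro integral_nonneg_AE) (auto elim!: eventually_mono intro!: mult_nonneg_nonneg divide_nonneg_nonneg)

lemma \<nu>_one_pos: "0 < \<nu> one_bcontfun"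
proof -
  have nn: "AE \<omega> in M. 0 \<le> indicator G \<omega> / Z \<omega> * apply_bcontfun one_bcontfun (V \<omega> undefined)"
    using Z_ge by eventually_elim auto
  have "\<nu> one_bcontfun \<noteq> 0"
  proof
    assume "\<nu> one_bcontfun = 0"
    then have "AE \<omega> in M. indicator G \<omega> / Z \<omega> * apply_bcontfun one_bcontfun (V \<omega> undefined) = 0"
      unfolding \<nu>_def using integral_nonneg_eq_0_iff_AE[OF \<nu>_int nn] by simp
    then have "AE \<omega> in M. \<omega> \<notin> G" using Z_ge by eventually_elim (auto simp: indicator_def split: if_splits)
    then have "prob G = 0" using G_sets by (simp add: prob_eq_0)
    then show False using G_pos by simp
  qed
  moreover have "0 \<le> \<nu> one_bcontfun" by (rule \<nu>_nonneg) simp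
  ultimately show ?thesis by simp
qed

lemma perturbed_doeblin_laplace:
  obtains t0 where "0 < t0" "t0 \<le> \<theta>" "perturbed_doeblin laplace \<nu> (\<nu> one_bcontfun) t0"
proof -
  define a where "a = 2 / \<theta> * expectation Z"
  have a0: "0 \<le> a" unfolding a_def using \<theta> Z_ge
    by (intro mult_nonneg_nonneg integral_nonneg_AE) (auto elim: eventually_mono)
  \<comment> \<open>\<open>\<theta> / 2\<close> is the range of \<open>laplace_one_near\<close>. The
    second bound keeps \<open>laplace t\<close> at \<open>1\<close> within a quarter of
    \<open>\<nu> one_bcontfun\<close> of \<open>1\<close>, whence the fractions \<open>5 / 4\<close>
    and \<open>3 / 4\<close>; \<open>a + 1\<close> is positive given only
    \<open>a \<ge> 0\<close>.\<close>
  define t0 where "t0 = min (\<theta> / 2) (\<nu> one_bcontfun / (4 * (a + 1)))"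
  have "0 < t0" "t0 \<le> \<theta>" using \<theta> \<nu>_one_pos a0 by (auto simp: t0_def)
  moreover have "perturbed_doeblin laplace \<nu> (\<nu> one_bcontfun) t0"
  proof (rule perturbed_doeblin.intro)
    fix t assume t: "\<bar>t\<bar> < t0"
    then have t': "\<bar>t\<bar> \<le> \<theta> / 2" "\<bar>t\<bar> < \<theta>" "\<bar>t\<bar> \<le> \<theta>" using \<theta> by (auto simp: t0_def)
    show "\<exists>T' C e. 0 < e \<and>
      (\<forall>s f. \<bar>s\<bar> < e \<longrightarrow> norm (laplace (t + s) f - laplace t f - s *\<^sub>R T' f) \<le> C * s\<^sup>2 * norm f) \<and> linear T'"
      by (rule laplace_expansion[OF t'(2)])
    show "doeblin (\<lambda>f. laplace t f - \<nu> f *\<^sub>R one_bcontfun) \<nu> (\<nu> one_bcontfun)"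
    proof (rule doeblin.intro)
      show "bounded_linear (\<lambda>f. laplace t f - \<nu> f *\<^sub>R one_bcontfun)"
        by (intro bounded_linear_sub kop_bounded_linear[OF adm_exp[OF t'(3)]]
            bounded_linear_compose[OF bounded_linear_scaleR_left \<nu>_bounded_linear])
      show "0 \<le> (laplace t f - \<nu> f *\<^sub>R one_bcontfun) y" if "\<And>x. 0 \<le> apply_bcontfun f x" for f y
        using \<nu>_le_laplace[OF t'(3) that] by simp
      have *: "\<bar>laplace t one_bcontfun x - 1\<bar> \<le> \<nu> one_bcontfun / 4" for x
      proof -
        have "\<bar>laplace t one_bcontfun x - 1\<bar> \<le> \<bar>t\<bar> * a"
          unfolding a_def by (rule laplace_one_near[OF t'(1)])
        also have "\<dots> \<le> \<nu> one_bcontfun / (4 * (a + 1)) * (a + 1)"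
          using t a0 by (intro mult_mono) (auto simp: t0_def)
        also have "\<dots> = \<nu> one_bcontfun / 4"
          using a0 by (simp add: divide_simps)
        finally show ?thesis .
      qed
      have **: "apply_bcontfun (laplace t one_bcontfun) x \<le> 1 + \<nu> one_bcontfun / 4"
        "1 - \<nu> one_bcontfun / 4 \<le> apply_bcontfun (laplace t one_bcontfun) x" for x
        using abs_le_D1[OF *[of x]] abs_le_D2[OF *[of x]] by linarith+
      show "1 - 5 / 4 * \<nu> one_bcontfun \<le> (laplace t one_bcontfun - \<nu> one_bcontfun *\<^sub>R one_bcontfun) x" for x
        using **[of x] by simp
      show "(laplace t one_bcontfun - \<nu> one_bcontfun *\<^sub>R one_bcontfun) x \<le> 1 - 3 / 4 * \<nu> one_bcontfun" for x
        using **[of x] by simp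
    qed (rule \<nu>_bounded_linear \<nu>_nonneg \<nu>_one_pos refl | assumption)+
  qed
  ultimately show ?thesis by (rule that)
qed

end

section \<open>Products of random topical operators\<close>

text \<open>Approximate \<open>Y\<close> by simple functions: each takes finitely many values, so
  only finitely many sections of \<open>f\<close> occur, and continuity passes to the limit. This
  evaluates a random operator at a random point.\<close>

lemma borel_measurable_Caratheodory:
  fixes f :: "'w \<Rightarrow> 'a::{metric_space, second_countable_topology} \<Rightarrow> 'b::metric_space"
  assumes meas: "\<And>x. (\<lambda>\<omega>. f \<omega> x) \<in> borel_measurable N"
    and cont: "\<And>\<omega>. \<omega> \<in> space N \<Longrightarrow> continuous_on UNIV (f \<omega>)"
    and Y: "Y \<in> borel_measurable N"
  shows "(\<lambda>\<omega>. f \<omega> (Y \<omega>)) \<in> borel_measurable N"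
proof -
  obtain F where F: "\<And>i. simple_function N (F i)"
    and lim: "\<And>\<omega>. \<omega> \<in> space N \<Longrightarrow> (\<lambda>i. F i \<omega>) \<longlonglongrightarrow> Y \<omega>"
    using borel_measurable_implies_sequence_metric[OF Y] by blast
  show ?thesis
  proof (rule borel_measurable_LIMSEQ_metric)
    show "(\<lambda>\<omega>. f \<omega> (F i \<omega>)) \<in> borel_measurable N" for i
    proof (rule measurable_compose_countable'[where I = "F i ` space N" and f = "\<lambda>x \<omega>. f \<omega> x"])
      have fin: "finite (F i ` space N)" using F by (rule simple_functionD)
      then show "countable (F i ` space N)" by (rule countable_finite)
      show "F i \<in> measurable N (count_space (F i ` space N))"
        using F[of i] fin by (subst measurable_count_space_eq2) (auto simp: simple_function_def)
    qed (rule meas)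
    show "(\<lambda>i. f \<omega> (F i \<omega>)) \<longlonglongrightarrow> f \<omega> (Y \<omega>)" if "\<omega> \<in> space N" for \<omega>
      by (intro continuous_on_tendsto_compose[OF cont lim]) (use that in auto)
  qed
qed

section \<open>Topical maps are nonexpansive, hence continuous\<close>

lemma one_vec_nth [simp]: "one_vec $ i = 1"
  by (simp add: one_vec_def)

lemma topical_fun_mono: "topical_fun f \<Longrightarrow> (\<And>i. x $ i \<le> y $ i) \<Longrightarrow> f x \<le> f y"
  by (simp add: topical_fun_def vle_def)

lemma topical_fun_add: "topical_fun f \<Longrightarrow> f (x + a *\<^sub>R one_vec) = f x + a"
  by (simp add: topical_fun_def)

lemma topical_fun_diff: "topical_fun f \<Longrightarrow> f (x - a *\<^sub>R one_vec) = f x - a"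
  using topical_fun_add[of f x "- a"] by simp

lemma topical_op_add: "topical_op F \<Longrightarrow> F (x + a *\<^sub>R one_vec) = F x + a *\<^sub>R one_vec"
  by (simp add: topical_op_def)

lemma topical_op_diff: "topical_op F \<Longrightarrow> F (x - a *\<^sub>R one_vec) = F x - a *\<^sub>R one_vec"
  using topical_op_add[of F x "- a"] by simp

lemma topical_fun_nth: "topical_op F \<Longrightarrow> topical_fun (\<lambda>x. F x $ i)"
  by (auto simp: topical_op_def topical_fun_def vle_def)

lemma topical_fun_comp: "topical_fun f \<Longrightarrow> topical_op F \<Longrightarrow> topical_fun (\<lambda>x. f (F x))"
  by (auto simp: topical_op_def topical_fun_def)

lemma topical_op_comp: "topical_op F \<Longrightarrow> topical_op F' \<Longrightarrow> topical_op (\<lambda>x. F (F' x))"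
  by (auto simp: topical_op_def)

text \<open>Every coordinate of \<open>x - y\<close> is at most \<open>norm (x - y)\<close>, so
  \<open>x\<close> lies below \<open>y\<close> shifted by that multiple of
  \<open>one_vec\<close>.\<close>

lemma topical_fun_lipschitz:
  assumes "topical_fun f"
  shows "\<bar>f x - f y\<bar> \<le> norm (x - y)"
proof -
  have le: "f x \<le> f y + norm (x - y)" for x y
  proof -
    have "x $ i \<le> (y + norm (x - y) *\<^sub>R one_vec) $ i" for i
      using component_le_norm_cart[of "x - y" i] by (simp add: abs_le_iff)
    then have "f x \<le> f (y + norm (x - y) *\<^sub>R one_vec)" by (rule topical_fun_mono[OF assms])
    then show ?thesis by (simp add: topical_fun_add[OF assms])
  qed
  from le[of x y] le[of y x] show ?thesis by (simp add: abs_le_iff norm_minus_commute)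
qed

lemma topical_fun_continuous: "topical_fun f \<Longrightarrow> continuous_on S f"
  unfolding continuous_on_iff dist_norm real_norm_def
  using topical_fun_lipschitz le_less_trans by blast

lemma topical_op_continuous:
  assumes "topical_op F"
  shows "continuous_on S F"
proof -
  have "continuous_on S (\<lambda>x. \<chi> i. F x $ i)"
    by (intro continuous_on_vec_lambda topical_fun_continuous topical_fun_nth assms)
  then show ?thesis by simp
qed

text \<open>The inequality describes a closed set, and this set contains the dense set
  \<open>D\<close>.\<close>

lemma dense_SUP_bound:
  fixes g :: "'a::second_countable_topology \<Rightarrow> ennreal"
  assumes g: "continuous_on UNIV g" and D: "\<And>X. open X \<Longrightarrow> X \<noteq> {} \<Longrightarrow> \<exists>d\<in>D. d \<in> X"
  shows "g x \<le> (SUP d\<in>D. g d)"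
proof -
  have "closed {x. g x \<le> (SUP d\<in>D. g d)}"
    by (intro closed_Collect_le g continuous_on_const)
  then have "open {x. \<not> g x \<le> (SUP d\<in>D. g d)}"
    by (simp add: closed_def Compl_eq)
  then have "{x. \<not> g x \<le> (SUP d\<in>D. g d)} = {}"
    using D[of "{x. \<not> g x \<le> (SUP d\<in>D. g d)}"] by (auto intro: SUP_upper)
  then show ?thesis by auto
qed

locale topical_sequence = prob_space M
  for M :: "'w measure" +
  fixes A :: "nat \<Rightarrow> 'w \<Rightarrow> real ^ 'd \<Rightarrow> real ^ 'd" and \<phi> :: "real ^ 'd \<Rightarrow> real" and \<theta> :: real
  assumes topA: "\<And>n \<omega>. n \<ge> 1 \<Longrightarrow> \<omega> \<in> space M \<Longrightarrow> topical_op (A n \<omega>)"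
    and indep: "indep_vars (\<lambda>_. op_space) A {1..}"
    and ident: "\<And>n. n \<ge> 1 \<Longrightarrow> distr M op_space (A n) = distr M op_space (A 1)"
    and top\<phi>: "topical_fun \<phi>"
    and \<theta>_pos: "0 < \<theta>"
    and expmom: "(\<integral>\<^sup>+\<omega>. (SUP x. ennreal (exp (\<theta> * \<bar>\<phi> (A 1 \<omega> x) - \<phi> x\<bar>))) \<partial>M) < \<infinity>"
begin

lemma A_rv: "n \<ge> 1 \<Longrightarrow> A n \<in> measurable M op_space"
  using indep by (auto simp: indep_vars_def)

lemma A_continuous: "\<omega> \<in> space M \<Longrightarrow> continuous_on S (A (Suc n) \<omega>)"
  by (rule topical_op_continuous[OF topA]) auto

lemma A_meas: "n \<ge> 1 \<Longrightarrow> (\<lambda>\<omega>. A n \<omega> x) \<in> borel_measurable M"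
  by (rule measurable_compose[OF A_rv measurable_component_singleton]) auto

lemma \<phi>_meas [measurable]: "\<phi> \<in> borel_measurable borel"
  by (intro borel_measurable_continuous_onI topical_fun_continuous top\<phi>)

definition X :: "nat \<Rightarrow> 'w \<Rightarrow> real ^ 'd \<Rightarrow> real ^ 'd" where
  "X n \<omega> x = xseq A (\<lambda>_. x) n \<omega>"

lemma X_0 [simp]: "X 0 \<omega> x = x" by (simp add: X_def)

lemma X_Suc [simp]: "X (Suc n) \<omega> x = A (Suc n) \<omega> (X n \<omega> x)" by (simp add: X_def)

lemma xseq_eq_X: "xseq A X0 n \<omega> = X n \<omega> (X0 \<omega>)"
  by (induction n) auto

lemma prodA_eq_X: "prodA A \<omega> n = X n \<omega>"
  by (induction n) (auto simp: fun_eq_iff)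

lemma X_topical: "\<omega> \<in> space M \<Longrightarrow> topical_op (X n \<omega>)"
proof (induction n)
  case 0
  then show ?case by (simp add: topical_op_def vle_def)
next
  case (Suc n)
  then show ?case using topical_op_comp[OF topA[of "Suc n" \<omega>], of "X n \<omega>"] by (simp add: topical_op_def)
qed

text \<open>Evaluation \<open>(F, y) \<mapsto> F y\<close> is not jointly measurable on \<open>op_space\<close>. Therefore \<open>\<omega>\<close> itself, with the
  \<open>\<sigma>\<close>-algebra generated by \<open>A n\<close>, plays the role of the random operator in Fubini's theorem.\<close>

definition past :: "nat \<Rightarrow> 'w measure" where
  "past n = vimage_algebra (space M) (\<lambda>\<omega>. \<lambda>i\<in>{1..n}. A i \<omega>) (PiM {1..n} (\<lambda>_. op_space))"

definition present :: "nat \<Rightarrow> 'w measure" where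
  "present n = vimage_algebra (space M) (A n) op_space"

lemma space_past [simp]: "space (past n) = space M" by (simp add: past_def)

lemma space_present [simp]: "space (present n) = space M" by (simp add: present_def)

lemma past_rv: "(\<lambda>\<omega>. \<lambda>i\<in>{1..n}. A i \<omega>) \<in> measurable M (PiM {1..n} (\<lambda>_. op_space))"
  by (intro measurable_restrict A_rv) auto

lemma sets_past: "sets (past n) =
    {(\<lambda>\<omega>. \<lambda>i\<in>{1..n}. A i \<omega>) -` B \<inter> space M | B. B \<in> sets (PiM {1..n} (\<lambda>_. op_space))}"
  unfolding past_def using measurable_space[OF past_rv] by (intro sets_vimage_algebra2) auto

lemma sets_present: "n \<ge> 1 \<Longrightarrow> sets (present n) = {A n -` B \<inter> space M | B. B \<in> sets op_space}"
  unfolding present_def using measurable_space[OF A_rv] by (intro sets_vimage_algebra2) auto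

lemma sets_present_subset: "n \<ge> 1 \<Longrightarrow> sets (present n) \<subseteq> sets M"
  using measurable_sets[OF A_rv] by (auto simp: sets_present)

lemma A_meas_past:
  assumes "i \<in> {1..n}"
  shows "(\<lambda>\<omega>. A i \<omega> x) \<in> borel_measurable (past n)"
proof -
  have "(\<lambda>\<omega>. \<lambda>i\<in>{1..n}. A i \<omega>) \<in> measurable (past n) (PiM {1..n} (\<lambda>_. op_space))"
    unfolding past_def using measurable_space[OF past_rv] by (intro measurable_vimage_algebra1) auto
  from measurable_compose[OF measurable_compose[OF this measurable_component_singleton[OF assms]]
    measurable_component_singleton[of x]]
  show ?thesis using assms by simp
qed

lemma A_meas_present:
  assumes "n \<ge> 1"
  shows "(\<lambda>\<omega>. A n \<omega> x) \<in> borel_measurable (present n)"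
proof -
  have "A n \<in> measurable (present n) op_space"
    unfolding present_def using measurable_space[OF A_rv[OF assms]]
    by (intro measurable_vimage_algebra1) auto
  from measurable_compose[OF this measurable_component_singleton[of x]] show ?thesis by simp
qed

lemma X_meas_past: "n \<le> m \<Longrightarrow> (\<lambda>\<omega>. X n \<omega> x) \<in> borel_measurable (past m)"
proof (induction n)
  case (Suc n)
  have "(\<lambda>\<omega>. A (Suc n) \<omega> (X n \<omega> x)) \<in> borel_measurable (past m)"
    by (rule borel_measurable_Caratheodory[where f = "A (Suc n)"])
      (use Suc in \<open>auto intro: A_continuous A_meas_past\<close>)
  then show ?case by simp
qed simp

lemma X_meas_comp: "Y \<in> borel_measurable M \<Longrightarrow> (\<lambda>\<omega>. X n \<omega> (Y \<omega>)) \<in> borel_measurable M"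
proof (induction n)
  case (Suc n)
  have "(\<lambda>\<omega>. A (Suc n) \<omega> (X n \<omega> (Y \<omega>))) \<in> borel_measurable M"
    by (rule borel_measurable_Caratheodory[where f = "A (Suc n)"])
      (use Suc in \<open>auto intro: A_continuous A_meas\<close>)
  then show ?case by simp
qed simp

lemma X_meas [measurable]: "(\<lambda>\<omega>. X n \<omega> x) \<in> borel_measurable M"
  by (rule X_meas_comp) simp

text \<open>Events of \<open>X n\<close> at a fixed point belong to \<open>past n\<close>, so
  independence of disjoint blocks of indices applies.\<close>

lemma indep_past_present:
  assumes S: "S \<in> sets borel" and B: "B \<in> sets (present (Suc n))"
  shows "prob ((\<lambda>\<omega>. X n \<omega> x) -` S \<inter> B) = prob ((\<lambda>\<omega>. X n \<omega> x) -` S \<inter> space M) * prob B"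
proof -
  have iv: "indep_var (PiM {1..n} (\<lambda>_. op_space)) (\<lambda>\<omega>. \<lambda>i\<in>{1..n}. A i \<omega>)
      (PiM {Suc n} (\<lambda>_. op_space)) (\<lambda>\<omega>. \<lambda>i\<in>{Suc n}. A i \<omega>)"
    by (rule indep_var_restrict[OF indep]) auto
  have "(\<lambda>\<omega>. X n \<omega> x) -` S \<inter> space M \<in> sets (past n)"
    using measurable_sets[OF X_meas_past[OF order_refl] S] by simp
  then obtain C where C: "C \<in> sets (PiM {1..n} (\<lambda>_. op_space))"
    "(\<lambda>\<omega>. X n \<omega> x) -` S \<inter> space M = (\<lambda>\<omega>. \<lambda>i\<in>{1..n}. A i \<omega>) -` C \<inter> space M"
    unfolding sets_past by blast
  obtain B' where B': "B' \<in> sets op_space" "B = A (Suc n) -` B' \<inter> space M"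
    using B sets_present[of "Suc n"] by auto
  \<comment> \<open>Blocks consist of families of operators; \<open>?E\<close> lifts
    \<open>B'\<close> to families with the single index \<open>Suc n\<close>.\<close>
  let ?E = "(\<lambda>f. f (Suc n)) -` B' \<inter> space (PiM {Suc n} (\<lambda>_. op_space))"
  have E: "?E \<in> sets (PiM {Suc n} (\<lambda>_. op_space))"
    by (rule measurable_sets[OF _ B'(1)], rule measurable_component_singleton) simp
  have B_eq: "B = (\<lambda>\<omega>. \<lambda>i\<in>{Suc n}. A i \<omega>) -` ?E \<inter> space M"
    using B'(2) measurable_space[OF indep_var_rv2[OF iv]] by auto
  have "(\<lambda>\<omega>. X n \<omega> x) -` S \<inter> B = ((\<lambda>\<omega>. X n \<omega> x) -` S \<inter> space M) \<inter> B"
    using B'(2) by auto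
  also have "\<dots> = (\<lambda>\<omega>. (\<lambda>i\<in>{1..n}. A i \<omega>, \<lambda>i\<in>{Suc n}. A i \<omega>)) -` (C \<times> ?E) \<inter> space M"
    unfolding C(2) by (subst B_eq) auto
  also have "prob \<dots> = prob ((\<lambda>\<omega>. \<lambda>i\<in>{1..n}. A i \<omega>) -` C \<inter> space M)
      * prob ((\<lambda>\<omega>. \<lambda>i\<in>{Suc n}. A i \<omega>) -` ?E \<inter> space M)"
    by (rule indep_varD[OF iv C(1) E])
  finally show ?thesis unfolding C(2)[symmetric] B_eq[symmetric] .
qed

lemma present_id: "(\<lambda>\<omega>. \<omega>) \<in> measurable M (present (Suc n))"
  using sets_present_subset[of "Suc n"] by (intro measurableI) auto

lemma distr_past_present:
  "distr M borel (\<lambda>\<omega>. X n \<omega> x) \<Otimes>\<^sub>M distr M (present (Suc n)) (\<lambda>\<omega>. \<omega>)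
    = distr M (borel \<Otimes>\<^sub>M present (Suc n)) (\<lambda>\<omega>. (X n \<omega> x, \<omega>))"
proof (rule pair_measure_eqI)
  have pm: "(\<lambda>\<omega>. (X n \<omega> x, \<omega>)) \<in> measurable M (borel \<Otimes>\<^sub>M present (Suc n))"
    by (intro measurable_Pair X_meas present_id)
  show "sigma_finite_measure (distr M borel (\<lambda>\<omega>. X n \<omega> x))"
    by (intro prob_space_imp_sigma_finite prob_space_distr X_meas)
  show "sigma_finite_measure (distr M (present (Suc n)) (\<lambda>\<omega>. \<omega>))"
    by (intro prob_space_imp_sigma_finite prob_space_distr present_id)
  show "sets (distr M borel (\<lambda>\<omega>. X n \<omega> x) \<Otimes>\<^sub>M distr M (present (Suc n)) (\<lambda>\<omega>. \<omega>))
      = sets (distr M (borel \<Otimes>\<^sub>M present (Suc n)) (\<lambda>\<omega>. (X n \<omega> x, \<omega>)))"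
    by (simp cong: sets_pair_measure_cong)
  fix S B assume S: "S \<in> sets (distr M borel (\<lambda>\<omega>. X n \<omega> x))"
    and B: "B \<in> sets (distr M (present (Suc n)) (\<lambda>\<omega>. \<omega>))"
  then have B': "B \<inter> space M = B" using sets.sets_into_space[of B "present (Suc n)"] by auto
  have "(\<lambda>\<omega>. (X n \<omega> x, \<omega>)) -` (S \<times> B) \<inter> space M = (\<lambda>\<omega>. X n \<omega> x) -` S \<inter> B"
    using B' by auto
  then show "emeasure (distr M borel (\<lambda>\<omega>. X n \<omega> x)) S * emeasure (distr M (present (Suc n)) (\<lambda>\<omega>. \<omega>)) B
      = emeasure (distr M (borel \<Otimes>\<^sub>M present (Suc n)) (\<lambda>\<omega>. (X n \<omega> x, \<omega>))) (S \<times> B)"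
    using S B B' indep_past_present[of S B n x]
    by (simp add: emeasure_distr[OF pm] emeasure_distr[OF X_meas] emeasure_distr[OF present_id]
      emeasure_eq_measure ennreal_mult'[symmetric])
qed

text \<open>Projective classes are represented by their member on which \<open>\<phi>\<close> vanishes.\<close>

definition proj :: "real ^ 'd \<Rightarrow> real ^ 'd" where
  "proj y = y - \<phi> y *\<^sub>R one_vec"

definition U :: "nat \<Rightarrow> 'w \<Rightarrow> real ^ 'd \<Rightarrow> real" where
  "U n \<omega> x = \<phi> (X n \<omega> x) - \<phi> x"

definition V :: "nat \<Rightarrow> 'w \<Rightarrow> real ^ 'd \<Rightarrow> real ^ 'd" where
  "V n \<omega> x = proj (X n \<omega> x)"

lemma proj_shift: "proj (y - a *\<^sub>R one_vec) = proj y"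
  by (simp add: proj_def topical_fun_diff[OF top\<phi>] algebra_simps)

lemma proj_proj [simp]: "proj (proj y) = proj y"
  using proj_shift[of y "\<phi> y"] by (simp only: proj_def[symmetric])

lemma proj_continuous: "continuous_on S proj"
  unfolding proj_def by (intro continuous_intros topical_fun_continuous top\<phi>)

lemma proj_meas [measurable]: "proj \<in> borel_measurable borel"
  by (intro borel_measurable_continuous_onI proj_continuous)

lemma U_proj: "\<omega> \<in> space M \<Longrightarrow> U n \<omega> (proj x) = U n \<omega> x"
  by (simp add: U_def proj_def topical_op_diff[OF X_topical] topical_fun_diff[OF top\<phi>])

lemma V_proj: "\<omega> \<in> space M \<Longrightarrow> V n \<omega> (proj x) = V n \<omega> x"
  by (simp add: V_def proj_def[of x] topical_op_diff[OF X_topical] proj_shift)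

text \<open>Suprema over a countable dense set instead of all of \<open>\<real>\<^sup>d\<close> stay measurable.\<close>

definition D :: "(real ^ 'd) set" where
  "D = (SOME D. countable D \<and> (\<forall>X. open X \<longrightarrow> X \<noteq> {} \<longrightarrow> (\<exists>d\<in>D. d \<in> X)))"

lemma D: "countable D" "open W \<Longrightarrow> W \<noteq> {} \<Longrightarrow> \<exists>d\<in>D. d \<in> W"
  using someI_ex[OF countable_dense_exists[where 'a = "real ^ 'd"]] unfolding D_def by blast+

definition H :: "(real ^ 'd \<Rightarrow> real ^ 'd) \<Rightarrow> ennreal" where
  "H F = (SUP x\<in>D. ennreal (exp (\<theta> * \<bar>\<phi> (F x) - \<phi> x\<bar>)))"

lemma H_meas [measurable]: "H \<in> borel_measurable op_space"
  unfolding H_def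
proof (intro borel_measurable_SUP D(1))
  fix x :: "real ^ 'd"
  have comp: "(\<lambda>F. F x) \<in> measurable op_space borel" by (rule measurable_component_singleton) simp
  show "(\<lambda>F. ennreal (exp (\<theta> * \<bar>\<phi> (F x) - \<phi> x\<bar>))) \<in> borel_measurable op_space"
    by (rule measurable_compose[OF comp]) measurable
qed

lemma H_upper:
  assumes "topical_op F"
  shows "ennreal (exp (\<theta> * \<bar>\<phi> (F x) - \<phi> x\<bar>)) \<le> H F"
proof -
  have "continuous_on UNIV (\<lambda>x. \<phi> (F x))" "continuous_on UNIV \<phi>"
    by (rule topical_fun_continuous[OF topical_fun_comp[OF top\<phi> assms]])
      (rule topical_fun_continuous[OF top\<phi>])
  then have "continuous_on UNIV (\<lambda>x. ennreal (exp (\<theta> * \<bar>\<phi> (F x) - \<phi> x\<bar>)))"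
    by (intro continuous_on_ennreal continuous_intros)
  then show ?thesis unfolding H_def using D(2) by (rule dense_SUP_bound)
qed

text \<open>The measurable \<open>H\<close> can be transported along the common law of the
  operators. The supremum over all \<open>x\<close> from the moment condition enters as an upper
  bound at index \<open>1\<close>.\<close>

lemma H_int: "n \<ge> 1 \<Longrightarrow> (\<integral>\<^sup>+\<omega>. H (A n \<omega>) \<partial>M) < \<infinity>"
proof -
  assume n: "n \<ge> 1"
  have "(\<integral>\<^sup>+\<omega>. H (A n \<omega>) \<partial>M) = (\<integral>\<^sup>+F. H F \<partial>distr M op_space (A n))"
    by (rule nn_integral_distr[symmetric]) (auto intro: A_rv n)
  also have "\<dots> = (\<integral>\<^sup>+F. H F \<partial>distr M op_space (A 1))" using ident[OF n] by simp
  also have "\<dots> = (\<integral>\<^sup>+\<omega>. H (A 1 \<omega>) \<partial>M)"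
    by (rule nn_integral_distr) (auto intro: A_rv)
  also have "\<dots> \<le> (\<integral>\<^sup>+\<omega>. (SUP x. ennreal (exp (\<theta> * \<bar>\<phi> (A 1 \<omega> x) - \<phi> x\<bar>))) \<partial>M)"
    unfolding H_def by (intro nn_integral_mono SUP_subset_mono) auto
  also have "\<dots> < \<infinity>" by (rule expmom)
  finally show ?thesis .
qed

section \<open>Exponential moments of products\<close>

definition HH :: "nat \<Rightarrow> 'w \<Rightarrow> ennreal" where
  "HH n \<omega> = (\<Prod>i\<in>{1..n}. H (A i \<omega>))"

text \<open>\<open>enn2real\<close> sends infinite values of \<open>HH\<close> to \<open>0\<close>.
  They form a null set, so the resulting bound holds almost everywhere.\<close>

definition Z :: "nat \<Rightarrow> 'w \<Rightarrow> real" where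
  "Z n \<omega> = enn2real (HH n \<omega>)"

lemma HA_meas: "i \<ge> 1 \<Longrightarrow> (\<lambda>\<omega>. H (A i \<omega>)) \<in> borel_measurable M"
  by (rule measurable_compose[OF A_rv H_meas])

lemma HH_meas [measurable]: "HH n \<in> borel_measurable M"
  unfolding HH_def[abs_def] by (intro borel_measurable_prod_ennreal HA_meas) auto

lemma HH_int: "(\<integral>\<^sup>+\<omega>. HH n \<omega> \<partial>M) < \<infinity>"
proof -
  have "indep_vars (\<lambda>_. borel) (\<lambda>i \<omega>. H (A i \<omega>)) {1..n}"
    by (rule indep_vars_compose2[OF indep_vars_subset[OF indep]]) auto
  then have "(\<integral>\<^sup>+\<omega>. HH n \<omega> \<partial>M) = (\<Prod>i\<in>{1..n}. \<integral>\<^sup>+\<omega>. H (A i \<omega>) \<partial>M)"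
    unfolding HH_def by (intro indep_vars_nn_integral) auto
  also have "\<dots> < \<infinity>" using H_int by (auto simp: less_top[symmetric] ennreal_prod_eq_top)
  finally show ?thesis .
qed

text \<open>The increment over \<open>n\<close> steps is a sum of one-step increments at random
  positions, each bounded by a supremum over all positions.\<close>

lemma HH_upper: "\<omega> \<in> space M \<Longrightarrow> ennreal (exp (\<theta> * \<bar>U n \<omega> x\<bar>)) \<le> HH n \<omega>"
proof (induction n)
  case 0
  then show ?case by (simp add: U_def HH_def)
next
  case (Suc n)
  let ?y = "X n \<omega> x"
  have "\<bar>U (Suc n) \<omega> x\<bar> \<le> \<bar>U n \<omega> x\<bar> + \<bar>\<phi> (A (Suc n) \<omega> ?y) - \<phi> ?y\<bar>" by (simp add: U_def)
  then have "\<theta> * \<bar>U (Suc n) \<omega> x\<bar> \<le> \<theta> * (\<bar>U n \<omega> x\<bar> + \<bar>\<phi> (A (Suc n) \<omega> ?y) - \<phi> ?y\<bar>)"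
    using \<theta>_pos by (intro mult_left_mono) auto
  then have "exp (\<theta> * \<bar>U (Suc n) \<omega> x\<bar>) \<le> exp (\<theta> * \<bar>U n \<omega> x\<bar>) * exp (\<theta> * \<bar>\<phi> (A (Suc n) \<omega> ?y) - \<phi> ?y\<bar>)"
    by (simp add: exp_add[symmetric] distrib_left)
  then have "ennreal (exp (\<theta> * \<bar>U (Suc n) \<omega> x\<bar>)) \<le> ennreal (exp (\<theta> * \<bar>U n \<omega> x\<bar>)) * ennreal (exp (\<theta> * \<bar>\<phi> (A (Suc n) \<omega> ?y) - \<phi> ?y\<bar>))"
    by (simp add: ennreal_mult'[symmetric] ennreal_leI)
  also have "\<dots> \<le> HH n \<omega> * H (A (Suc n) \<omega>)"
    using Suc by (intro mult_mono H_upper topA) auto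
  also have "\<dots> = HH (Suc n) \<omega>" by (simp add: HH_def)
  finally show ?case .
qed

lemma HH_finite: "AE \<omega> in M. HH n \<omega> \<noteq> \<infinity>"
  using HH_int[of n] by (intro nn_integral_noteq_infinite) auto

sublocale K: weighted_kernel M "U n" "V n" "Z n" \<theta> for n
proof
  show "0 < \<theta>" by (rule \<theta>_pos)
  show "(\<lambda>\<omega>. U n \<omega> x) \<in> borel_measurable M" "(\<lambda>\<omega>. V n \<omega> x) \<in> borel_measurable M" for x
    unfolding U_def V_def by measurable
  show "continuous_on UNIV (U n \<omega>)" if "\<omega> \<in> space M" for \<omega>
    unfolding U_def
    by (intro continuous_on_diff topical_fun_continuous[OF topical_fun_comp[OF top\<phi> X_topical[OF that]]]
        topical_fun_continuous[OF top\<phi>])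
  show "continuous_on UNIV (V n \<omega>)" if "\<omega> \<in> space M" for \<omega>
    unfolding V_def
    by (rule continuous_on_compose2[OF proj_continuous topical_op_continuous[OF X_topical[OF that]]]) auto
  have "(\<integral>\<^sup>+\<omega>. ennreal (Z n \<omega>) \<partial>M) \<le> (\<integral>\<^sup>+\<omega>. HH n \<omega> \<partial>M)"
    unfolding Z_def by (intro nn_integral_mono) (simp add: ennreal_enn2real_if)
  then have "(\<integral>\<^sup>+\<omega>. ennreal (Z n \<omega>) \<partial>M) < \<infinity>" using HH_int[of n] by (rule le_less_trans)
  then show "integrable M (Z n)"
    by (intro integrableI_nonneg) (auto simp: Z_def[abs_def])
  show "AE \<omega> in M. \<forall>x. exp (\<theta> * \<bar>U n \<omega> x\<bar>) \<le> Z n \<omega>"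
    using HH_finite[of n] AE_space
  proof eventually_elim
    case (elim \<omega>)
    show ?case
    proof
      fix x
      have "ennreal (exp (\<theta> * \<bar>U n \<omega> x\<bar>)) \<le> ennreal (Z n \<omega>)"
        using HH_upper[of \<omega> n x] elim by (simp add: Z_def ennreal_enn2real_if)
      then show "exp (\<theta> * \<bar>U n \<omega> x\<bar>) \<le> Z n \<omega>" by (simp add: Z_def ennreal_le_iff)
    qed
  qed
qed

section \<open>Markov property of the Laplace operators\<close>

lemma nn_integral_laplace:
  assumes "\<bar>t\<bar> \<le> \<theta>" "\<And>x. 0 \<le> apply_bcontfun f x"
  shows "(\<integral>\<^sup>+\<omega>. ennreal (exp (t * U n \<omega> x) * f (V n \<omega> x)) \<partial>M) = ennreal (K.laplace n t f x)"
  unfolding K.kop_apply[OF K.adm_exp[OF assms(1)]]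
  using assms(2) by (intro nn_integral_eq_integral K.kernel_int[OF K.adm_exp[OF assms(1)]]) auto

lemma next_step:
  assumes t: "\<bar>t\<bar> \<le> \<theta>" and f: "\<And>x. 0 \<le> apply_bcontfun f x"
  shows "(\<integral>\<^sup>+\<omega>. ennreal (exp (t * (\<phi> (A (Suc n) \<omega> y) - \<phi> y)) * f (proj (A (Suc n) \<omega> y))) \<partial>M)
    = ennreal (K.laplace 1 t f (proj y))"
proof -
  let ?g = "\<lambda>z. ennreal (exp (t * (\<phi> z - \<phi> y)) * f (proj z))"
  have comp: "(\<lambda>F. F y) \<in> measurable op_space borel" by (rule measurable_component_singleton) simp
  have g: "(\<lambda>F. ?g (F y)) \<in> borel_measurable op_space"
    by (rule measurable_compose[OF comp]) measurable
  have "(\<integral>\<^sup>+\<omega>. ?g (A (Suc n) \<omega> y) \<partial>M) = (\<integral>\<^sup>+F. ?g (F y) \<partial>distr M op_space (A (Suc n)))"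
    by (rule nn_integral_distr[symmetric]) (auto intro: A_rv g)
  also have "\<dots> = (\<integral>\<^sup>+F. ?g (F y) \<partial>distr M op_space (A 1))" using ident[of "Suc n"] by simp
  also have "\<dots> = (\<integral>\<^sup>+\<omega>. ?g (A 1 \<omega> y) \<partial>M)"
    by (rule nn_integral_distr) (auto intro: A_rv g)
  also have "\<dots> = (\<integral>\<^sup>+\<omega>. ennreal (exp (t * U 1 \<omega> (proj y)) * f (V 1 \<omega> (proj y))) \<partial>M)"
    by (intro nn_integral_cong) (simp add: U_proj V_proj, simp add: U_def V_def)
  also have "\<dots> = ennreal (K.laplace 1 t f (proj y))" by (rule nn_integral_laplace[OF t f])
  finally show ?thesis .
qed

lemma laplace_nonneg:
  assumes "\<bar>t\<bar> \<le> \<theta>" "\<And>x. 0 \<le> apply_bcontfun f x"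
  shows "0 \<le> K.laplace n t f x"
  unfolding K.kop_apply[OF K.adm_exp[OF assms(1)]] using assms(2) by simp

text \<open>\<open>U (Suc n)\<close> is the increment up to time \<open>n\<close> plus the next one,
  and the latter depends on the position only through its projective class. For nonnegative
  \<open>f\<close>, Tonelli's theorem integrates out the last operator.\<close>

lemma laplace_Suc:
  assumes t: "\<bar>t\<bar> \<le> \<theta>" and f: "\<And>x. 0 \<le> apply_bcontfun f x"
  shows "K.laplace (Suc n) t f = K.laplace n t (K.laplace 1 t f)"
proof (rule bcontfun_eqI)
  fix x
  let ?N = "present (Suc n)"
  let ?P = "\<lambda>\<omega>. X n \<omega> x"
  let ?g = "\<lambda>y. ennreal (exp (t * (\<phi> y - \<phi> x)))"
  let ?h = "\<lambda>y \<omega>. ennreal (exp (t * (\<phi> (A (Suc n) \<omega> y) - \<phi> y)) * f (proj (A (Suc n) \<omega> y)))"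
  have idm: "(\<lambda>\<omega>. \<omega>) \<in> measurable M ?N" by (rule present_id)
  have Am: "(\<lambda>p. A (Suc n) (snd p) (fst p)) \<in> borel_measurable (borel \<Otimes>\<^sub>M ?N)"
  proof (rule borel_measurable_Caratheodory[where f = "\<lambda>p. A (Suc n) (snd p)" and Y = fst])
    show "(\<lambda>p. A (Suc n) (snd p) y) \<in> borel_measurable (borel \<Otimes>\<^sub>M ?N)" for y
      by (rule measurable_compose[OF measurable_snd A_meas_present]) simp
  qed (auto simp: space_pair_measure intro!: A_continuous)
  have hm: "(\<lambda>(y, \<omega>). ?g y * ?h y \<omega>) \<in> borel_measurable (borel \<Otimes>\<^sub>M ?N)"
    unfolding case_prod_beta using Am by measurable
  have pm: "(\<lambda>\<omega>. (?P \<omega>, \<omega>)) \<in> measurable M (borel \<Otimes>\<^sub>M ?N)" using idm by measurable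
  interpret N: prob_space "distr M ?N (\<lambda>\<omega>. \<omega>)" by (rule prob_space_distr[OF idm])
  have "(\<integral>\<^sup>+\<omega>. ennreal (exp (t * U (Suc n) \<omega> x) * f (V (Suc n) \<omega> x)) \<partial>M)
      = (\<integral>\<^sup>+\<omega>. (\<lambda>(y, \<omega>). ?g y * ?h y \<omega>) (?P \<omega>, \<omega>) \<partial>M)"
    by (intro nn_integral_cong)
      (simp add: U_def V_def ennreal_mult'[symmetric] mult.assoc[symmetric] exp_add[symmetric] distrib_left[symmetric])
  also have "\<dots> = (\<integral>\<^sup>+p. (\<lambda>(y, \<omega>). ?g y * ?h y \<omega>) p \<partial>distr M (borel \<Otimes>\<^sub>M ?N) (\<lambda>\<omega>. (?P \<omega>, \<omega>)))"
    by (rule nn_integral_distr[OF pm, symmetric]) (simp add: hm)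
  also have "distr M (borel \<Otimes>\<^sub>M ?N) (\<lambda>\<omega>. (?P \<omega>, \<omega>)) = distr M borel ?P \<Otimes>\<^sub>M distr M ?N (\<lambda>\<omega>. \<omega>)"
    by (rule distr_past_present[symmetric])
  also have "(\<integral>\<^sup>+p. (\<lambda>(y, \<omega>). ?g y * ?h y \<omega>) p \<partial>(distr M borel ?P \<Otimes>\<^sub>M distr M ?N (\<lambda>\<omega>. \<omega>)))
      = (\<integral>\<^sup>+y. (\<integral>\<^sup>+\<omega>. ?g y * ?h y \<omega> \<partial>distr M ?N (\<lambda>\<omega>. \<omega>)) \<partial>distr M borel ?P)"
    using hm by (subst N.nn_integral_fst[symmetric]) (auto simp: measurable_distr_eq1 cong: measurable_cong_sets)
  also have "\<dots> = (\<integral>\<^sup>+y. ennreal (exp (t * (\<phi> y - \<phi> x)) * K.laplace 1 t f (proj y)) \<partial>distr M borel ?P)"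
  proof (intro nn_integral_cong)
    fix y
    have hy: "?h y \<in> borel_measurable ?N"
      using measurable_compose[OF _ hm, of "\<lambda>\<omega>. (y, \<omega>)"] A_meas_present[of "Suc n" y] by measurable
    have "(\<integral>\<^sup>+\<omega>. ?g y * ?h y \<omega> \<partial>distr M ?N (\<lambda>\<omega>. \<omega>)) = ?g y * (\<integral>\<^sup>+\<omega>. ?h y \<omega> \<partial>distr M ?N (\<lambda>\<omega>. \<omega>))"
      using hy by (intro nn_integral_cmult) simp
    also have "(\<integral>\<^sup>+\<omega>. ?h y \<omega> \<partial>distr M ?N (\<lambda>\<omega>. \<omega>)) = (\<integral>\<^sup>+\<omega>. ?h y \<omega> \<partial>M)"
      using hy by (intro nn_integral_distr idm) simp
    also have "\<dots> = ennreal (K.laplace 1 t f (proj y))" by (rule next_step[OF t f])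
    finally show "(\<integral>\<^sup>+\<omega>. ?g y * ?h y \<omega> \<partial>distr M ?N (\<lambda>\<omega>. \<omega>))
      = ennreal (exp (t * (\<phi> y - \<phi> x)) * K.laplace 1 t f (proj y))"
      by (simp add: ennreal_mult')
  qed
  also have "\<dots> = (\<integral>\<^sup>+\<omega>. ennreal (exp (t * U n \<omega> x) * K.laplace 1 t f (V n \<omega> x)) \<partial>M)"
    unfolding U_def V_def by (rule nn_integral_distr) measurable
  also have "\<dots> = ennreal (K.laplace n t (K.laplace 1 t f) x)"
    by (intro nn_integral_laplace t laplace_nonneg f)
  finally have "ennreal (K.laplace (Suc n) t f x) = ennreal (K.laplace n t (K.laplace 1 t f) x)"
    by (simp add: nn_integral_laplace[OF t f])
  then show "K.laplace (Suc n) t f x = K.laplace n t (K.laplace 1 t f) x"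
    by (simp add: laplace_nonneg t f)
qed

lemma laplace_0: "\<bar>t\<bar> \<le> \<theta> \<Longrightarrow> apply_bcontfun (K.laplace 0 t f) x = f (proj x)"
  unfolding K.kop_apply[OF K.adm_exp] by (simp add: U_def V_def prob_space)

text \<open>\<open>K.laplace 0 t\<close> is composition with \<open>proj\<close> and not the
  identity; the base case holds because \<open>proj\<close> fixes the values of
  \<open>V n\<close>.\<close>

lemma laplace_add:
  assumes t: "\<bar>t\<bar> \<le> \<theta>" and f: "\<And>x. 0 \<le> apply_bcontfun f x"
  shows "K.laplace (n + m) t f = K.laplace n t (K.laplace m t f)"
  using f
proof (induction m arbitrary: f)
  case 0
  show ?case
  proof (rule bcontfun_eqI)
    fix x
    have "K.laplace n t (K.laplace 0 t f) x = expectation (\<lambda>\<omega>. exp (t * U n \<omega> x) * K.laplace 0 t f (V n \<omega> x))"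
      by (rule K.kop_apply[OF K.adm_exp[OF t]])
    also have "\<dots> = expectation (\<lambda>\<omega>. exp (t * U n \<omega> x) * f (V n \<omega> x))"
      by (simp only: laplace_0[OF t] V_def proj_proj)
    also have "\<dots> = K.laplace n t f x"
      by (rule K.kop_apply[OF K.adm_exp[OF t], symmetric])
    finally show "K.laplace (n + 0) t f x = K.laplace n t (K.laplace 0 t f) x" by simp
  qed
next
  case (Suc m)
  have "K.laplace (n + Suc m) t f = K.laplace (n + m) t (K.laplace 1 t f)"
    unfolding add_Suc_right by (rule laplace_Suc[OF t Suc.prems])
  also have "\<dots> = K.laplace n t (K.laplace m t (K.laplace 1 t f))"
    by (intro Suc.IH laplace_nonneg t Suc.prems)
  also have "\<dots> = K.laplace n t (K.laplace (Suc m) t f)"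
    by (simp only: laplace_Suc[OF t Suc.prems, of m])
  finally show ?case .
qed

lemma laplace_funpow:
  assumes t: "\<bar>t\<bar> \<le> \<theta>"
  shows "(K.laplace n t ^^ k) one_bcontfun = K.laplace (n * k) t one_bcontfun"
proof (induction k)
  case 0
  show ?case by (intro bcontfun_eqI) (simp add: laplace_0[OF t])
next
  case (Suc k)
  then show ?case using laplace_add[OF t, of one_bcontfun n "n * k"] by simp
qed

end

section \<open>Asymptotics of the Laplace transforms\<close>

lemma abs_ln_diff_le:
  fixes a x C :: real
  assumes "0 < a" "0 < x" "exp (- C) * a \<le> x" "x \<le> exp C * a"
  shows "\<bar>ln x - ln a\<bar> \<le> C"
proof -
  have pos: "0 < exp c * a" for c using assms by simp
  have "ln (exp (- C) * a) \<le> ln x" by (rule iffD2[OF ln_le_cancel_iff[OF pos assms(2)] assms(3)])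
  moreover have "ln x \<le> ln (exp C * a)" by (rule iffD2[OF ln_le_cancel_iff[OF assms(2) pos] assms(4)])
  ultimately show ?thesis using assms by (simp add: ln_mult abs_le_iff)
qed

lemma LIMSEQ_ln_div:
  assumes "\<And>n. \<bar>ln (a n) - real n * l\<bar> \<le> C"
  shows "(\<lambda>n. ln (a n) / real n) \<longlonglongrightarrow> l"
proof (rule LIM_zero_cancel, rule Lim_null_comparison)
  show "\<forall>\<^sub>F n in sequentially. norm (ln (a n) / real n - l) \<le> C / real n"
    using eventually_gt_at_top[of 0]
  proof eventually_elim
    case (elim n)
    then have "ln (a n) / real n - l = (ln (a n) - real n * l) / real n"
      by (simp add: field_simps)
    then have "norm (ln (a n) / real n - l) = \<bar>ln (a n) - real n * l\<bar> / real n" by simp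
    also have "\<dots> \<le> C / real n" using assms[of n] by (intro divide_right_mono) auto
    finally show ?case .
  qed
  show "(\<lambda>n. C / real n) \<longlonglongrightarrow> 0" by real_asymp
qed

context topical_sequence
begin

definition mgf :: "nat \<Rightarrow> real \<Rightarrow> real" where
  "mgf n t = expectation (\<lambda>\<omega>. exp (t * U n \<omega> 0))"

lemma mgf_int: "\<bar>t\<bar> \<le> \<theta> \<Longrightarrow> integrable M (\<lambda>\<omega>. exp (t * U n \<omega> x))"
  using K.kernel_int[OF K.adm_exp, of t n x one_bcontfun] by simp

lemma mgf_eq: "\<bar>t\<bar> \<le> \<theta> \<Longrightarrow> mgf n t = K.laplace n t one_bcontfun 0"
  by (simp add: mgf_def K.kop_apply[OF K.adm_exp])

lemma mgf_pos: "\<bar>t\<bar> \<le> \<theta> \<Longrightarrow> 0 < mgf n t"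
  using K.laplace_one_lower[of t n] mgf_eq[of t n] by (metis less_le_trans)

lemma mgf_asymptotics:
  assumes N: "N \<ge> 1" and pos: "0 < prob {\<omega>\<in>space M. rank1 (X N \<omega>)}"
  obtains t0 L L' where "0 < t0" "t0 \<le> \<theta>"
    "\<And>t. \<bar>t\<bar> < t0 \<Longrightarrow> (L has_real_derivative L' t) (at t)"
    "\<And>t. \<bar>t\<bar> < t0 \<Longrightarrow> \<exists>C. \<forall>n. \<bar>ln (mgf n t) - real n * L t\<bar> \<le> C"
proof -
  let ?G = "{\<omega>\<in>space M. rank1 (X N \<omega>)}"
  interpret F: forgetful_kernel M "U N" "V N" "Z N" \<theta> ?G
  proof
    \<comment> \<open>Nonmeasurable sets have \<open>measure\<close> equal to \<open>0\<close>, so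
      positive probability entails that the rank 1 event is measurable.\<close>
    show "?G \<in> sets M" using pos measure_notin_sets by fastforce
    show "0 < prob ?G" by (rule pos)
    fix \<omega> x y assume "\<omega> \<in> ?G"
    then obtain a where "X N \<omega> x - X N \<omega> y = a *\<^sub>R one_vec" unfolding rank1_def by blast
    then have "X N \<omega> y = X N \<omega> x - a *\<^sub>R one_vec" by (simp add: algebra_simps)
    then show "V N \<omega> x = V N \<omega> y" by (simp add: V_def proj_shift)
  qed
  obtain t0 where t0: "0 < t0" "t0 \<le> \<theta>" and "perturbed_doeblin (\<lambda>t. K.laplace N t) F.\<nu> (F.\<nu> one_bcontfun) t0"
    using F.perturbed_doeblin_laplace by blast
  then interpret P: perturbed_doeblin "\<lambda>t. K.laplace N t" F.\<nu> "F.\<nu> one_bcontfun" t0 by simp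
  \<comment> \<open>\<open>P.lam\<close> is the eigenvalue of a block of \<open>N\<close> steps,
    hence the division by \<open>N\<close>.\<close>
  define L where "L t = ln (P.lam t) / real N" for t
  define L' where "L' t = (SOME D. (L has_real_derivative D) (at t))" for t
  show ?thesis
  proof
    fix t assume t: "\<bar>t\<bar> < t0"
    have t\<theta>: "\<bar>t\<bar> \<le> \<theta>" using t t0 by simp
    note lam_pos = P.lam(1)[OF t]
    obtain D where "(P.lam has_real_derivative D) (at t)" using P.lam_differentiable[OF t] by blast
    then have "((\<lambda>t. ln (P.lam t) / real N) has_real_derivative (D / P.lam t) / real N) (at t)"
      using lam_pos N by (auto intro!: derivative_eq_intros)
    then show "(L has_real_derivative L' t) (at t)"
      unfolding L'_def L_def[abs_def, symmetric] by (rule someI)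
    obtain a b where ab: "0 < a" "0 < b"
      and bounds: "\<And>n x. a * P.lam t ^ n \<le> (K.laplace N t ^^ n) one_bcontfun x \<and>
        (K.laplace N t ^^ n) one_bcontfun x \<le> b * P.lam t ^ n"
      using P.T_pow_bounds[OF t] by blast
    have "\<forall>r. \<exists>p>0. \<forall>x. p \<le> K.laplace r t one_bcontfun x"
      using K.laplace_one_lower[OF t\<theta>] by metis
    then obtain p where p: "\<And>r. 0 < p r" "\<And>r x. p r \<le> K.laplace r t one_bcontfun x" by metis
    define B where "B r = norm (K.laplace r t one_bcontfun)" for r
    have B: "K.laplace r t one_bcontfun x \<le> B r" for r x
      using abs_apply_le_norm[of "K.laplace r t one_bcontfun" x] by (simp add: B_def)
    have B_pos: "0 < B r" for r using p[of r] B[of r 0] by (meson less_le_trans order_trans)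
    define C where "C = \<bar>ln a\<bar> + \<bar>ln b\<bar> + (\<Sum>r<N. \<bar>ln (p r)\<bar> + \<bar>ln (B r)\<bar>) + \<bar>ln (P.lam t)\<bar>"
    have "\<bar>ln (mgf n t) - real n * L t\<bar> \<le> C" for n
    proof -
      \<comment> \<open>The full blocks give a power of \<open>P.lam t\<close>; the
        \<open>r < N\<close> remaining steps contribute a factor between \<open>p r\<close> and
        \<open>B r\<close>. The sum over all residues in \<open>C\<close> makes the bound
        independent of \<open>n\<close>.\<close>
      define q r where "q = n div N" and "r = n mod N"
      have n: "n = N * q + r" "r < N" using N by (simp_all add: q_def r_def)
      have "K.laplace n t one_bcontfun = K.laplace (N * q) t (K.laplace r t one_bcontfun)"
        unfolding n(1) by (rule laplace_add[OF t\<theta>]) simp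
      then have mgf: "mgf n t = K.laplace (N * q) t (K.laplace r t one_bcontfun) 0"
        by (simp add: mgf_eq[OF t\<theta>])
      have lin: "linear (K.laplace (N * q) t)" by (rule K.kop_linear[OF K.adm_exp[OF t\<theta>]])
      have bd: "a * P.lam t ^ q \<le> K.laplace (N * q) t one_bcontfun 0"
        "K.laplace (N * q) t one_bcontfun 0 \<le> b * P.lam t ^ q"
        using bounds[of q 0] by (simp_all add: laplace_funpow[OF t\<theta>])
      have "p r * (a * P.lam t ^ q) \<le> p r * K.laplace (N * q) t one_bcontfun 0"
        using bd p[of r] by (intro mult_left_mono) auto
      also have "\<dots> = K.laplace (N * q) t (p r *\<^sub>R one_bcontfun) 0" by (simp add: linear_scale[OF lin])
      also have "\<dots> \<le> mgf n t" unfolding mgf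
        by (rule positive_linear_mono[OF lin laplace_nonneg[OF t\<theta>]]) (simp_all add: p)
      finally have lower: "p r * (a * P.lam t ^ q) \<le> mgf n t" .
      have "mgf n t \<le> K.laplace (N * q) t (B r *\<^sub>R one_bcontfun) 0" unfolding mgf
        by (rule positive_linear_mono[OF lin laplace_nonneg[OF t\<theta>]]) (simp_all add: B)
      also have "\<dots> = B r * K.laplace (N * q) t one_bcontfun 0" by (simp add: linear_scale[OF lin])
      also have "\<dots> \<le> B r * (b * P.lam t ^ q)"
        using bd B_pos[of r] by (intro mult_left_mono) auto
      finally have upper: "mgf n t \<le> B r * (b * P.lam t ^ q)" .
      have "ln (p r * (a * P.lam t ^ q)) \<le> ln (mgf n t)" "ln (mgf n t) \<le> ln (B r * (b * P.lam t ^ q))"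
        using lower upper p[of r] B_pos[of r] ab lam_pos mgf_pos[OF t\<theta>, of n] by simp_all
      then have ln: "ln (p r) + ln a + real q * ln (P.lam t) \<le> ln (mgf n t)"
        "ln (mgf n t) \<le> ln (B r) + ln b + real q * ln (P.lam t)"
        using p[of r] B_pos[of r] ab lam_pos by (simp_all add: ln_mult ln_realpow)
      have sum: "\<bar>ln (p r)\<bar> + \<bar>ln (B r)\<bar> \<le> (\<Sum>r<N. \<bar>ln (p r)\<bar> + \<bar>ln (B r)\<bar>)"
        using n(2) by (intro member_le_sum) auto
      have "real n * L t - real q * ln (P.lam t) = (real r / real N) * ln (P.lam t)"
        using N by (simp add: L_def n(1) field_simps)
      then have "\<bar>real n * L t - real q * ln (P.lam t)\<bar> = (real r / real N) * \<bar>ln (P.lam t)\<bar>"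
        by (simp add: abs_mult)
      also have "\<dots> \<le> 1 * \<bar>ln (P.lam t)\<bar>"
        using n(2) by (intro mult_right_mono) (auto simp: field_simps)
      finally show ?thesis using ln sum unfolding C_def by linarith
    qed
    then show "\<exists>C. \<forall>n. \<bar>ln (mgf n t) - real n * L t\<bar> \<le> C" by blast
  qed (rule t0)+
qed

text \<open>With probability bounded below, all coordinates of the normalised position are at least
  \<open>1\<close> in direction \<open>s\<close>, and then a topical \<open>\<phi>\<close> has moved
  by at least \<open>sqrt n\<close> in that direction.\<close>

lemma clt_mgf_lower:
  fixes \<gamma> \<sigma>2 s t :: real
  assumes clt: "weak_conv_measures
        (\<lambda>n. distr M borel (\<lambda>\<omega>. (1 / sqrt (real n)) *\<^sub>R (X n \<omega> 0 - (real n * \<gamma>) *\<^sub>R one_vec)))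
        (distr (density lborel (normal_density 0 (sqrt \<sigma>2))) borel (\<lambda>z. z *\<^sub>R (one_vec :: real ^ 'd)))"
    and \<sigma>2: "\<sigma>2 > 0" and s: "s = 1 \<or> s = - 1" and t: "0 \<le> t" "t \<le> \<theta>"
  obtains m where "0 < m"
    "\<forall>\<^sub>F n in sequentially. m * exp (t * sqrt (real n)) \<le> exp (- (s * t * real n * \<gamma>)) * mgf n (s * t)"
proof -
  \<comment> \<open>A continuous cutoff, \<open>0\<close> where \<open>s * z \<le> 1\<close> and
    \<open>1\<close> where \<open>s * z \<ge> 2\<close>. The product over the coordinates keeps
    positive mass in the limit because the limiting vector has equal coordinates.\<close>
  define k :: "real \<Rightarrow> real" where "k z = max 0 (min 1 (s * z - 1))" for z
  define f :: "real ^ 'd \<Rightarrow> real" where "f v = (\<Prod>i\<in>UNIV. k (v $ i))" for v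
  have k: "0 \<le> k z" "k z \<le> 1" for z by (auto simp: k_def)
  have f: "0 \<le> f v" "f v \<le> 1" for v
    unfolding f_def by (auto intro!: prod_nonneg prod_le_1 k)
  have f_cont: "continuous_on UNIV f"
    unfolding f_def k_def by (intro continuous_intros)
  then have [measurable]: "f \<in> borel_measurable borel" by (rule borel_measurable_continuous_onI)
  have "bounded (range f)" using f by (intro boundedI[of _ 1]) (auto simp: abs_le_iff intro: order_trans[of _ 0])
  define N where "N = density lborel (normal_density 0 (sqrt \<sigma>2))"
  define Wn where "Wn n \<omega> = (1 / sqrt (real n)) *\<^sub>R (X n \<omega> 0 - (real n * \<gamma>) *\<^sub>R (one_vec :: real ^ 'd))" for n \<omega>
  have Wn [measurable]: "Wn n \<in> borel_measurable M" for n unfolding Wn_def by measurable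
  define m where "m = (\<integral>v. f v \<partial>distr N borel (\<lambda>z. z *\<^sub>R (one_vec :: real ^ 'd)))"
  have "(\<lambda>n. \<integral>v. f v \<partial>distr M borel (Wn n)) \<longlonglongrightarrow> m"
    using clt f_cont \<open>bounded (range f)\<close> unfolding weak_conv_measures_def m_def N_def Wn_def by blast
  then have lim: "(\<lambda>n. expectation (\<lambda>\<omega>. f (Wn n \<omega>))) \<longlonglongrightarrow> m"
    by (simp add: integral_distr)
  have "0 < m"
  proof -
    let ?g = "\<lambda>z. normal_density 0 (sqrt \<sigma>2) z * f (z *\<^sub>R one_vec)"
    have m: "m = (\<integral>z. ?g z \<partial>lborel)"
      unfolding m_def N_def by (subst integral_distr) (auto simp: integral_density)
    have int: "integrable lborel ?g"
    proof (rule Bochner_Integration.integrable_bound)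
      show "integrable lborel (normal_density 0 (sqrt \<sigma>2))" using \<sigma>2 by simp
      show "AE z in lborel. norm (?g z) \<le> norm (normal_density 0 (sqrt \<sigma>2) z)"
        using f by (auto simp: abs_mult intro!: mult_left_le)
    qed measurable
    \<comment> \<open>For \<open>z\<close> in \<open>I\<close> every factor of
      \<open>f (z *\<^sub>R one_vec)\<close> is \<open>1\<close> and the density is positive, so
      \<open>m = 0\<close> would make this interval a null set.\<close>
    define I :: "real set" where "I = (if s = 1 then {2..3} else {-3..-2})"
    have "m \<noteq> 0"
    proof
      assume "m = 0"
      then have "AE z in lborel. ?g z = 0"
        unfolding m using f by (subst (asm) integral_nonneg_eq_0_iff_AE[OF int]) auto
      then have "AE z in lborel. z \<notin> I"
      proof eventually_elim
        case (elim z)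
        have "z \<in> I \<Longrightarrow> k z = 1" using s by (auto simp: k_def I_def split: if_splits)
        moreover have "0 < normal_density 0 (sqrt \<sigma>2) z" using \<sigma>2 by (simp add: normal_density_pos)
        ultimately show ?case using elim by (auto simp: f_def)
      qed
      then have "emeasure lborel I = 0"
        by (subst (asm) AE_iff_measurable[of I]) (auto simp: I_def)
      then show False by (auto simp: I_def split: if_splits)
    qed
    moreover have "0 \<le> m" unfolding m_def using f by simp
    ultimately show ?thesis by simp
  qed
  have "\<forall>\<^sub>F n in sequentially. m / 2 < expectation (\<lambda>\<omega>. f (Wn n \<omega>))"
    by (rule order_tendstoD(1)[OF lim]) (use \<open>0 < m\<close> in simp)
  then have "\<forall>\<^sub>F n in sequentially. m / 2 * exp (t * sqrt (real n)) \<le> exp (- (s * t * real n * \<gamma>)) * mgf n (s * t)"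
    using eventually_gt_at_top[of 0]
  proof eventually_elim
    case (elim n)
    have st: "\<bar>s * t\<bar> \<le> \<theta>" using s t by auto
    have "expectation (\<lambda>\<omega>. exp (t * sqrt (real n)) * f (Wn n \<omega>))
        \<le> expectation (\<lambda>\<omega>. exp (- (s * t * real n * \<gamma>)) * exp (s * t * U n \<omega> 0))"
    proof (rule integral_mono)
      show "integrable M (\<lambda>\<omega>. exp (t * sqrt (real n)) * f (Wn n \<omega>))"
        using f by (intro integrable_mult_right integrable_const_bound[of _ 1]) (auto simp: abs_le_iff intro: order_trans[of _ 0])
      show "integrable M (\<lambda>\<omega>. exp (- (s * t * real n * \<gamma>)) * exp (s * t * U n \<omega> 0))"
        by (intro integrable_mult_right mgf_int st)
      fix \<omega> assume \<omega>: "\<omega> \<in> space M"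
      show "exp (t * sqrt (real n)) * f (Wn n \<omega>) \<le> exp (- (s * t * real n * \<gamma>)) * exp (s * t * U n \<omega> 0)"
      proof (cases "f (Wn n \<omega>) = 0")
        case False
        have W: "1 \<le> s * Wn n \<omega> $ i" for i
        proof (rule ccontr)
          assume "\<not> ?thesis"
          then have "k (Wn n \<omega> $ i) = 0" by (simp add: k_def)
          then have "f (Wn n \<omega>) = 0" unfolding f_def by (intro prod_zero) auto
          with False show False by simp
        qed
        have X: "sqrt (real n) \<le> s * (X n \<omega> 0 $ i - real n * \<gamma>)" for i
          using W[of i] elim(2) by (simp add: Wn_def field_simps)
        have "sqrt (real n) \<le> s * (U n \<omega> 0 - real n * \<gamma>)"
          using s
        proof
          assume "s = 1"
          \<comment> \<open>Written as a shift of \<open>0\<close>, the vector produces the term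
            \<open>\<phi> 0\<close> that \<open>U\<close> subtracts.\<close>
          have "\<phi> (0 + (real n * \<gamma> + sqrt (real n)) *\<^sub>R one_vec) \<le> \<phi> (X n \<omega> 0)"
            by (rule topical_fun_mono[OF top\<phi>]) (use X \<open>s = 1\<close> in \<open>auto simp: algebra_simps\<close>)
          then show ?thesis using \<open>s = 1\<close> unfolding topical_fun_add[OF top\<phi>] by (simp add: U_def)
        next
          assume "s = - 1"
          have "\<phi> (X n \<omega> 0) \<le> \<phi> (0 + (real n * \<gamma> - sqrt (real n)) *\<^sub>R one_vec)"
            by (rule topical_fun_mono[OF top\<phi>]) (use X \<open>s = - 1\<close> in \<open>auto simp: algebra_simps\<close>)
          then show ?thesis using \<open>s = - 1\<close> unfolding topical_fun_add[OF top\<phi>] by (simp add: U_def)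
        qed
        then have "t * sqrt (real n) \<le> t * (s * (U n \<omega> 0 - real n * \<gamma>))" using t by (intro mult_left_mono)
        then have "exp (t * sqrt (real n)) \<le> exp (- (s * t * real n * \<gamma>)) * exp (s * t * U n \<omega> 0)"
          by (simp add: exp_add[symmetric] algebra_simps)
        moreover have "exp (t * sqrt (real n)) * f (Wn n \<omega>) \<le> exp (t * sqrt (real n)) * 1"
          using f by (intro mult_left_mono) auto
        ultimately show ?thesis by linarith
      qed simp
    qed
    then have "exp (t * sqrt (real n)) * expectation (\<lambda>\<omega>. f (Wn n \<omega>)) \<le> exp (- (s * t * real n * \<gamma>)) * mgf n (s * t)"
      by (simp add: mgf_def)
    moreover have "m / 2 * exp (t * sqrt (real n)) \<le> exp (t * sqrt (real n)) * expectation (\<lambda>\<omega>. f (Wn n \<omega>))"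
      unfolding mult.commute[of "m / 2"] using elim(1) by (intro mult_left_mono) auto
    ultimately show ?case by (rule order_trans[rotated])
  qed
  then show ?thesis using that[of "m / 2"] \<open>0 < m\<close> by simp
qed

text \<open>If \<open>l - t * \<gamma> \<le> 0\<close>, the bounded error keeps the centred Laplace
  transforms below \<open>exp C\<close>, while the central limit theorem makes them grow like
  \<open>exp (\<bar>t\<bar> * sqrt n)\<close>. An error of merely \<open>o(n)\<close> would be
  compatible with that growth.\<close>

lemma cumulant_pos:
  fixes \<gamma> \<sigma>2 t l :: real
  assumes clt: "weak_conv_measures
        (\<lambda>n. distr M borel (\<lambda>\<omega>. (1 / sqrt (real n)) *\<^sub>R (X n \<omega> 0 - (real n * \<gamma>) *\<^sub>R one_vec)))
        (distr (density lborel (normal_density 0 (sqrt \<sigma>2))) borel (\<lambda>z. z *\<^sub>R (one_vec :: real ^ 'd)))"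
    and \<sigma>2: "\<sigma>2 > 0" and t: "t \<noteq> 0" "\<bar>t\<bar> \<le> \<theta>"
    and C: "\<And>n. \<bar>ln (mgf n t) - real n * l\<bar> \<le> C"
  shows "0 < l - t * \<gamma>"
proof (rule ccontr)
  assume neg: "\<not> 0 < l - t * \<gamma>"
  have s: "sgn t = 1 \<or> sgn t = - 1" using t by (auto simp: sgn_real_def)
  obtain m where m: "0 < m" and
    ev: "\<forall>\<^sub>F n in sequentially. m * exp (\<bar>t\<bar> * sqrt (real n)) \<le> exp (- (sgn t * \<bar>t\<bar> * real n * \<gamma>)) * mgf n (sgn t * \<bar>t\<bar>)"
    using clt_mgf_lower[OF clt \<sigma>2 s, of "\<bar>t\<bar>"] t by auto
  have "\<forall>\<^sub>F n in sequentially. exp C / m < exp (\<bar>t\<bar> * sqrt (real n))"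
    using t m by real_asymp
  with ev have "\<forall>\<^sub>F n in sequentially. False"
  proof eventually_elim
    case (elim n)
    have "ln (mgf n t) \<le> C + real n * l" using abs_le_D1[OF C[of n]] by simp
    then have "mgf n t \<le> exp (C + real n * l)"
      using mgf_pos[OF t(2), of n] by (metis exp_le_cancel_iff exp_ln)
    then have "exp (- (t * real n * \<gamma>)) * mgf n t \<le> exp (- (t * real n * \<gamma>)) * exp (C + real n * l)"
      by simp
    also have "\<dots> = exp (C + real n * (l - t * \<gamma>))" by (simp add: exp_add[symmetric] algebra_simps)
    also have "\<dots> \<le> exp C" using neg by (simp add: mult_nonneg_nonpos)
    finally have "m * exp (\<bar>t\<bar> * sqrt (real n)) \<le> exp C" using elim(1) by (simp add: sgn_mult_abs)
    then show False using elim(2) m by (simp add: field_simps)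
  qed
  then show False by simp
qed

text \<open>Products of topical operators are nonexpansive, so for each \<open>\<omega>\<close> a
  start within distance \<open>B\<close> of \<open>0\<close> changes \<open>\<phi>\<close> by at
  most \<open>B\<close>. The term \<open>\<bar>\<phi> 0\<bar>\<close> appears because
  \<open>U\<close> measures from \<open>\<phi> 0\<close>.\<close>

lemma mgf_initial:
  fixes X0 :: "'w \<Rightarrow> real ^ 'd" and \<gamma> :: real
  assumes X0: "X0 \<in> borel_measurable M" "\<forall>\<omega>\<in>space M. norm (X0 \<omega>) \<le> B" and t: "\<bar>t\<bar> \<le> \<theta>"
  defines "Y \<equiv> \<lambda>n \<omega>. \<phi> (xseq A X0 n \<omega>) - real n * \<gamma>"
  shows "Y n \<in> borel_measurable M" "integrable M (\<lambda>\<omega>. exp (t * Y n \<omega>))"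
    "\<bar>ln (expectation (\<lambda>\<omega>. exp (t * Y n \<omega>))) - (ln (mgf n t) - t * real n * \<gamma>)\<bar> \<le> \<bar>t\<bar> * (B + \<bar>\<phi> 0\<bar>)"
proof -
  define C where "C = \<bar>t\<bar> * (B + \<bar>\<phi> 0\<bar>)"
  have [measurable]: "(\<lambda>\<omega>. X n \<omega> (X0 \<omega>)) \<in> borel_measurable M" by (rule X_meas_comp[OF X0(1)])
  show Ym[measurable]: "Y n \<in> borel_measurable M" unfolding Y_def xseq_eq_X by measurable
  have near: "\<bar>t * Y n \<omega> - (t * U n \<omega> 0 - t * real n * \<gamma>)\<bar> \<le> C" if \<omega>: "\<omega> \<in> space M" for \<omega>
  proof -
    have "\<bar>\<phi> (X n \<omega> (X0 \<omega>)) - \<phi> (X n \<omega> 0)\<bar> \<le> norm (X0 \<omega> - 0)"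
      by (rule topical_fun_lipschitz[OF topical_fun_comp[OF top\<phi> X_topical[OF \<omega>]]])
    then have "\<bar>\<phi> (X n \<omega> (X0 \<omega>)) - \<phi> (X n \<omega> 0) + \<phi> 0\<bar> \<le> B + \<bar>\<phi> 0\<bar>"
      using bspec[OF X0(2) \<omega>] by simp
    then have "\<bar>t\<bar> * \<bar>\<phi> (X n \<omega> (X0 \<omega>)) - \<phi> (X n \<omega> 0) + \<phi> 0\<bar> \<le> C"
      unfolding C_def by (intro mult_left_mono) auto
    moreover have "t * Y n \<omega> - (t * U n \<omega> 0 - t * real n * \<gamma>) = t * (\<phi> (X n \<omega> (X0 \<omega>)) - \<phi> (X n \<omega> 0) + \<phi> 0)"
      by (simp add: Y_def xseq_eq_X U_def algebra_simps)
    ultimately show ?thesis by (simp add: abs_mult)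
  qed
  let ?e = "exp (- (t * real n * \<gamma>))"
  have up: "exp (t * Y n \<omega>) \<le> exp C * (?e * exp (t * U n \<omega> 0))" if "\<omega> \<in> space M" for \<omega>
    using abs_le_D1[OF near[OF that]] by (simp add: exp_add[symmetric])
  have low: "exp (- C) * (?e * exp (t * U n \<omega> 0)) \<le> exp (t * Y n \<omega>)" if "\<omega> \<in> space M" for \<omega>
    using abs_le_D2[OF near[OF that]] by (simp add: exp_add[symmetric])
  have int: "integrable M (\<lambda>\<omega>. c * (?e * exp (t * U n \<omega> 0)))" for c
    by (intro integrable_mult_right mgf_int t)
  show intY: "integrable M (\<lambda>\<omega>. exp (t * Y n \<omega>))"
    by (rule Bochner_Integration.integrable_bound[OF int[of "exp C"]]) (auto intro!: AE_I2 up)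
  have 1: "exp (- C) * (?e * mgf n t) \<le> expectation (\<lambda>\<omega>. exp (t * Y n \<omega>))"
    using integral_mono[OF int[of "exp (- C)"] intY low] by (simp add: mgf_def)
  have 2: "expectation (\<lambda>\<omega>. exp (t * Y n \<omega>)) \<le> exp C * (?e * mgf n t)"
    using integral_mono[OF intY int[of "exp C"] up] by (simp add: mgf_def)
  have pos: "0 < ?e * mgf n t" using mgf_pos[OF t] by simp
  then have "0 < exp (- C) * (?e * mgf n t)" by (intro mult_pos_pos[of "exp (- C)"]) simp_all
  then have "0 < expectation (\<lambda>\<omega>. exp (t * Y n \<omega>))" using 1 by linarith
  then have "\<bar>ln (expectation (\<lambda>\<omega>. exp (t * Y n \<omega>))) - ln (?e * mgf n t)\<bar> \<le> C"
    using abs_ln_diff_le[OF pos _ 1 2] by simp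
  moreover have "ln (?e * mgf n t) = ln (mgf n t) - t * real n * \<gamma>"
    using mgf_pos[OF t, of n] by (simp add: ln_mult)
  ultimately show "\<bar>ln (expectation (\<lambda>\<omega>. exp (t * Y n \<omega>))) - (ln (mgf n t) - t * real n * \<gamma>)\<bar> \<le> \<bar>t\<bar> * (B + \<bar>\<phi> 0\<bar>)"
    by (simp add: C_def)
qed

lemma tails:
  fixes \<gamma> :: real
  assumes L: "cumulant_limit (\<lambda>t. L t - t * \<gamma>) L' t0 r \<delta>" and t0: "t0 \<le> \<theta>"
    and asymp: "\<forall>t. \<bar>t\<bar> < t0 \<longrightarrow> (\<exists>C. \<forall>n. \<bar>ln (mgf n t) - real n * L t\<bar> \<le> C)"
    and X0: "X0 \<in> borel_measurable M" "\<forall>\<omega>\<in>space M. norm (X0 \<omega>) \<le> B"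
    and e: "0 < e" "e < \<delta>"
  defines "c \<equiv> legendre (\<lambda>t. L t - t * \<gamma>) r"
  shows "\<forall>\<^sub>F n in sequentially. 0 < prob {\<omega>\<in>space M. \<phi> (xseq A X0 n \<omega>) - real n * \<gamma> > real n * e}"
    and "(\<lambda>n. ln (prob {\<omega>\<in>space M. \<phi> (xseq A X0 n \<omega>) - real n * \<gamma> > real n * e}) / real n) \<longlonglongrightarrow> - c e"
    and "\<forall>\<^sub>F n in sequentially. 0 < prob {\<omega>\<in>space M. \<phi> (xseq A X0 n \<omega>) - real n * \<gamma> < - (real n * e)}"
    and "(\<lambda>n. ln (prob {\<omega>\<in>space M. \<phi> (xseq A X0 n \<omega>) - real n * \<gamma> < - (real n * e)}) / real n) \<longlonglongrightarrow> - c (- e)"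
proof -
  let ?Y = "\<lambda>n \<omega>. \<phi> (xseq A X0 n \<omega>) - real n * \<gamma>"
  have small: "\<bar>t\<bar> < t0 \<Longrightarrow> \<bar>t\<bar> \<le> \<theta>" for t using t0 by simp
  note Y = mgf_initial[OF X0, where \<gamma> = \<gamma>]
  have lim: "(\<lambda>n. ln (expectation (\<lambda>\<omega>. exp (t * ?Y n \<omega>))) / real n) \<longlonglongrightarrow> L t - t * \<gamma>" if t: "\<bar>t\<bar> < t0" for t
  proof -
    obtain C where C: "\<And>n. \<bar>ln (mgf n t) - real n * L t\<bar> \<le> C" using asymp t by blast
    show ?thesis
    proof (rule LIMSEQ_ln_div[where C = "\<bar>t\<bar> * (B + \<bar>\<phi> 0\<bar>) + C"])
      fix n
      have "real n * (L t - t * \<gamma>) = real n * L t - t * real n * \<gamma>" by (simp add: algebra_simps)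
      then show "\<bar>ln (expectation (\<lambda>\<omega>. exp (t * ?Y n \<omega>))) - real n * (L t - t * \<gamma>)\<bar> \<le> \<bar>t\<bar> * (B + \<bar>\<phi> 0\<bar>) + C"
        using Y(3)[OF small[OF t], of n] C[of n] by linarith
    qed
  qed
  interpret R: cumulant_limit "\<lambda>t. L t - t * \<gamma>" L' t0 r \<delta> by (rule L)
  interpret up: gaertner_ellis M "\<lambda>t. L t - t * \<gamma>" L' t0 r \<delta> ?Y
  proof unfold_locales
    show "?Y n \<in> borel_measurable M" for n
      by (rule Y(1)[of 0]) (use \<theta>_pos in simp)
    show "integrable M (\<lambda>\<omega>. exp (t * ?Y n \<omega>))" if "\<bar>t\<bar> < t0" for n t
      by (rule Y(2)[OF small[OF that]])
  qed (rule lim)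
  \<comment> \<open>The lower tail of \<open>?Y\<close> is the upper tail of its negative, whose
    cumulants are the reflected ones; \<open>- - t\<close> keeps the form in which
    \<open>reflect\<close> delivers them.\<close>
  interpret R': cumulant_limit "\<lambda>t. L (- t) - - t * \<gamma>" "\<lambda>t. - L' (- t)" t0 r \<delta> by (rule R.reflect)
  interpret low: gaertner_ellis M "\<lambda>t. L (- t) - - t * \<gamma>" "\<lambda>t. - L' (- t)" t0 r \<delta> "\<lambda>n \<omega>. - ?Y n \<omega>"
  proof unfold_locales
    show "(\<lambda>\<omega>. - ?Y n \<omega>) \<in> borel_measurable M" for n using up.meas by (intro borel_measurable_uminus)
    have neg: "a * - b = - a * b" for a b :: real by simp
    fix t assume t: "\<bar>t\<bar> < t0"
    show "integrable M (\<lambda>\<omega>. exp (t * - ?Y n \<omega>))" for n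
      unfolding neg by (rule up.int) (use t in simp)
    show "(\<lambda>n. ln (expectation (\<lambda>\<omega>. exp (t * - ?Y n \<omega>))) / real n) \<longlonglongrightarrow> L (- t) - - t * \<gamma>"
      unfolding neg by (rule up.lim) (use t in simp)
  qed
  show "\<forall>\<^sub>F n in sequentially. 0 < prob {\<omega>\<in>space M. ?Y n \<omega> > real n * e}"
    and "(\<lambda>n. ln (prob {\<omega>\<in>space M. ?Y n \<omega> > real n * e}) / real n) \<longlonglongrightarrow> - c e"
    unfolding c_def by (rule up.tail[OF e])+
  have set_eq: "{\<omega>\<in>space M. ?Y n \<omega> < - (real n * e)} = {\<omega>\<in>space M. real n * e < - ?Y n \<omega>}" for n
    by auto
  have c: "legendre (\<lambda>t. L (- t) - - t * \<gamma>) r e = c (- e)"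
    unfolding c_def by (rule legendre_uminus)
  show "\<forall>\<^sub>F n in sequentially. 0 < prob {\<omega>\<in>space M. ?Y n \<omega> < - (real n * e)}"
    and "(\<lambda>n. ln (prob {\<omega>\<in>space M. ?Y n \<omega> < - (real n * e)}) / real n) \<longlonglongrightarrow> - c (- e)"
    unfolding set_eq c[symmetric] by (rule low.tail[OF e])+
qed

end

theorem theorem2p6:
  fixes M :: "'w measure"
    and A :: "nat \<Rightarrow> 'w \<Rightarrow> real ^ 'd \<Rightarrow> real ^ 'd"
    and \<phi> :: "real ^ 'd \<Rightarrow> real"
    and \<gamma> \<sigma>2 :: real
  assumes prob: "prob_space M"
    and topA: "\<And>n \<omega>. n \<ge> 1 \<Longrightarrow> \<omega> \<in> space M \<Longrightarrow> topical_op (A n \<omega>)"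
    and indep: "prob_space.indep_vars M (\<lambda>_. op_space) A {1..}"
    and ident: "\<And>n. n \<ge> 1 \<Longrightarrow> distr M op_space (A n) = distr M op_space (A 1)"
    and memloss: "\<exists>N. measure M {\<omega> \<in> space M. rank1 (prodA A \<omega> N)} > 0"
    and top\<phi>: "topical_fun \<phi>"
    and expmom: "\<exists>\<theta>>0. (\<integral>\<^sup>+\<omega>. (SUP x. ennreal (exp (\<theta> * \<bar>\<phi> (A 1 \<omega> x) - \<phi> x\<bar>))) \<partial>M) < \<infinity>"
    and lyap: "AE \<omega> in M. (\<lambda>n. (1 / real n) *\<^sub>R xseq A (\<lambda>_. 0) n \<omega>) \<longlonglongrightarrow> \<gamma> *\<^sub>R one_vec"
    and clt: "weak_conv_measures
        (\<lambda>n. distr M borel (\<lambda>\<omega>. (1 / sqrt (real n)) *\<^sub>R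
               (xseq A (\<lambda>_. 0) n \<omega> - (real n * \<gamma>) *\<^sub>R one_vec)))
        (distr (density lborel (normal_density 0 (sqrt \<sigma>2))) borel (\<lambda>z. z *\<^sub>R one_vec))"
    and \<sigma>pos: "\<sigma>2 > 0"
  shows "\<exists>c :: real \<Rightarrow> real. \<exists>\<delta>>0.
           strict_convex_on {-\<delta><..<\<delta>} c \<and>
           (\<forall>e\<in>{-\<delta><..<\<delta>}. c e \<ge> 0 \<and> (c e = 0 \<longleftrightarrow> e = 0)) \<and>
           (\<exists>\<epsilon>0>0. \<epsilon>0 \<le> \<delta> \<and>
             (\<forall>X0 :: 'w \<Rightarrow> real ^ 'd.
                X0 \<in> borel_measurable M \<and> (\<exists>B. \<forall>\<omega>\<in>space M. norm (X0 \<omega>) \<le> B) \<and>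
                prob_space.indep_set M
                   {X0 -` S \<inter> space M | S. S \<in> sets (borel :: (real ^ 'd) measure)}
                   {(\<lambda>\<omega>. \<lambda>n\<in>{1::nat..}. A n \<omega>) -` T \<inter> space M | T.
                      T \<in> sets (PiM {1::nat..} (\<lambda>_. (op_space :: (real ^ 'd \<Rightarrow> real ^ 'd) measure)))}
                \<longrightarrow>
                (\<forall>\<epsilon>. 0 < \<epsilon> \<and> \<epsilon> < \<epsilon>0 \<longrightarrow>
                   (eventually (\<lambda>n. measure M {\<omega>\<in>space M. \<phi> (xseq A X0 n \<omega>) - real n * \<gamma> > real n * \<epsilon>} > 0) sequentially) \<and>
                   (\<lambda>n. ln (measure M {\<omega>\<in>space M. \<phi> (xseq A X0 n \<omega>) - real n * \<gamma> > real n * \<epsilon>}) / real n)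
                      \<longlonglongrightarrow> - c \<epsilon> \<and>
                   (eventually (\<lambda>n. measure M {\<omega>\<in>space M. \<phi> (xseq A X0 n \<omega>) - real n * \<gamma> < - (real n * \<epsilon>)} > 0) sequentially) \<and>
                   (\<lambda>n. ln (measure M {\<omega>\<in>space M. \<phi> (xseq A X0 n \<omega>) - real n * \<gamma> < - (real n * \<epsilon>)}) / real n)
                      \<longlonglongrightarrow> - c (- \<epsilon>))))"
proof -
  obtain \<theta> where \<theta>: "\<theta> > 0" "(\<integral>\<^sup>+\<omega>. (SUP x. ennreal (exp (\<theta> * \<bar>\<phi> (A 1 \<omega> x) - \<phi> x\<bar>))) \<partial>M) < \<infinity>"
    using expmom by blast
  interpret prob_space M by (rule prob)
  interpret topical_sequence M A \<phi> \<theta>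
    by (intro topical_sequence.intro topical_sequence_axioms.intro) (fact prob topA indep ident top\<phi> \<theta>)+
  obtain N0 where N0: "0 < prob {\<omega>\<in>space M. rank1 (X N0 \<omega>)}"
    using memloss unfolding prodA_eq_X by blast
  \<comment> \<open>The identity has rank 1 only in dimension one, where every map has rank 1.\<close>
  have "\<exists>N\<ge>1. 0 < prob {\<omega>\<in>space M. rank1 (X N \<omega>)}"
  proof (cases "N0 = 0")
    case True
    have "{\<omega>\<in>space M. rank1 (X N0 \<omega>)} \<noteq> {}" using N0 by force
    then have id: "\<exists>a. x - y = a *\<^sub>R one_vec" for x y :: "real ^ 'd"
      unfolding True rank1_def by auto
    have "rank1 F" for F :: "real ^ 'd \<Rightarrow> real ^ 'd"
      unfolding rank1_def using id by blast
    then have "{\<omega>\<in>space M. rank1 (X 1 \<omega>)} = space M" by blast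
    then show ?thesis by (intro exI[of _ 1]) (simp add: prob_space)
  next
    case False
    then show ?thesis using N0 by (intro exI[of _ N0]) auto
  qed
  then obtain N where N: "N \<ge> 1" "0 < prob {\<omega>\<in>space M. rank1 (X N \<omega>)}" by blast
  obtain t0 L L' where t0: "0 < t0" "t0 \<le> \<theta>"
    and deriv: "\<And>t. \<bar>t\<bar> < t0 \<Longrightarrow> (L has_real_derivative L' t) (at t)"
    and asymp: "\<And>t. \<bar>t\<bar> < t0 \<Longrightarrow> \<exists>C. \<forall>n. \<bar>ln (mgf n t) - real n * L t\<bar> \<le> C"
    using mgf_asymptotics[OF N] by metis
  let ?L = "\<lambda>t. L t - t * \<gamma>"
  have pos: "0 < ?L t" if t: "\<bar>t\<bar> < t0" "t \<noteq> 0" for t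
  proof -
    obtain C where "\<And>n. \<bar>ln (mgf n t) - real n * L t\<bar> \<le> C" using asymp[OF t(1)] by blast
    then show ?thesis using clt \<sigma>pos t t0 unfolding xseq_eq_X by (intro cumulant_pos) auto
  qed
  have zero: "L 0 = 0"
  proof -
    obtain C where "\<And>n. \<bar>ln (mgf n 0) - real n * L 0\<bar> \<le> C" using asymp[of 0] t0 by auto
    then have "(\<lambda>n. ln (mgf n 0) / real n) \<longlonglongrightarrow> L 0" by (rule LIMSEQ_ln_div)
    moreover have "(\<lambda>n. ln (mgf n 0) / real n) = (\<lambda>n. 0)" by (simp add: mgf_def prob_space)
    ultimately show ?thesis using LIMSEQ_unique tendsto_const by metis
  qed
  define r where "r = t0 / 2"
  have r: "0 < r" "r < t0" using t0 by (auto simp: r_def)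
  \<comment> \<open>The largest slope admissible at both endpoints, positive because the cumulant
    limit is positive away from \<open>0\<close>.\<close>
  define \<delta> where "\<delta> = min (?L r) (?L (- r)) / r"
  have \<delta>: "0 < \<delta>" "\<delta> * r \<le> ?L r" "\<delta> * r \<le> ?L (- r)"
    using pos[of r] pos[of "- r"] r by (auto simp: \<delta>_def)
  have cl: "cumulant_limit ?L (\<lambda>t. L' t - \<gamma>) t0 r \<delta>"
  proof (rule cumulant_limit.intro)
    show "(?L has_real_derivative L' t - \<gamma>) (at t)" if t: "\<bar>t\<bar> < t0" for t
      using DERIV_diff[OF deriv[OF t] DERIV_cmult_right[OF DERIV_ident], of \<gamma>] by simp
    show "?L 0 = 0" using zero by simp
  qed (rule r pos \<delta> | assumption)+
  interpret R: cumulant_limit ?L "\<lambda>t. L' t - \<gamma>" t0 r \<delta> by (rule cl)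
  show ?thesis
  \<comment> \<open>\<open>\<delta>\<close> is the witness both for the domain of \<open>c\<close>
    and for the range of admissible \<open>\<epsilon>\<close>.\<close>
  proof (intro exI[of _ "legendre ?L r"] exI[of _ \<delta>] conjI allI impI ballI)
    fix X0 :: "'w \<Rightarrow> real ^ 'd" and \<epsilon> :: real
    assume X0: "X0 \<in> borel_measurable M \<and> (\<exists>B. \<forall>\<omega>\<in>space M. norm (X0 \<omega>) \<le> B) \<and>
                prob_space.indep_set M
                   {X0 -` S \<inter> space M | S. S \<in> sets (borel :: (real ^ 'd) measure)}
                   {(\<lambda>\<omega>. \<lambda>n\<in>{1::nat..}. A n \<omega>) -` T \<inter> space M | T.
                      T \<in> sets (PiM {1::nat..} (\<lambda>_. (op_space :: (real ^ 'd \<Rightarrow> real ^ 'd) measure)))}"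
      and e: "0 < \<epsilon> \<and> \<epsilon> < \<delta>"
    then obtain B where B: "\<forall>\<omega>\<in>space M. norm (X0 \<omega>) \<le> B" by blast
    have m: "X0 \<in> borel_measurable M" using X0 by blast
    have as: "\<forall>t. \<bar>t\<bar> < t0 \<longrightarrow> (\<exists>C. \<forall>n. \<bar>ln (mgf n t) - real n * L t\<bar> \<le> C)"
      using asymp by blast
    note tl = tails[OF cl t0(2) as m B conjunct1[OF e] conjunct2[OF e]]
    show "eventually (\<lambda>n. measure M {\<omega>\<in>space M. \<phi> (xseq A X0 n \<omega>) - real n * \<gamma> > real n * \<epsilon>} > 0) sequentially"
      by (rule tl(1))
    show "(\<lambda>n. ln (measure M {\<omega>\<in>space M. \<phi> (xseq A X0 n \<omega>) - real n * \<gamma> > real n * \<epsilon>}) / real n)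
        \<longlonglongrightarrow> - legendre ?L r \<epsilon>" by (rule tl(2))
    show "eventually (\<lambda>n. measure M {\<omega>\<in>space M. \<phi> (xseq A X0 n \<omega>) - real n * \<gamma> < - (real n * \<epsilon>)} > 0) sequentially"
      by (rule tl(3))
    show "(\<lambda>n. ln (measure M {\<omega>\<in>space M. \<phi> (xseq A X0 n \<omega>) - real n * \<gamma> < - (real n * \<epsilon>)}) / real n)
        \<longlonglongrightarrow> - legendre ?L r (- \<epsilon>)" by (rule tl(4))
  qed (use \<delta> R.strict_convex_legendre R.legendre_nonneg R.legendre_eq_0_iff in \<open>auto simp: abs_less_iff\<close>)
qed

end
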